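(* Let $p\in[1,\infty]$, let $\omega$ be a fast majorant, and let $f=u+iv=h+\overline{g}$ be a complex-valued harmonic function in $\mathbb{D}$ which is continuous up to the boundary $\mathbb{T}$, where $h,g\in\mathscr{A}(\mathbb{D})$ and $u,v$ are real-valued functions in $\mathbb{D}$. Then the following statements are equivalent. (A1) There is a constant $M>0$ such that for all $z\in\mathbb{D}$: $\left(\int_0^{2\pi}(\mathscr{M}_f(ze^{i\eta}))^p\,d\eta\right)^{1/p}\le M\,\frac{\omega(d_{\mathbb{D}}(z))}{d_{\mathbb{D}}(z)}$ if $p\in[1,\infty)$, and $\mathscr{M}_f(z)\le M\,\frac{\omega(d_{\mathbb{D}}(z))}{d_{\mathbb{D}}(z)}$ if $p=\infty$. (A2) $f\in\Lambda_{\omega,p}(\overline{\mathbb{D}})$. (A3) $h,g\in\Lambda_{\omega,p}(\overline{\mathbb{D}})$. (A4) $|h|,|g|\in\Lambda_{\omega,p}(\overline{\mathbb{D}})$. Furthermore, assume that $f$ is also $K$-quasiregular in $\mathbb{D}$ for some constant $K\in[1,\infty)$, and let $q$ be a real number with $0<q\le p$ if $p<\infty$ and $0<q<\infty$ if $p=\infty$. Then (A1)–(A4) are equivalent to each of the following conditions (A5)–(A11). (A5) $|f|\in\Lambda_{\omega,p}(\overline{\mathbb{D}})$. (A6) $u\in\Lambda_{\omega,p}(\overline{\mathbb{D}})$. (A7) $|u|\in\Lambda_{\omega,p}(\overline{\mathbb{D}})$. (A8) $v\in\Lambda_{\omega,p}(\overline{\mathbb{D}})$. (A9) $|v|\in\Lambda_{\omega,p}(\overline{\mathbb{D}})$.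 (A10) There is a constant $M>0$ such that $\mathscr{Y}_{u,q,p}(z)\le M\,\frac{\omega(d_{\mathbb{D}}(z))}{d_{\mathbb{D}}(z)}$ for all $z\in\mathbb{D}$. (A11) There is a constant $M>0$ such that $\mathscr{Y}_{v,q,p}(z)\le M\,\frac{\omega(d_{\mathbb{D}}(z))}{d_{\mathbb{D}}(z)}$ for all $z\in\mathbb{D}$.
   Context: $\mathbb{D}$ is the open unit disk in $\mathbb{C}$, $\mathbb{T}=\partial\mathbb{D}$, $\mathbb{D}(a,\rho)=\{z:|z-a|<\rho\}$, and $d_{\mathbb{D}}(z)=1-|z|$ is the distance from $z$ to $\mathbb{T}$. $\mathscr{A}(\mathbb{D})$ is the disk algebra: functions analytic in $\mathbb{D}$ and continuous up to the boundary. For a differentiable function $F$, $\mathscr{M}_F(z)=|F_z(z)|+|F_{\overline z}(z)|$, where $F_z=\frac12(F_x-iF_y)$, $F_{\overline z}=\frac12(F_x+iF_y)$. A majorant is a continuous increasing function $\omega:[0,\infty)\to[0,\infty)$ with $\omega(0)=0$ such that $\omega(t)/t$ is non-increasing for $t>0$. It is fast if, for some $\delta_0>0$ and $M>0$, $\int_0^\delta\frac{\omega(t)}{t}\,dt\le M\omega(\delta)$ for all $0<\delta<\delta_0$. For $p\in(0,\infty)$ put $\mathcal{L}_p[F](z_1,z_2)=\left(\int_0^{2\pi}|F(e^{i\eta}z_1)-F(e^{i\eta}z_2)|^p\,d\eta\right)^{1/p}$, and put $\mathcal{L}_\infty[F](z_1,z_2)=|F(z_1)-F(z_2)|$. $\Lambda_{\omega,p}(\overline{\mathbb{D}})$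 is the class of Borel functions $F:\overline{\mathbb{D}}\to\mathbb{C}$ for which there is $M>0$ with $\mathcal{L}_p[F](z_1,z_2)\le M\omega(|z_1-z_2|)$ for all $z_1,z_2\in\overline{\mathbb{D}}$ (functions in $\mathbb{D}$ continuous up to $\mathbb{T}$ are identified with their continuous extensions). A sense-preserving continuous mapping $f:\mathbb{D}\to\mathbb{C}$ is $K$-quasiregular if (1) $f$ is absolutely continuous on lines with locally $L^2$ partial derivatives ($ACL^2$) in $\mathbb{D}$ and $J_f=|f_z|^2-|f_{\overline z}|^2>0$ a.e. in $\mathbb{D}$; (2) $\mathscr{M}_f^2\le KJ_f$ a.e. in $\mathbb{D}$, with $K\ge1$. For a real harmonic function $w$ in $\mathbb{D}$ and $B_z=\mathbb{D}(z,d_{\mathbb{D}}(z)/2)$ with area $|B_z|$, and $dA$ Lebesgue area measure: $\mathscr{Y}_{w,q,p}(z)=\left(\int_0^{2\pi}\left(\frac{1}{|B_z|}\int_{B_z}(\mathscr{M}_w(\xi e^{i\eta}))^q\,dA(\xi)\right)^{p/q}d\eta\right)^{1/p}$ if $0<q\le p<\infty$, and $\mathscr{Y}_{w,q,\infty}(z)=\left(\frac{1}{|B_z|}\int_{B_z}(\mathscr{M}_w(\xi))^q\,dA(\xi)\right)^{1/q}$ if $0<q<p=\infty$. *)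

theory Defs
  imports "HOL-Complex_Analysis.Complex_Analysis"
begin

abbreviation unit_disk :: "complex set" ("\<bbbD>")
  where "\<bbbD> \<equiv> ball 0 1"

abbreviation closed_unit_disk :: "complex set"
  where "closed_unit_disk \<equiv> cball 0 1"

definition dist_bdry :: "complex \<Rightarrow> real"
  where "dist_bdry z = 1 - cmod z"

definition disk_algebra :: "(complex \<Rightarrow> complex) set"
  where "disk_algebra = {h. h holomorphic_on \<bbbD> \<and> continuous_on closed_unit_disk h}"

definition partial_x :: "(complex \<Rightarrow> complex) \<Rightarrow> complex \<Rightarrow> complex"
  where "partial_x F z = vector_derivative (\<lambda>t. F (z + of_real t)) (at 0)"

definition partial_y :: "(complex \<Rightarrow> complex) \<Rightarrow> complex \<Rightarrow> complex"
  where "partial_y F z = vector_derivative (\<lambda>t. F (z + \<i> * of_real t)) (at 0)"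

definition wirtinger :: "(complex \<Rightarrow> complex) \<Rightarrow> complex \<Rightarrow> complex"
  where "wirtinger F z = (partial_x F z - \<i> * partial_y F z) / 2"

definition wirtinger_bar :: "(complex \<Rightarrow> complex) \<Rightarrow> complex \<Rightarrow> complex"
  where "wirtinger_bar F z = (partial_x F z + \<i> * partial_y F z) / 2"

definition max_deriv :: "(complex \<Rightarrow> complex) \<Rightarrow> complex \<Rightarrow> real"
  where "max_deriv F z = cmod (wirtinger F z) + cmod (wirtinger_bar F z)"

definition jacobian :: "(complex \<Rightarrow> complex) \<Rightarrow> complex \<Rightarrow> real"
  where "jacobian F z = (cmod (wirtinger F z))\<^sup>2 - (cmod (wirtinger_bar F z))\<^sup>2"

text \<open>Complex-valued harmonic functions: \<open>C\<^sup>2\<close> with vanishing Laplacian.  Real differentiability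
  of the function and of its first partial derivatives guarantees that the
  partial derivatives below exist.\<close>

definition harmonic_on :: "(complex \<Rightarrow> complex) \<Rightarrow> complex set \<Rightarrow> bool"
  where "harmonic_on f S \<longleftrightarrow>
    f differentiable_on S \<and>
    partial_x f differentiable_on S \<and> partial_y f differentiable_on S \<and>
    continuous_on S (partial_x (partial_x f)) \<and> continuous_on S (partial_y (partial_x f)) \<and>
    continuous_on S (partial_x (partial_y f)) \<and> continuous_on S (partial_y (partial_y f)) \<and>
    (\<forall>z\<in>S. partial_x (partial_x f) z + partial_y (partial_y f) z = 0)"

text \<open>``Increasing'' is read in the weak sense.\<close>

definition majorant :: "(real \<Rightarrow> real) \<Rightarrow> bool"
  where "majorant \<omega> \<longleftrightarrow>
    continuous_on {0..} \<omega> \<and> mono_on {0..} \<omega> \<and> (\<forall>t\<ge>0. 0 \<le> \<omega> t) \<and> \<omega> 0 = 0 \<and>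
    antimono_on {0<..} (\<lambda>t. \<omega> t / t)"

text \<open>Integrability is required explicitly because the library integral of a
  non-integrable function is 0.\<close>

definition fast_majorant :: "(real \<Rightarrow> real) \<Rightarrow> bool"
  where "fast_majorant \<omega> \<longleftrightarrow> majorant \<omega> \<and>
    (\<exists>\<delta>\<^sub>0>0. \<exists>M>0. \<forall>\<delta>. 0 < \<delta> \<and> \<delta> < \<delta>\<^sub>0 \<longrightarrow>
       set_integrable lborel {0<..\<delta>} (\<lambda>t. \<omega> t / t) \<and>
       (LINT t:{0<..\<delta>}|lborel. \<omega> t / t) \<le> M * \<omega> \<delta>)"

text \<open>The exponents \<open>p\<close> are extended reals.  For finite \<open>p\<close>, \<open>Lp_osc\<close> is meaningful only
  under \<open>Lp_osc_finite\<close>, which says that the defining integral is finite.\<close>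

definition Lp_osc_finite ::
    "ereal \<Rightarrow> (complex \<Rightarrow> complex) \<Rightarrow> complex \<Rightarrow> complex \<Rightarrow> bool"
  where "Lp_osc_finite p F z\<^sub>1 z\<^sub>2 \<longleftrightarrow>
    (p < \<infinity> \<longrightarrow> set_integrable lborel {0..2 * pi}
       (\<lambda>\<eta>. cmod (F (cis \<eta> * z\<^sub>1) - F (cis \<eta> * z\<^sub>2)) powr real_of_ereal p))"

definition Lp_osc :: "ereal \<Rightarrow> (complex \<Rightarrow> complex) \<Rightarrow> complex \<Rightarrow> complex \<Rightarrow> real"
  where "Lp_osc p F z\<^sub>1 z\<^sub>2 =
    (if p = \<infinity> then cmod (F z\<^sub>1 - F z\<^sub>2)
     else (LINT \<eta>:{0..2 * pi}|lborel.
             cmod (F (cis \<eta> * z\<^sub>1) - F (cis \<eta> * z\<^sub>2)) powr real_of_ereal p)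
          powr (1 / real_of_ereal p))"

definition Lip_class :: "(real \<Rightarrow> real) \<Rightarrow> ereal \<Rightarrow> (complex \<Rightarrow> complex) set"
  where "Lip_class \<omega> p = {F.
    F \<in> borel_measurable (restrict_space borel closed_unit_disk) \<and>
    (\<exists>M>0. \<forall>z\<^sub>1\<in>closed_unit_disk. \<forall>z\<^sub>2\<in>closed_unit_disk.
       Lp_osc_finite p F z\<^sub>1 z\<^sub>2 \<and> Lp_osc p F z\<^sub>1 z\<^sub>2 \<le> M * \<omega> (dist z\<^sub>1 z\<^sub>2))}"

definition deriv_mean :: "ereal \<Rightarrow> (complex \<Rightarrow> complex) \<Rightarrow> complex \<Rightarrow> real"
  where "deriv_mean p F z =
    (if p = \<infinity> then max_deriv F z
     else (LINT \<eta>:{0..2 * pi}|lborel. max_deriv F (z * cis \<eta>) powr real_of_ereal p)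
          powr (1 / real_of_ereal p))"

definition half_ball :: "complex \<Rightarrow> complex set"
  where "half_ball z = ball z (dist_bdry z / 2)"

definition Y_mean :: "(complex \<Rightarrow> real) \<Rightarrow> real \<Rightarrow> ereal \<Rightarrow> complex \<Rightarrow> real"
  where "Y_mean w q p z =
    (if p = \<infinity> then
       (1 / measure lborel (half_ball z) *
         (LINT \<xi>:half_ball z|lborel. max_deriv (\<lambda>x. of_real (w x)) \<xi> powr q)) powr (1 / q)
     else
       (LINT \<eta>:{0..2 * pi}|lborel.
          (1 / measure lborel (half_ball z) *
            (LINT \<xi>:half_ball z|lborel. max_deriv (\<lambda>x. of_real (w x)) (\<xi> * cis \<eta>) powr q))
          powr (real_of_ereal p / q))
       powr (1 / real_of_ereal p))"

text \<open>The \<open>\<epsilon>\<close>-\<open>\<delta>\<close> definition over finite families of non-overlapping intervals \<open>[s i, t i]\<close>.\<close>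

definition abs_cont_on :: "real \<Rightarrow> real \<Rightarrow> (real \<Rightarrow> complex) \<Rightarrow> bool"
  where "abs_cont_on a b \<phi> \<longleftrightarrow>
    (\<forall>\<epsilon>>0. \<exists>\<delta>>0. \<forall>(n::nat) s t.
       (\<forall>i<n. a \<le> s i \<and> s i \<le> t i \<and> t i \<le> b) \<and>
       disjoint_family_on (\<lambda>i. {s i<..<t i}) {..<n} \<and>
       (\<Sum>i<n. t i - s i) < \<delta>
       \<longrightarrow> (\<Sum>i<n. cmod (\<phi> (t i) - \<phi> (s i))) < \<epsilon>)"

definition ACL_on :: "(complex \<Rightarrow> complex) \<Rightarrow> complex set \<Rightarrow> bool"
  where "ACL_on f S \<longleftrightarrow> continuous_on S f \<and>
    (\<forall>a b c d. a \<le> b \<and> c \<le> d \<and> cbox (Complex a c) (Complex b d) \<subseteq> S \<longrightarrow>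
       (AE y in lborel. y \<in> {c..d} \<longrightarrow> abs_cont_on a b (\<lambda>x. f (Complex x y))) \<and>
       (AE x in lborel. x \<in> {a..b} \<longrightarrow> abs_cont_on c d (\<lambda>y. f (Complex x y))))"

definition ACL2_on :: "(complex \<Rightarrow> complex) \<Rightarrow> complex set \<Rightarrow> bool"
  where "ACL2_on f S \<longleftrightarrow> ACL_on f S \<and>
    (\<forall>C. compact C \<and> C \<subseteq> S \<longrightarrow>
       set_integrable lebesgue C (\<lambda>z. (cmod (partial_x f z))\<^sup>2) \<and>
       set_integrable lebesgue C (\<lambda>z. (cmod (partial_y f z))\<^sup>2))"

text \<open>A continuous planar map is sense-preserving if its topological degree is positive: for every
  Jordan domain \<open>U\<close> with closure in \<open>S\<close> and every \<open>w \<in> f(U) - f(\<partial>U)\<close>, the local degree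
  \<open>\<mu>(w, f, U)\<close>, i.e. the winding number about \<open>w\<close> of the image of the positively
  oriented boundary curve, is positive.\<close>

definition sense_preserving_on :: "(complex \<Rightarrow> complex) \<Rightarrow> complex set \<Rightarrow> bool"
  where "sense_preserving_on f S \<longleftrightarrow>
    (\<forall>\<gamma>. simple_path \<gamma> \<and> pathfinish \<gamma> = pathstart \<gamma> \<and>
         path_image \<gamma> \<union> inside (path_image \<gamma>) \<subseteq> S \<and>
         (\<forall>z\<in>inside (path_image \<gamma>). winding_number \<gamma> z = 1) \<longrightarrow>
       (\<forall>w \<in> f ` inside (path_image \<gamma>) - f ` path_image \<gamma>.
          0 < Re (winding_number (f \<circ> \<gamma>) w)))"

definition quasiregular_on :: "real \<Rightarrow> (complex \<Rightarrow> complex) \<Rightarrow> complex set \<Rightarrow> bool"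
  where "quasiregular_on K f S \<longleftrightarrow> 1 \<le> K \<and>
    continuous_on S f \<and> sense_preserving_on f S \<and>
    ACL2_on f S \<and> (AE z in lborel. z \<in> S \<longrightarrow> jacobian f z > 0) \<and>
    (AE z in lborel. z \<in> S \<longrightarrow> (max_deriv f z)\<^sup>2 \<le> K * jacobian f z)"

end

theory Submission
  imports Defs
begin

text \<open>
All conditions are compared with the growth, measured in \<open>L\<^sup>p\<close> over rotations, of the derivatives
of holomorphic functions.  For \<open>f = h + cnj g\<close> one has \<open>\<M>\<^sub>f = \<bar>h'\<bar> + \<bar>g'\<bar>\<close>, so the first condition says
that \<open>h'\<close> and \<open>g'\<close> grow at most like \<open>\<omega> d / d\<close>, where \<open>d\<close> is the distance to the boundary.  Moreover
\<open>u\<close> and \<open>v\<close> are the real parts of \<open>\<phi> = h + g\<close> and \<open>\<psi> = - \<i> (h - g)\<close>, with \<open>\<M>\<^sub>u = \<bar>\<phi>'\<bar>\<close> and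
\<open>\<M>\<^sub>v = \<bar>\<psi>'\<bar>\<close>.

From growth to smoothness: integrate the derivative along a path that first goes inwards and then
across (Hardy and Littlewood); fastness of the majorant controls the radial parts
(\<open>mean_modulus_of_growth\<close>).  Smoothness of \<open>h\<close> and \<open>g\<close> then passes to \<open>f\<close>, \<open>u\<close>, \<open>v\<close> and all moduli by
the triangle inequality.

From smoothness to growth there is one estimate (\<open>touching_gradient_bound\<close>): if \<open>Re \<psi> \<le> G\<close> with equality
at the centre of a disk of radius \<open>\<rho>\<close>, then \<open>\<rho> \<bar>\<psi>'\<bar>\<close> at the centre is at most a constant times the mean of
\<open>\<bar>G - G(centre)\<bar>\<close> over the boundary circle.  It only sees the positive part of the increment
of \<open>Re \<psi>\<close>, which is why \<open>G\<close> may be a modulus.  With \<open>G = \<bar>h\<bar>\<close> and \<open>\<psi> = c h\<close> for a unimodular constant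
\<open>c\<close> it bounds \<open>h'\<close>; with \<open>G = \<bar>u\<bar>\<close> and \<open>\<psi> = \<plusminus> \<phi>\<close> it bounds \<open>\<phi>'\<close>; with \<open>G = \<bar>f\<bar>\<close> and
\<open>\<psi> = c h + cnj c * g\<close> it bounds \<open>\<bar>h'\<bar> - \<bar>g'\<bar>\<close>.  Bounds for both \<open>\<phi>'\<close> and \<open>\<psi>'\<close> give back \<open>h'\<close> and
\<open>g'\<close>; this settles the first four conditions.

If \<open>f\<close> is quasiregular, then \<open>\<bar>h'\<bar> + \<bar>g'\<bar> \<le> K (\<bar>h'\<bar> - \<bar>g'\<bar>)\<close> everywhere
(\<open>quasiregular_dilatation_bound\<close>), so \<open>\<bar>\<phi>'\<bar>\<close>, \<open>\<bar>\<psi>'\<bar>\<close> and \<open>\<M>\<^sub>f\<close> are comparable pointwise, and each of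
\<open>\<bar>f\<bar>\<close>, \<open>u\<close>, \<open>\<bar>u\<bar>\<close>, \<open>v\<close>, \<open>\<bar>v\<bar>\<close> alone is enough.  The averaged conditions are equivalent to
growth of \<open>\<phi>'\<close> and \<open>\<psi>'\<close> by the sub-mean value property of \<open>\<bar>\<phi>'\<bar>\<^sup>q\<close> over disks, which holds up to a
constant for every \<open>q > 0\<close> (\<open>power_area_submean\<close>, \<open>mean_growth_iff_half_ball_mean\<close>).
\<close>

section \<open>Mean values over rotations\<close>

text \<open>The bound is phrased with the nonnegative integral, so that Tonelli's theorem and Fatou's lemma
apply without any integrability side conditions.  For \<open>p = \<infinity>\<close> a single angle suffices, because
the bounds are always required at every point of a rotation invariant set.\<close>

definition circ_bound :: "ereal \<Rightarrow> (real \<Rightarrow> real) \<Rightarrow> real \<Rightarrow> bool"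
  where "circ_bound p X B \<longleftrightarrow>
    (if p = \<infinity> then X 0 \<le> B
     else (\<integral>\<^sup>+\<eta>\<in>{0..2 * pi}. ennreal (X \<eta> powr real_of_ereal p) \<partial>lborel)
            \<le> ennreal (B powr real_of_ereal p))"

lemma exponent_cases:
  fixes p :: ereal
  assumes "1 \<le> p"
  obtains (infinite) "p = \<infinity>" | (finite) r where "p = ereal r" "1 \<le> r"
  using assms by (cases p) auto

lemma circ_bound_mono:
  assumes "1 \<le> p" and "circ_bound p Y B"
    and "\<And>\<eta>. 0 \<le> X \<eta>" and "\<And>\<eta>. X \<eta> \<le> Y \<eta>" and "0 \<le> B" and "B \<le> B'"
  shows "circ_bound p X B'"
  using assms(1)
proof (cases rule: exponent_cases)
  case infinite
  then show ?thesis
    using assms(2,6) assms(4)[of 0] by (simp add: circ_bound_def)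
next
  case (finite r)
  have "(\<integral>\<^sup>+\<eta>\<in>{0..2 * pi}. ennreal (X \<eta> powr r) \<partial>lborel)
      \<le> (\<integral>\<^sup>+\<eta>\<in>{0..2 * pi}. ennreal (Y \<eta> powr r) \<partial>lborel)"
    using assms(3,4) finite by (intro nn_integral_mono mult_right_mono ennreal_leI powr_mono2) auto
  also have "\<dots> \<le> ennreal (B powr r)"
    using assms(2) finite by (simp add: circ_bound_def)
  also have "\<dots> \<le> ennreal (B' powr r)"
    using assms(5,6) finite by (intro ennreal_leI powr_mono2) auto
  finally show ?thesis
    using finite by (simp add: circ_bound_def)
qed

lemma circ_bound_cmult:
  assumes "1 \<le> p" and X: "circ_bound p X B"
    and [measurable]: "X \<in> borel_measurable borel" and nonneg: "\<And>\<eta>. 0 \<le> X \<eta>" "0 \<le> B" "0 \<le> c"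
  shows "circ_bound p (\<lambda>\<eta>. c * X \<eta>) (c * B)"
  using assms(1)
proof (cases rule: exponent_cases)
  case infinite
  then show ?thesis
    using X nonneg by (auto simp: circ_bound_def intro: mult_left_mono)
next
  case (finite r)
  have "(\<integral>\<^sup>+\<eta>\<in>{0..2 * pi}. ennreal ((c * X \<eta>) powr r) \<partial>lborel)
      = (\<integral>\<^sup>+\<eta>. ennreal (c powr r) * (ennreal (X \<eta> powr r) * indicator {0..2 * pi} \<eta>) \<partial>lborel)"
    using nonneg by (intro nn_integral_cong) (simp add: powr_mult ennreal_mult mult.assoc)
  also have "\<dots> = ennreal (c powr r) * (\<integral>\<^sup>+\<eta>\<in>{0..2 * pi}. ennreal (X \<eta> powr r) \<partial>lborel)"
    by (rule nn_integral_cmult) measurable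
  also have "\<dots> \<le> ennreal (c powr r) * ennreal (B powr r)"
    using X finite by (intro mult_left_mono) (simp_all add: circ_bound_def)
  also have "\<dots> = ennreal ((c * B) powr r)"
    using nonneg by (simp add: powr_mult ennreal_mult)
  finally show ?thesis
    using finite by (simp add: circ_bound_def)
qed

text \<open>The crude constant 4 replaces Minkowski's inequality; all statements below are up to constants.\<close>

lemma circ_bound_add:
  assumes "1 \<le> p" and X: "circ_bound p X A" and Y: "circ_bound p Y B"
    and [measurable]: "X \<in> borel_measurable borel" "Y \<in> borel_measurable borel"
    and nonneg: "\<And>\<eta>. 0 \<le> X \<eta>" "\<And>\<eta>. 0 \<le> Y \<eta>" "0 \<le> A" "0 \<le> B"
  shows "circ_bound p (\<lambda>\<eta>. X \<eta> + Y \<eta>) (4 * (A + B))"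
  using assms(1)
proof (cases rule: exponent_cases)
  case infinite
  then show ?thesis
    using X Y nonneg by (auto simp: circ_bound_def)
next
  case (finite r)
  have pointwise: "(x + y) powr r \<le> 2 powr r * (x powr r + y powr r)" if "0 \<le> x" "0 \<le> y" for x y :: real
  proof -
    have "(x + y) powr r \<le> (2 * max x y) powr r"
      using that finite by (intro powr_mono2) auto
    also have "\<dots> = 2 powr r * max x y powr r"
      using that by (simp add: powr_mult)
    also have "\<dots> \<le> 2 powr r * (x powr r + y powr r)"
      by (intro mult_left_mono) (auto simp: max_def)
    finally show ?thesis .
  qed
  have "(\<integral>\<^sup>+\<eta>\<in>{0..2 * pi}. ennreal ((X \<eta> + Y \<eta>) powr r) \<partial>lborel)
      \<le> (\<integral>\<^sup>+\<eta>. ennreal (2 powr r) * (ennreal (X \<eta> powr r) * indicator {0..2 * pi} \<eta> +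
                ennreal (Y \<eta> powr r) * indicator {0..2 * pi} \<eta>) \<partial>lborel)"
    using pointwise nonneg
    by (intro nn_integral_mono) (auto simp: indicator_def simp flip: ennreal_mult ennreal_plus intro!: ennreal_leI)
  also have "\<dots> = ennreal (2 powr r) * ((\<integral>\<^sup>+\<eta>\<in>{0..2 * pi}. ennreal (X \<eta> powr r) \<partial>lborel) +
       (\<integral>\<^sup>+\<eta>\<in>{0..2 * pi}. ennreal (Y \<eta> powr r) \<partial>lborel))"
    by (simp add: nn_integral_add nn_integral_cmult)
  also have "\<dots> \<le> ennreal (2 powr r) * (ennreal (A powr r) + ennreal (B powr r))"
    using X Y finite by (intro mult_left_mono add_mono) (simp_all add: circ_bound_def)
  also have "\<dots> = ennreal (2 powr r * (A powr r + B powr r))"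
    by (simp add: ennreal_mult ennreal_plus)
  also have "\<dots> \<le> ennreal ((4 * (A + B)) powr r)"
  proof (rule ennreal_leI)
    have "A powr r + B powr r \<le> (A + B) powr r + (A + B) powr r"
      using nonneg finite by (intro add_mono powr_mono2) auto
    also have "\<dots> \<le> 2 powr r * (A + B) powr r"
      using powr_mono[of 1 r 2] finite mult_right_mono[of 2 "2 powr r" "(A + B) powr r"] by simp
    finally have "2 powr r * (A powr r + B powr r) \<le> 2 powr r * (2 powr r * (A + B) powr r)"
      by (intro mult_left_mono) auto
    also have "\<dots> = (2 * (2 * (A + B))) powr r"
      by (simp only: powr_mult[of 2 "A + B" r] powr_mult[of 2 "2 * (A + B)" r])
    finally show "2 powr r * (A powr r + B powr r) \<le> (4 * (A + B)) powr r" by simp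
  qed
  finally show ?thesis
    using finite by (simp add: circ_bound_def)
qed

lemma circ_bound_limit:
  assumes "1 \<le> p" and "0 \<le> B" "0 \<le> m" and "\<And>\<epsilon>. 0 < \<epsilon> \<Longrightarrow> circ_bound p X (B + \<epsilon> * m)"
  shows "circ_bound p X B"
  using assms(1)
proof (cases rule: exponent_cases)
  case infinite
  have lim: "((\<lambda>\<epsilon>. B + \<epsilon> * m) \<longlongrightarrow> B + 0 * m) (at_right 0)"
    by (intro tendsto_intros)
  have "X 0 \<le> B + 0 * m"
    using assms(4) infinite
    by (intro tendsto_le[OF _ lim tendsto_const]) (auto simp: circ_bound_def eventually_at_filter)
  then show ?thesis
    using infinite by (simp add: circ_bound_def)
next
  case (finite r)
  have lim: "((\<lambda>\<epsilon>. ennreal ((B + \<epsilon> * m) powr r)) \<longlongrightarrow> ennreal ((B + 0 * m) powr r)) (at_right 0)"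
    using assms finite
    by (intro tendsto_ennrealI tendsto_powr2 tendsto_intros) (auto simp: eventually_at_filter)
  have "(\<integral>\<^sup>+\<eta>\<in>{0..2 * pi}. ennreal (X \<eta> powr r) \<partial>lborel) \<le> ennreal ((B + 0 * m) powr r)"
    using assms(4) finite
    by (intro tendsto_le[OF _ lim tendsto_const]) (auto simp: circ_bound_def eventually_at_filter)
  then show ?thesis
    using finite by (simp add: circ_bound_def)
qed

text \<open>Jensen's inequality for the measure \<open>b dt\<close> and the function \<open>x / b\<close>: integrate the tangent line
inequality of \<open>u powr r\<close> at the point \<open>s / I\<close>.\<close>

lemma weighted_jensen:
  fixes A :: "'a::euclidean_space set" and x b :: "'a \<Rightarrow> real"
  assumes [measurable]: "A \<in> sets borel" "x \<in> borel_measurable borel" "b \<in> borel_measurable borel"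
    and "1 \<le> r" "0 < I" "0 \<le> s"
    and b: "\<And>t. t \<in> A \<Longrightarrow> 0 < b t" and x: "\<And>t. t \<in> A \<Longrightarrow> 0 \<le> x t"
    and I: "(\<integral>\<^sup>+t\<in>A. ennreal (b t) \<partial>lborel) \<le> ennreal I"
    and s: "ennreal s \<le> (\<integral>\<^sup>+t\<in>A. ennreal (x t) \<partial>lborel)"
  shows "ennreal (s powr r)
    \<le> ennreal (I powr (r - 1)) * (\<integral>\<^sup>+t\<in>A. ennreal (x t powr r * b t powr (1 - r)) \<partial>lborel)"
proof (cases "s = 0")
  case False
  define a where "a = s / I"
  have "a > 0" "s = a * I" using False assms(5,6) by (auto simp: a_def)
  have tangent: "r * a powr (r - 1) * u \<le> u powr r + (r - 1) * a powr r" if "u \<ge> 0" for u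
  proof (cases "u = 0")
    case True
    then show ?thesis using \<open>1 \<le> r\<close> by simp
  next
    case False
    with that have "u > 0" by simp
    have "(u powr r) powr (1 / r) * (a powr r) powr ((r - 1) / r)
        \<le> (1 / r) * u powr r + ((r - 1) / r) * a powr r"
      using \<open>1 \<le> r\<close> \<open>u > 0\<close> \<open>a > 0\<close>
      by (intro Youngs_inequality_0) (auto simp: field_simps)
    then have "u * a powr (r - 1) \<le> (u powr r + (r - 1) * a powr r) / r"
      using \<open>1 \<le> r\<close> \<open>u > 0\<close> \<open>a > 0\<close> by (simp add: powr_powr add_divide_distrib)
    then show ?thesis
      using \<open>1 \<le> r\<close> by (simp add: field_simps)
  qed
  have pointwise: "r * a powr (r - 1) * x t \<le> x t powr r * b t powr (1 - r) + (r - 1) * a powr r * b t"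
    if "t \<in> A" for t
  proof -
    have "b t > 0" "x t \<ge> 0" using b x that by auto
    have "r * a powr (r - 1) * (x t / b t) * b t \<le> ((x t / b t) powr r + (r - 1) * a powr r) * b t"
      using tangent[of "x t / b t"] \<open>b t > 0\<close> \<open>x t \<ge> 0\<close> by (intro mult_right_mono) auto
    moreover have "(x t / b t) powr r * b t = x t powr r * b t powr (1 - r)"
      using \<open>b t > 0\<close> \<open>x t \<ge> 0\<close> by (simp add: powr_divide powr_diff)
    ultimately show ?thesis
      using \<open>b t > 0\<close> by (simp add: algebra_simps)
  qed
  define J where "J = (\<integral>\<^sup>+t\<in>A. ennreal (x t powr r * b t powr (1 - r)) \<partial>lborel)"
  have "ennreal (r * a powr (r - 1) * s) = ennreal (r * a powr (r - 1)) * ennreal s"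
    using assms by (simp add: ennreal_mult)
  also have "\<dots> \<le> ennreal (r * a powr (r - 1)) * (\<integral>\<^sup>+t\<in>A. ennreal (x t) \<partial>lborel)"
    using s by (intro mult_left_mono) auto
  also have "\<dots> = (\<integral>\<^sup>+t. ennreal (r * a powr (r - 1)) * (ennreal (x t) * indicator A t) \<partial>lborel)"
    by (rule nn_integral_cmult[symmetric]) measurable
  also have "\<dots> \<le> (\<integral>\<^sup>+t. ennreal (x t powr r * b t powr (1 - r)) * indicator A t +
       ennreal ((r - 1) * a powr r) * (ennreal (b t) * indicator A t) \<partial>lborel)"
    using pointwise b x \<open>1 \<le> r\<close>
    by (intro nn_integral_mono)
       (auto simp: indicator_def less_imp_le simp flip: ennreal_mult ennreal_plus intro!: ennreal_leI)
  also have "\<dots> = J + ennreal ((r - 1) * a powr r) * (\<integral>\<^sup>+t\<in>A. ennreal (b t) \<partial>lborel)"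
    by (simp add: J_def nn_integral_add nn_integral_cmult)
  also have "\<dots> \<le> J + ennreal ((r - 1) * a powr r) * ennreal I"
    using I by (intro add_left_mono mult_left_mono) auto
  also have "\<dots> = J + ennreal ((r - 1) * a powr r * I)"
    using \<open>1 \<le> r\<close> \<open>0 < I\<close> by (simp add: ennreal_mult)
  finally have ineq: "ennreal (r * a powr (r - 1) * s) \<le> J + ennreal ((r - 1) * a powr r * I)" .
  have "r * a powr (r - 1) * s = a powr r * I + (r - 1) * a powr r * I"
    using \<open>a > 0\<close> \<open>s = a * I\<close> by (simp add: powr_diff field_simps)
  then have "ennreal (a powr r * I) + ennreal ((r - 1) * a powr r * I)
      \<le> J + ennreal ((r - 1) * a powr r * I)"
    using ineq \<open>1 \<le> r\<close> \<open>0 < I\<close> by (simp flip: ennreal_plus)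
  then have "ennreal (a powr r * I) \<le> J"
    by (simp add: ennreal_add_left_cancel_le add.commute)
  then have "ennreal (I powr (r - 1)) * ennreal (a powr r * I) \<le> ennreal (I powr (r - 1)) * J"
    by (intro mult_left_mono) auto
  moreover have "I powr (r - 1) * (a powr r * I) = s powr r"
    using \<open>s = a * I\<close> \<open>0 < I\<close> \<open>a > 0\<close> by (simp add: powr_mult powr_diff)
  ultimately show ?thesis
    using \<open>0 < I\<close> by (simp add: J_def flip: ennreal_mult)
qed (use assms in simp)

text \<open>Minkowski's integral inequality in the form in which it is needed: bounds \<open>b t\<close> on the \<open>L\<^sup>p\<close> norms
of the functions \<open>X t\<close> add up to a bound on the norm of their integral.  Because the bounds are
given in advance, no duality is required: Jensen's inequality with weight \<open>b\<close> is applied at every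
angle, and Tonelli's theorem then lets the weights cancel.\<close>

lemma circ_bound_integral_pos:
  fixes A :: "'a::euclidean_space set"
  assumes "1 \<le> p" and [measurable]: "A \<in> sets borel" "b \<in> borel_measurable borel"
    and meas[measurable]: "(\<lambda>(t, \<eta>). X t \<eta>) \<in> borel_measurable (borel \<Otimes>\<^sub>M borel)"
    and b: "\<And>t. t \<in> A \<Longrightarrow> 0 < b t" and X: "\<And>t \<eta>. t \<in> A \<Longrightarrow> 0 \<le> X t \<eta>"
    and I: "(\<integral>\<^sup>+t\<in>A. ennreal (b t) \<partial>lborel) \<le> ennreal I" "0 < I"
    and Xb: "\<And>t. t \<in> A \<Longrightarrow> circ_bound p (X t) (b t)"
    and Y: "\<And>\<eta>. 0 \<le> Y \<eta>" "\<And>\<eta>. ennreal (Y \<eta>) \<le> (\<integral>\<^sup>+t\<in>A. ennreal (X t \<eta>) \<partial>lborel)"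
  shows "circ_bound p Y I"
  using assms(1)
proof (cases rule: exponent_cases)
  case infinite
  have "ennreal (Y 0) \<le> (\<integral>\<^sup>+t\<in>A. ennreal (X t 0) \<partial>lborel)" by (rule Y(2))
  also have "\<dots> \<le> (\<integral>\<^sup>+t\<in>A. ennreal (b t) \<partial>lborel)"
    using Xb infinite by (intro nn_integral_mono) (auto simp: circ_bound_def indicator_def ennreal_leI)
  also have "\<dots> \<le> ennreal I" by (rule I)
  finally show ?thesis
    using infinite I by (simp add: circ_bound_def)
next
  case (finite r)
  have [measurable]: "(\<lambda>p. X (fst p) (snd p)) \<in> borel_measurable (borel \<Otimes>\<^sub>M borel)"
    using meas by (simp add: case_prod_beta)
  let ?c = "ennreal (I powr (r - 1))"
  have sec: "(\<lambda>t. X t \<eta>) \<in> borel_measurable borel" for \<eta> by measurable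
  have sec2[measurable]: "X t \<in> borel_measurable borel" for t by measurable
  have "(\<integral>\<^sup>+\<eta>\<in>{0..2 * pi}. ennreal (Y \<eta> powr r) \<partial>lborel)
    \<le> (\<integral>\<^sup>+\<eta>. ?c * (\<integral>\<^sup>+t. ennreal (X t \<eta> powr r * b t powr (1 - r)) * indicator A t \<partial>lborel)
          * indicator {0..2 * pi} \<eta> \<partial>lborel)"
    using finite(2) I Y b X sec
    by (intro nn_integral_mono mult_right_mono weighted_jensen) auto
  also have "\<dots> = (\<integral>\<^sup>+\<eta>. (\<integral>\<^sup>+t. ?c * (ennreal (X t \<eta> powr r * b t powr (1 - r)) * indicator A t)
          * indicator {0..2 * pi} \<eta> \<partial>lborel) \<partial>lborel)"
    by (simp add: nn_integral_cmult nn_integral_multc)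
  also have "\<dots> = (\<integral>\<^sup>+t. (\<integral>\<^sup>+\<eta>. ?c * (ennreal (X t \<eta> powr r * b t powr (1 - r)) * indicator A t)
          * indicator {0..2 * pi} \<eta> \<partial>lborel) \<partial>lborel)"
    by (rule lborel_pair.Fubini') measurable
  also have "\<dots> \<le> (\<integral>\<^sup>+t. ?c * (ennreal (b t) * indicator A t) \<partial>lborel)"
  proof (rule nn_integral_mono)
    fix t
    show "(\<integral>\<^sup>+\<eta>. ?c * (ennreal (X t \<eta> powr r * b t powr (1 - r)) * indicator A t)
          * indicator {0..2 * pi} \<eta> \<partial>lborel) \<le> ?c * (ennreal (b t) * indicator A t)"
    proof (cases "t \<in> A")
      case True
      have "(\<integral>\<^sup>+\<eta>. ?c * (ennreal (X t \<eta> powr r * b t powr (1 - r)) * indicator A t)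
          * indicator {0..2 * pi} \<eta> \<partial>lborel)
        = (\<integral>\<^sup>+\<eta>. (?c * ennreal (b t powr (1 - r))) * (ennreal (X t \<eta> powr r) * indicator {0..2 * pi} \<eta>) \<partial>lborel)"
        using True by (intro nn_integral_cong) (simp add: ennreal_mult mult_ac)
      also have "\<dots> = (?c * ennreal (b t powr (1 - r))) *
          (\<integral>\<^sup>+\<eta>\<in>{0..2 * pi}. ennreal (X t \<eta> powr r) \<partial>lborel)"
        by (rule nn_integral_cmult) measurable
      also have "\<dots> \<le> (?c * ennreal (b t powr (1 - r))) * ennreal (b t powr r)"
        using Xb[OF True] finite by (intro mult_left_mono) (simp_all add: circ_bound_def)
      also have "\<dots> = ?c * ennreal (b t)"
        using b[OF True] by (simp add: mult.assoc flip: ennreal_mult powr_add)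
      finally show ?thesis using True by simp
    qed simp
  qed
  also have "\<dots> = ?c * (\<integral>\<^sup>+t\<in>A. ennreal (b t) \<partial>lborel)"
    by (rule nn_integral_cmult) measurable
  also have "\<dots> \<le> ?c * ennreal I" using I by (intro mult_left_mono) auto
  also have "\<dots> = ennreal (I powr r)"
    using I by (simp add: powr_diff flip: ennreal_mult)
  finally show ?thesis
    using finite by (simp add: circ_bound_def)
qed

text \<open>The weight in Jensen's inequality must not vanish; bounds that may be zero (the majorant can vanish
identically) are first increased by a small constant.\<close>

lemma circ_bound_integral:
  fixes A :: "'a::euclidean_space set"
  assumes p: "1 \<le> p" and [measurable]: "A \<in> sets borel" "b \<in> borel_measurable borel"
    and fin: "emeasure lborel A < \<infinity>"
    and meas: "(\<lambda>(t, \<eta>). X t \<eta>) \<in> borel_measurable (borel \<Otimes>\<^sub>M borel)"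
    and b: "\<And>t. t \<in> A \<Longrightarrow> 0 \<le> b t" and X: "\<And>t \<eta>. t \<in> A \<Longrightarrow> 0 \<le> X t \<eta>"
    and I: "(\<integral>\<^sup>+t\<in>A. ennreal (b t) \<partial>lborel) \<le> ennreal I" "0 \<le> I"
    and Xb: "\<And>t. t \<in> A \<Longrightarrow> circ_bound p (X t) (b t)"
    and Y: "\<And>\<eta>. 0 \<le> Y \<eta>" "\<And>\<eta>. ennreal (Y \<eta>) \<le> (\<integral>\<^sup>+t\<in>A. ennreal (X t \<eta>) \<partial>lborel)"
  shows "circ_bound p Y I"
proof (rule circ_bound_limit[OF p I(2), of "measure lborel A + 1"])
  fix \<epsilon> :: real assume \<epsilon>: "0 < \<epsilon>"
  show "circ_bound p Y (I + \<epsilon> * (measure lborel A + 1))"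
  proof (rule circ_bound_integral_pos[OF p _ _ meas _ X _ _ _ Y])
    show "(\<lambda>t. b t + \<epsilon>) \<in> borel_measurable borel" by measurable
    show "0 < b t + \<epsilon>" if "t \<in> A" for t using b[OF that] \<epsilon> by simp
    show "circ_bound p (X t) (b t + \<epsilon>)" if "t \<in> A" for t
      using circ_bound_mono[OF p Xb[OF that]] X b \<epsilon> that by simp
    have "(\<integral>\<^sup>+t\<in>A. ennreal (b t + \<epsilon>) \<partial>lborel)
        = (\<integral>\<^sup>+t. ennreal (b t) * indicator A t + ennreal \<epsilon> * indicator A t \<partial>lborel)"
      using b \<epsilon> by (intro nn_integral_cong) (auto simp: indicator_def ennreal_plus)
    also have "\<dots> = (\<integral>\<^sup>+t\<in>A. ennreal (b t) \<partial>lborel) + ennreal \<epsilon> * emeasure lborel A"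
      by (subst nn_integral_add) (auto simp: nn_integral_cmult_indicator)
    also have "\<dots> \<le> ennreal I + ennreal \<epsilon> * ennreal (measure lborel A + 1)"
      using I fin by (intro add_mono mult_left_mono)
        (auto simp: emeasure_eq_ennreal_measure intro!: ennreal_leI)
    also have "\<dots> = ennreal (I + \<epsilon> * (measure lborel A + 1))"
      using I \<epsilon> by (simp add: ennreal_mult ennreal_plus)
    finally show "(\<integral>\<^sup>+t\<in>A. ennreal (b t + \<epsilon>) \<partial>lborel) \<le> ennreal (I + \<epsilon> * (measure lborel A + 1))" .
    show "0 < I + \<epsilon> * (measure lborel A + 1)"
      using I \<epsilon> by (simp add: add_nonneg_pos add_pos_nonneg)
  qed simp_all
qed (simp_all add: add_nonneg_nonneg)

lemma circ_bound_iff: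
  assumes p: "1 \<le> p" and B: "0 \<le> B"
    and int: "p < \<infinity> \<Longrightarrow> set_integrable lborel {0..2 * pi} (\<lambda>\<eta>. X \<eta> powr real_of_ereal p)"
  shows "(if p = \<infinity> then X 0
     else (LINT \<eta>:{0..2 * pi}|lborel. X \<eta> powr real_of_ereal p) powr (1 / real_of_ereal p)) \<le> B
    \<longleftrightarrow> circ_bound p X B"
  using p
proof (cases rule: exponent_cases)
  case (finite r)
  define L where "L = (LINT \<eta>:{0..2 * pi}|lborel. X \<eta> powr r)"
  have "L \<ge> 0" unfolding L_def set_lebesgue_integral_def by (intro integral_nonneg_AE) auto
  have "ennreal L = (\<integral>\<^sup>+\<eta>\<in>{0..2 * pi}. ennreal (X \<eta> powr r) \<partial>lborel)"
    using int finite unfolding L_def set_lebesgue_integral_def set_integrable_def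
    by (subst nn_integral_eq_integral[symmetric])
       (auto intro!: nn_integral_cong simp: indicator_def)
  then have "circ_bound p X B \<longleftrightarrow> L \<le> B powr r"
    using finite by (simp add: circ_bound_def flip: \<open>ennreal L = _\<close>)
  also have "\<dots> \<longleftrightarrow> L powr (1 / r) \<le> B"
  proof
    assume "L \<le> B powr r"
    then have "L powr (1 / r) \<le> (B powr r) powr (1 / r)"
      using \<open>L \<ge> 0\<close> finite by (intro powr_mono2) auto
    then show "L powr (1 / r) \<le> B" using finite B by (simp add: powr_powr)
  next
    assume "L powr (1 / r) \<le> B"
    then have "(L powr (1 / r)) powr r \<le> B powr r"
      using finite by (intro powr_mono2) auto
    then show "L \<le> B powr r" using finite \<open>L \<ge> 0\<close> by (simp add: powr_powr)
  qed
  finally show ?thesis using finite by (simp add: L_def)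
next
  case infinite
  then show ?thesis by (simp add: circ_bound_def)
qed

lemma set_integrable_powr_of_continuous:
  fixes X :: "real \<Rightarrow> real"
  assumes "1 \<le> p" "p < \<infinity>" and cont: "continuous_on {0..2 * pi} X" and nonneg: "\<And>\<eta>. 0 \<le> X \<eta>"
  shows "set_integrable lborel {0..2 * pi} (\<lambda>\<eta>. X \<eta> powr real_of_ereal p)"
proof -
  obtain r where "p = ereal r" "1 \<le> r" using assms by (cases p) auto
  then have "continuous_on {0..2 * pi} (\<lambda>\<eta>. X \<eta> powr real_of_ereal p)"
    using nonneg by (intro continuous_on_powr' cont continuous_on_const) auto
  then show ?thesis
    by (rule borel_integrable_compact[OF compact_Icc, folded set_integrable_def])
qed

lemma circ_bound_pointwise_limit:
  assumes "1 \<le> p" and X: "\<And>n. circ_bound p (X n) B"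
    and [measurable]: "\<And>n. X n \<in> borel_measurable borel" and nonneg: "\<And>n \<eta>. 0 \<le> X n \<eta>"
    and lim: "\<And>\<eta>. (\<lambda>n. X n \<eta>) \<longlonglongrightarrow> Y \<eta>"
  shows "circ_bound p Y B"
  using assms(1)
proof (cases rule: exponent_cases)
  case infinite
  then show ?thesis
    using X LIMSEQ_le_const2[OF lim[of 0], of B] by (auto simp: circ_bound_def)
next
  case (finite r)
  have "(\<lambda>n. ennreal (X n \<eta> powr r) * indicator {0..2 * pi} \<eta>)
      \<longlonglongrightarrow> ennreal (Y \<eta> powr r) * indicator {0..2 * pi} \<eta>" for \<eta>
  proof -
    have "(\<lambda>n. X n \<eta> powr r) \<longlonglongrightarrow> Y \<eta> powr r"
      using finite nonneg by (intro tendsto_powr2 lim tendsto_const) auto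
    then show ?thesis by (auto simp: indicator_def intro: tendsto_ennrealI)
  qed
  then have "(\<integral>\<^sup>+\<eta>\<in>{0..2 * pi}. ennreal (Y \<eta> powr r) \<partial>lborel)
      = (\<integral>\<^sup>+\<eta>. liminf (\<lambda>n. ennreal (X n \<eta> powr r) * indicator {0..2 * pi} \<eta>) \<partial>lborel)"
    by (intro nn_integral_cong lim_imp_Liminf[symmetric]) auto
  also have "\<dots> \<le> liminf (\<lambda>n. (\<integral>\<^sup>+\<eta>\<in>{0..2 * pi}. ennreal (X n \<eta> powr r) \<partial>lborel))"
    by (rule nn_integral_liminf) simp
  also have "\<dots> \<le> liminf (\<lambda>n. ennreal (B powr r))"
    using X finite by (intro Liminf_mono) (simp add: circ_bound_def)
  also have "\<dots> = ennreal (B powr r)" by (simp add: Liminf_const)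
  finally show ?thesis using finite by (simp add: circ_bound_def)
qed

text \<open>Passing from \<open>X\<close> to its power \<open>q\<close> replaces the exponent \<open>p\<close> by \<open>p / q\<close>, which is at least 1; this
makes Minkowski's inequality available for averages of \<open>q\<close>-th powers.\<close>

lemma circ_bound_powr:
  assumes "1 \<le> p" "0 < q" "ereal q \<le> p"
  obtains p' where "1 \<le> p'"
    "\<And>X B. (\<And>\<eta>. 0 \<le> X \<eta>) \<Longrightarrow> 0 \<le> B \<Longrightarrow>
      circ_bound p X B \<longleftrightarrow> circ_bound p' (\<lambda>\<eta>. X \<eta> powr q) (B powr q)"
  using assms(1)
proof (cases rule: exponent_cases)
  case infinite
  have iff: "x \<le> B \<longleftrightarrow> x powr q \<le> B powr q" if "0 \<le> x" "0 \<le> B" for x B :: real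
    using that \<open>0 < q\<close> powr_mono2[of q x B] powr_less_mono2[of q B x] by (cases "x \<le> B") auto
  show ?thesis
  proof (rule that[of \<infinity>])
    fix X :: "real \<Rightarrow> real" and B :: real
    assume "\<And>\<eta>. 0 \<le> X \<eta>" "0 \<le> B"
    then show "circ_bound p X B \<longleftrightarrow> circ_bound \<infinity> (\<lambda>\<eta>. X \<eta> powr q) (B powr q)"
      unfolding circ_bound_def infinite using iff[of "X 0" B] by simp
  qed simp
next
  case (finite r)
  then have "q \<le> r" using assms by simp
  then show ?thesis
    using finite \<open>0 < q\<close> by (intro that[of "ereal (r / q)"]) (simp_all add: circ_bound_def powr_powr)
qed

section \<open>A gradient estimate from touching functions\<close>

lemma nn_integral_Icc_eq_integral:
  fixes f :: "real \<Rightarrow> real"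
  assumes "continuous_on {a..b} f" and "\<And>t. t \<in> {a..b} \<Longrightarrow> 0 \<le> f t"
  shows "(\<integral>\<^sup>+t\<in>{a..b}. ennreal (f t) \<partial>lborel) = ennreal (integral {a..b} f)"
proof -
  have "(f has_integral integral {a..b} f) {a..b}"
    using assms(1) by (intro integrable_integral integrable_continuous_real)
  then have "(\<integral>\<^sup>+t. ennreal (indicator {a..b} t * f t) \<partial>lborel) = ennreal (integral {a..b} f)"
    using assms(2) by (intro nn_integral_has_integral_lebesgue)
  then show ?thesis
    by (subst (asm) nn_integral_cong[where v = "\<lambda>t. ennreal (f t) * indicator {a..b} t"])
       (auto simp: indicator_def)
qed

text \<open>The Fourier coefficients of orders 0, 1 and -1 of the boundary values: the first two are Cauchy's
formulas for the value and the derivative at the centre, the last one vanishes by holomorphy.\<close>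

lemma circle_fourier_coefficients:
  fixes \<phi> :: "complex \<Rightarrow> complex"
  assumes "open S" "cball 0 1 \<subseteq> S" "\<phi> holomorphic_on S"
  shows "((\<lambda>t. \<phi> (cis t)) has_integral 2 * pi * \<phi> 0) {0..2 * pi}"
    and "((\<lambda>t. \<phi> (cis t) * cis (- t)) has_integral 2 * pi * deriv \<phi> 0) {0..2 * pi}"
    and "((\<lambda>t. \<phi> (cis t) * cis t) has_integral 0) {0..2 * pi}"
proof -
  have coeff: "((\<lambda>t. \<psi> (cis t) * cis (- (real k * t))) has_integral 2 * pi * (deriv ^^ k) \<psi> 0 / fact k) {0..2 * pi}"
    if "\<psi> holomorphic_on S" for \<psi> :: "complex \<Rightarrow> complex" and k
  proof -
    have cont: "continuous_on (cball 0 1) \<psi>" "\<psi> holomorphic_on ball 0 1"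
      using holomorphic_on_subset[OF that, of "cball 0 1"] holomorphic_on_subset[OF that, of "ball 0 1"] assms(2)
        ball_subset_cball[of 0 1]
      by (auto intro: holomorphic_on_imp_continuous_on)
    have "((\<lambda>u. \<psi> u / (u - 0) ^ Suc k) has_contour_integral (2 * pi * \<i>) / fact k * (deriv ^^ k) \<psi> 0)
        (circlepath 0 1)"
      using cont by (intro Cauchy_has_contour_integral_higher_derivative_circlepath) auto
    then have "((\<lambda>t. \<psi> (cis t) / cis t ^ Suc k * \<i> * cis t) has_integral
        (2 * pi * \<i>) / fact k * (deriv ^^ k) \<psi> 0) {0..2 * pi}"
      by (simp add: circlepath_def has_contour_integral_part_circlepath_iff)
    then have "((\<lambda>t. - \<i> * (\<psi> (cis t) / cis t ^ Suc k * \<i> * cis t)) has_integral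
        - \<i> * ((2 * pi * \<i>) / fact k * (deriv ^^ k) \<psi> 0)) {0..2 * pi}"
      by (rule has_integral_mult_right)
    moreover have "- \<i> * (\<psi> (cis t) / cis t ^ Suc k * \<i> * cis t) = \<psi> (cis t) * cis (- (real k * t))" for t
    proof -
      have "cis (- (real k * t)) = inverse (cis t ^ k)"
        by (simp add: Complex.DeMoivre)
      then show ?thesis by (simp add: field_simps)
    qed
    moreover have "- \<i> * ((2 * pi * \<i>) / fact k * (deriv ^^ k) \<psi> 0) = 2 * pi * (deriv ^^ k) \<psi> 0 / fact k"
      by (simp add: field_simps)
    ultimately show ?thesis by (simp only:)
  qed
  show "((\<lambda>t. \<phi> (cis t)) has_integral 2 * pi * \<phi> 0) {0..2 * pi}"
    using coeff[OF assms(3), of 0] by simp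
  show "((\<lambda>t. \<phi> (cis t) * cis (- t)) has_integral 2 * pi * deriv \<phi> 0) {0..2 * pi}"
    using coeff[OF assms(3), of 1] by simp
  show "((\<lambda>t. \<phi> (cis t) * cis t) has_integral 0) {0..2 * pi}"
    using coeff[of "\<lambda>z. \<phi> z * z" 0] assms(3) by (simp add: holomorphic_intros)
qed

text \<open>The key estimate.  Let \<open>F\<close> be the real part of \<open>\<phi>\<close> minus its value at 0.  As the coefficient of
order -1 of \<open>\<phi>\<close> vanishes, \<open>\<pi> \<phi>'(0)\<close> is the integral of \<open>F(t) e\<^sup>-\<^sup>i\<^sup>t\<close>, so it is at most the integral of
\<open>\<bar>F\<bar>\<close>.  Since \<open>F\<close> has mean zero, the integral of \<open>\<bar>F\<bar>\<close> is twice that of the positive part of \<open>F\<close>,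
and the positive part is dominated by the increment of any function \<open>G\<close> that lies above \<open>Re \<phi>\<close> and
touches it at the centre.  Thus one-sided information suffices: \<open>G\<close> may be a modulus.\<close>

lemma touching_gradient_bound_unit:
  fixes \<phi> :: "complex \<Rightarrow> complex" and G :: "complex \<Rightarrow> real"
  assumes S: "open S" "cball 0 1 \<subseteq> S" "\<phi> holomorphic_on S"
    and G: "continuous_on {0..2 * pi} (\<lambda>t. G (cis t))"
    and below: "\<And>t. Re (\<phi> (cis t)) \<le> G (cis t)" and touch: "Re (\<phi> 0) = G 0"
  shows "pi * cmod (deriv \<phi> 0) \<le> 2 * integral {0..2 * pi} (\<lambda>t. \<bar>G (cis t) - G 0\<bar>)"
proof -
  define F where "F t = Re (\<phi> (cis t)) - Re (\<phi> 0)" for t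
  note coeff = circle_fourier_coefficients[OF S]
  have unit: "((\<lambda>t. cis (- t)) has_integral 0) {0..2 * pi}"
    using circle_fourier_coefficients(2)[of UNIV "\<lambda>_. 1"] by simp
  have "((\<lambda>t. cnj (\<phi> (cis t) * cis t)) has_integral cnj 0) {0..2 * pi}"
    using has_integral_linear[OF coeff(3) bounded_linear_cnj] by (simp add: o_def)
  then have cnj: "((\<lambda>t. cnj (\<phi> (cis t)) * cis (- t)) has_integral 0) {0..2 * pi}"
    by (simp add: cis_cnj)
  have "((\<lambda>t. (\<phi> (cis t) * cis (- t) + cnj (\<phi> (cis t)) * cis (- t)) / 2 - of_real (Re (\<phi> 0)) * cis (- t))
      has_integral (2 * pi * deriv \<phi> 0 + 0) / 2 - of_real (Re (\<phi> 0)) * 0) {0..2 * pi}"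
    by (intro has_integral_diff has_integral_divide has_integral_add has_integral_mult_right coeff(2) cnj unit)
  moreover have "(w * c + cnj w * c) / 2 - of_real (Re (\<phi> 0)) * c = of_real (Re w - Re (\<phi> 0)) * c" for w c
    by (simp add: complex_eq_iff algebra_simps)
  ultimately have main: "((\<lambda>t. of_real (F t) * cis (- t)) has_integral pi * deriv \<phi> 0) {0..2 * pi}"
    by (simp add: F_def)
  have contF: "continuous_on {0..2 * pi} F"
    unfolding F_def using S
    by (intro continuous_intros continuous_on_compose2[OF holomorphic_on_imp_continuous_on[OF S(3)]]) auto
  have "((\<lambda>t. Re (\<phi> (cis t))) has_integral Re (2 * pi * \<phi> 0)) {0..2 * pi}"
    using has_integral_linear[OF coeff(1) bounded_linear_Re] by (simp add: o_def)
  from has_integral_diff[OF this has_integral_const_real[of "Re (\<phi> 0)" 0 "2 * pi"]]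
  have F0: "(F has_integral 0) {0..2 * pi}" by (simp add: F_def[abs_def])
  have contG: "continuous_on {0..2 * pi} (\<lambda>t. \<bar>G (cis t) - G 0\<bar>)"
    by (intro continuous_intros G)
  have "pi * cmod (deriv \<phi> 0) = cmod (integral {0..2 * pi} (\<lambda>t. of_real (F t) * cis (- t)))"
    using main by (simp add: integral_unique norm_mult)
  also have "\<dots> \<le> integral {0..2 * pi} (\<lambda>t. \<bar>F t\<bar>)"
    using main contF
    by (intro integral_norm_bound_integral) (auto simp: norm_mult intro!: integrable_continuous_real continuous_intros)
  also have "\<dots> \<le> integral {0..2 * pi} (\<lambda>t. 2 * \<bar>G (cis t) - G 0\<bar> - F t)"
  proof (rule integral_le)
    show "\<bar>F t\<bar> \<le> 2 * \<bar>G (cis t) - G 0\<bar> - F t" for t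
      using below[of t] touch unfolding F_def by (smt (verit))
  qed (intro integrable_continuous_real continuous_intros contF contG)+
  also have "\<dots> = 2 * integral {0..2 * pi} (\<lambda>t. \<bar>G (cis t) - G 0\<bar>) - 0"
    using contG
    by (intro integral_unique has_integral_diff F0 has_integral_mult_right integrable_integral integrable_continuous_real)
  finally show ?thesis by simp
qed

text \<open>The disk of the estimate has centre \<open>c z\<close> and radius \<open>\<rho>\<close>.  Writing its points as
\<open>c (z + \<rho> e\<^sup>i\<^sup>t)\<close> makes the right-hand side a difference of rotated values of \<open>G\<close> at two fixed points, which
is what the Lipschitz classes control.\<close>

lemma touching_gradient_bound:
  fixes \<psi> :: "complex \<Rightarrow> complex" and G :: "complex \<Rightarrow> real"
  assumes "\<psi> holomorphic_on \<bbbD>" "continuous_on \<bbbD> G"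
    and below: "\<And>w. w \<in> \<bbbD> \<Longrightarrow> Re (\<psi> w) \<le> G w" and touch: "Re (\<psi> (c * z)) = G (c * z)"
    and c: "cmod c = 1" and \<rho>: "0 < \<rho>" "cmod z + \<rho> < 1"
  shows "pi * \<rho> * cmod (deriv \<psi> (c * z))
    \<le> 2 * integral {0..2 * pi} (\<lambda>t. \<bar>G (c * (z + \<rho> * cis t)) - G (c * z)\<bar>)"
proof -
  define m where "m \<xi> = c * (z + \<rho> * \<xi>)" for \<xi> :: complex
  define S where "S = m -` \<bbbD>"
  have inD: "m \<xi> \<in> \<bbbD>" if "cmod \<xi> \<le> 1" for \<xi> :: complex
  proof -
    have "cmod (z + \<rho> * \<xi>) \<le> cmod z + \<rho> * cmod \<xi>"
      using norm_triangle_ineq[of z "\<rho> * \<xi>"] \<rho> by (simp add: norm_mult)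
    also have "\<dots> \<le> cmod z + \<rho> * 1" using that \<rho> by (intro add_left_mono mult_left_mono) auto
    finally show ?thesis using c \<rho> by (simp add: m_def norm_mult)
  qed
  have m_hol: "m holomorphic_on A" for A
    unfolding m_def by (intro holomorphic_intros)
  have "open S"
    unfolding S_def using m_hol[of UNIV] by (intro open_vimage holomorphic_on_imp_continuous_on) auto
  have hol: "(\<psi> \<circ> m) holomorphic_on S"
    by (rule holomorphic_on_compose_gen[OF m_hol assms(1)]) (auto simp: S_def)
  have "(\<psi> has_field_derivative deriv \<psi> (m 0)) (at (m 0))"
    using assms(1) inD[of 0] by (intro holomorphic_derivI) auto
  moreover have "(m has_field_derivative c * \<rho>) (at 0)"
    unfolding m_def by (auto intro!: derivative_eq_intros)
  ultimately have "(\<psi> \<circ> m has_field_derivative deriv \<psi> (m 0) * (c * \<rho>)) (at 0)"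
    by (rule DERIV_chain)
  then have "deriv (\<psi> \<circ> m) 0 = deriv \<psi> (m 0) * (c * \<rho>)"
    by (rule DERIV_imp_deriv)
  moreover have "pi * cmod (deriv (\<psi> \<circ> m) 0)
     \<le> 2 * integral {0..2 * pi} (\<lambda>t. \<bar>(G \<circ> m) (cis t) - (G \<circ> m) 0\<bar>)"
  proof (rule touching_gradient_bound_unit[OF \<open>open S\<close> _ hol])
    show "continuous_on {0..2 * pi} (\<lambda>t. (G \<circ> m) (cis t))"
      unfolding o_def using inD
      by (intro continuous_on_compose2[OF assms(2)]) (auto simp: m_def intro!: continuous_intros)
  qed (use inD below touch in \<open>auto simp: S_def m_def\<close>)
  ultimately show ?thesis
    using c \<rho> by (simp add: m_def norm_mult mult_ac)
qed

section \<open>Rotation invariance of planar Lebesgue measure\<close>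

text \<open>Lebesgue measure on the complex plane is the product measure in Cartesian coordinates, because both
agree on boxes.\<close>

lemma nn_integral_lborel_complex:
  assumes [measurable]: "f \<in> borel_measurable borel"
  shows "(\<integral>\<^sup>+z. f z \<partial>lborel) = (\<integral>\<^sup>+x. (\<integral>\<^sup>+y. f (Complex x y) \<partial>lborel) \<partial>lborel)"
proof -
  have [measurable]: "(\<lambda>(x, y). Complex x y) \<in> borel_measurable (borel \<Otimes>\<^sub>M borel)"
    unfolding borel_prod
    by (intro borel_measurable_continuous_onI)
       (simp add: case_prod_beta Complex_eq continuous_intros)
  have "lborel = distr (lborel \<Otimes>\<^sub>M lborel) borel (\<lambda>(x, y). Complex x y)"
  proof (rule lborel_eqI)
    fix l u :: complex
    assume lu: "\<And>b. b \<in> Basis \<Longrightarrow> l \<bullet> b \<le> u \<bullet> b"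
    have "(\<lambda>(x, y). Complex x y) -` box l u \<inter> space (lborel \<Otimes>\<^sub>M lborel)
        = {Re l<..<Re u} \<times> {Im l<..<Im u}"
      by (auto simp: box_def Basis_complex_def space_pair_measure)
    moreover have "Re l \<le> Re u" "Im l \<le> Im u"
      using lu[of 1] lu[of \<i>] by (auto simp: Basis_complex_def)
    ultimately show "emeasure (distr (lborel \<Otimes>\<^sub>M lborel) borel (\<lambda>(x, y). Complex x y)) (box l u)
        = (\<Prod>b\<in>Basis. (u - l) \<bullet> b)"
      by (simp add: emeasure_distr lborel.emeasure_pair_measure_Times Basis_complex_def ennreal_mult)
  qed simp
  then have "(\<integral>\<^sup>+z. f z \<partial>lborel) = (\<integral>\<^sup>+z. f z \<partial>distr (lborel \<Otimes>\<^sub>M lborel) borel (\<lambda>(x, y). Complex x y))"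
    by simp
  also have "\<dots> = (\<integral>\<^sup>+p. f (case p of (x, y) \<Rightarrow> Complex x y) \<partial>(lborel \<Otimes>\<^sub>M lborel))"
    by (rule nn_integral_distr) measurable
  also have "\<dots> = (\<integral>\<^sup>+x. (\<integral>\<^sup>+y. f (Complex x y) \<partial>lborel) \<partial>lborel)"
    by (subst lborel.nn_integral_fst[symmetric]) simp_all
  finally show ?thesis .
qed

lemma measurable_Complex[measurable (raw)]:
  assumes "f \<in> borel_measurable M" "g \<in> borel_measurable M"
  shows "(\<lambda>x. Complex (f x) (g x)) \<in> borel_measurable M"
  using assms unfolding Complex_eq by measurable

lemma nn_integral_translate:
  fixes a :: "'a::euclidean_space"
  assumes [measurable]: "f \<in> borel_measurable borel"
  shows "(\<integral>\<^sup>+x. f (a + x) \<partial>lborel) = (\<integral>\<^sup>+x. f x \<partial>lborel)"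
proof -
  have "(\<integral>\<^sup>+x. f x \<partial>lborel) = (\<integral>\<^sup>+x. f x \<partial>distr lborel borel ((+) a))"
    by (simp add: lborel_distr_plus)
  also have "\<dots> = (\<integral>\<^sup>+x. f (a + x) \<partial>lborel)"
    by (rule nn_integral_distr) measurable
  finally show ?thesis by simp
qed

lemma nn_integral_shear_Im:
  assumes [measurable]: "f \<in> borel_measurable borel"
  shows "(\<integral>\<^sup>+z. f (Complex (Re z) (Im z + a * Re z)) \<partial>lborel) = (\<integral>\<^sup>+z. f z \<partial>lborel)"
proof -
  have "(\<integral>\<^sup>+y. f (Complex x (y + a * x)) \<partial>lborel) = (\<integral>\<^sup>+y. f (Complex x y) \<partial>lborel)" for x
    using nn_integral_translate[of "\<lambda>y. f (Complex x y)" "a * x"] by (simp add: add.commute)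
  then show ?thesis
    by (simp add: nn_integral_lborel_complex)
qed

lemma nn_integral_shear_Re:
  assumes [measurable]: "f \<in> borel_measurable borel"
  shows "(\<integral>\<^sup>+z. f (Complex (Re z + a * Im z) (Im z)) \<partial>lborel) = (\<integral>\<^sup>+z. f z \<partial>lborel)"
proof -
  have "(\<integral>\<^sup>+z. f (Complex (Re z + a * Im z) (Im z)) \<partial>lborel)
      = (\<integral>\<^sup>+x. (\<integral>\<^sup>+y. f (Complex (x + a * y) y) \<partial>lborel) \<partial>lborel)"
    by (simp add: nn_integral_lborel_complex)
  also have "\<dots> = (\<integral>\<^sup>+y. (\<integral>\<^sup>+x. f (Complex (x + a * y) y) \<partial>lborel) \<partial>lborel)"
    by (rule lborel_pair.Fubini') measurable
  also have "\<dots> = (\<integral>\<^sup>+y. (\<integral>\<^sup>+x. f (Complex x y) \<partial>lborel) \<partial>lborel)"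
  proof (rule nn_integral_cong)
    show "(\<integral>\<^sup>+x. f (Complex (x + a * y) y) \<partial>lborel) = (\<integral>\<^sup>+x. f (Complex x y) \<partial>lborel)" for y
      using nn_integral_translate[of "\<lambda>x. f (Complex x y)" "a * y"] by (simp add: add.commute)
  qed
  also have "\<dots> = (\<integral>\<^sup>+x. (\<integral>\<^sup>+y. f (Complex x y) \<partial>lborel) \<partial>lborel)"
    by (rule lborel_pair.Fubini') measurable
  finally show ?thesis
    by (simp add: nn_integral_lborel_complex)
qed

text \<open>A rotation is a composition of three shears as long as it is not the half turn, and shears preserve
Lebesgue measure by translation invariance in one coordinate.  Every rotation is the square of
one which is not the half turn.\<close>

lemma nn_integral_rotate:
  assumes f[measurable]: "f \<in> borel_measurable borel" and c: "cmod c = 1"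
  shows "(\<integral>\<^sup>+z. f (c * z) \<partial>lborel) = (\<integral>\<^sup>+z. f z \<partial>lborel)"
proof -
  have generic: "(\<integral>\<^sup>+z. k (s * z) \<partial>lborel) = (\<integral>\<^sup>+z. k z \<partial>lborel)"
    if [measurable]: "k \<in> borel_measurable borel" and s: "cmod s = 1" "Re s \<noteq> - 1" for k s
  proof -
    define \<tau> where "\<tau> = - (Im s / (1 + Re s))"
    have sq: "(Re s)\<^sup>2 + (Im s)\<^sup>2 = 1"
      using s cmod_power2[of s] by simp
    then have t1: "1 + Im s * \<tau> = Re s" and t2: "\<tau> * (1 + Re s) = - Im s"
      using s(2) unfolding \<tau>_def by (simp_all add: field_simps power2_eq_square add_eq_0_iff)
    \<comment> \<open>The shears with slopes \<open>\<tau>\<close>, \<open>Im s\<close>, \<open>\<tau>\<close> compose to the rotation; \<open>- \<tau>\<close> is the tangent of half its angle.\<close>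
    define k1 where "k1 z = k (Complex (Re z + \<tau> * Im z) (Im z))" for z
    define k2 where "k2 z = k1 (Complex (Re z) (Im z + Im s * Re z))" for z
    have [measurable]: "k1 \<in> borel_measurable borel" "k2 \<in> borel_measurable borel"
      unfolding k2_def k1_def by measurable
    have "s * z = Complex ((Re z + \<tau> * Im z) + \<tau> * (Im z + Im s * (Re z + \<tau> * Im z)))
        (Im z + Im s * (Re z + \<tau> * Im z))" for z
    proof (rule complex_eqI)
      have "Im z + Im s * (Re z + \<tau> * Im z) = Im s * Re z + (1 + Im s * \<tau>) * Im z"
        by (simp add: algebra_simps)
      then have y: "Im z + Im s * (Re z + \<tau> * Im z) = Im s * Re z + Re s * Im z" by (simp add: t1)
      then show "Im (s * z) = Im (Complex ((Re z + \<tau> * Im z) + \<tau> * (Im z + Im s * (Re z + \<tau> * Im z)))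
          (Im z + Im s * (Re z + \<tau> * Im z)))" by (simp add: add.commute)
      have "(Re z + \<tau> * Im z) + \<tau> * (Im s * Re z + Re s * Im z)
          = (1 + Im s * \<tau>) * Re z + (\<tau> * (1 + Re s)) * Im z" by (simp add: algebra_simps)
      then show "Re (s * z) = Re (Complex ((Re z + \<tau> * Im z) + \<tau> * (Im z + Im s * (Re z + \<tau> * Im z)))
          (Im z + Im s * (Re z + \<tau> * Im z)))" by (simp add: y t1 t2)
    qed
    then have "(\<integral>\<^sup>+z. k (s * z) \<partial>lborel) = (\<integral>\<^sup>+z. k2 (Complex (Re z + \<tau> * Im z) (Im z)) \<partial>lborel)"
      by (simp add: k1_def k2_def)
    also have "\<dots> = (\<integral>\<^sup>+z. k2 z \<partial>lborel)" by (rule nn_integral_shear_Re) measurable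
    also have "\<dots> = (\<integral>\<^sup>+z. k1 z \<partial>lborel)"
      unfolding k2_def by (rule nn_integral_shear_Im) measurable
    also have "\<dots> = (\<integral>\<^sup>+z. k z \<partial>lborel)"
      unfolding k1_def by (rule nn_integral_shear_Re) measurable
    finally show ?thesis .
  qed
  \<comment> \<open>A square root in the right half plane is not the half turn.\<close>
  define s where "s = csqrt c"
  have "s\<^sup>2 = c" by (simp add: s_def)
  then have "cmod s = 1" using c by (metis norm_power power2_eq_1_iff norm_ge_zero zero_le_one less_eq_real_def not_one_le_zero order.trans neg_0_le_iff_le)
  moreover have "Re s \<noteq> - 1" using csqrt_principal[of c] by (auto simp: s_def simp del: csqrt.sel)
  ultimately have "(\<integral>\<^sup>+z. f (s * (s * z)) \<partial>lborel) = (\<integral>\<^sup>+z. f (s * z) \<partial>lborel)"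
    "(\<integral>\<^sup>+z. f (s * z) \<partial>lborel) = (\<integral>\<^sup>+z. f z \<partial>lborel)"
    using generic[of "\<lambda>z. f (s * z)" s] generic[of f s] by auto
  then show ?thesis
    using \<open>s\<^sup>2 = c\<close> by (simp add: power2_eq_square mult.assoc[symmetric])
qed

lemma measurable_cis[measurable (raw)]:
  assumes "f \<in> borel_measurable M"
  shows "(\<lambda>x. cis (f x)) \<in> borel_measurable M"
  using assms by (rule measurable_compose) (intro borel_measurable_continuous_onI continuous_intros)

section \<open>Sub-mean value inequalities over disks\<close>

lemma measurable_cmod_indicator:
  assumes "F holomorphic_on S" "A \<in> sets borel" "A \<subseteq> S"
  shows "(\<lambda>w. indicator A w * cmod (F w)) \<in> borel_measurable borel"
proof -
  have "continuous_on A (\<lambda>w. cmod (F w))"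
    using assms by (intro continuous_on_norm holomorphic_on_imp_continuous_on) (rule holomorphic_on_subset)
  from borel_measurable_continuous_on_indicator[OF assms(2) this] show ?thesis by simp
qed

lemma circle_mean_lower_bound:
  fixes \<phi> :: "complex \<Rightarrow> complex"
  assumes "open S" "cball 0 1 \<subseteq> S" "\<phi> holomorphic_on S"
  shows "ennreal (2 * pi * cmod (\<phi> 0)) \<le> (\<integral>\<^sup>+t\<in>{0..2 * pi}. ennreal (cmod (\<phi> (cis t))) \<partial>lborel)"
proof -
  have cont: "continuous_on {0..2 * pi} (\<lambda>t. \<phi> (cis t))"
    using assms
    by (intro continuous_on_compose2[OF holomorphic_on_imp_continuous_on[OF assms(3)]]) (auto intro!: continuous_intros)
  have "2 * pi * cmod (\<phi> 0) = cmod (integral {0..2 * pi} (\<lambda>t. \<phi> (cis t)))"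
    using circle_fourier_coefficients(1)[OF assms] by (simp add: integral_unique norm_mult)
  also have "\<dots> \<le> integral {0..2 * pi} (\<lambda>t. cmod (\<phi> (cis t)))"
    using cont by (intro integral_norm_bound_integral integrable_continuous_real continuous_on_norm) auto
  finally show ?thesis
    using cont by (subst nn_integral_Icc_eq_integral) (auto intro!: continuous_on_norm ennreal_leI)
qed

text \<open>The sub-mean value property over disks follows from the one over circles without polar coordinates:
the integral over a disk is invariant under rotations about the centre, so it equals its own average
over all rotations, and Tonelli's theorem turns this average into circle means.\<close>

lemma area_mean_lower_bound:
  fixes F :: "complex \<Rightarrow> complex"
  assumes F: "F holomorphic_on ball z r" and "0 < r"
  shows "ennreal (cmod (F z)) * emeasure lborel (ball z r)
    \<le> (\<integral>\<^sup>+w\<in>ball z r. ennreal (cmod (F w)) \<partial>lborel)"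
proof -
  define k where "k w = ennreal (cmod (F w)) * indicator (ball z r) w" for w
  have "(\<lambda>w. ennreal (indicator (ball z r) w * cmod (F w))) \<in> borel_measurable borel"
    using measurable_cmod_indicator[OF F, of "ball z r"] by measurable
  also have "(\<lambda>w. ennreal (indicator (ball z r) w * cmod (F w))) = k"
    by (auto simp: k_def indicator_def)
  finally have [measurable]: "k \<in> borel_measurable borel" .
  have rot: "(\<integral>\<^sup>+w. k (z + cis \<eta> * w) \<partial>lborel) = (\<integral>\<^sup>+w. k w \<partial>lborel)" for \<eta>
    by (subst nn_integral_rotate[of "\<lambda>w. k (z + w)" "cis \<eta>"]) (simp_all add: nn_integral_translate)
  have circle: "ennreal (2 * pi * cmod (F z)) * indicator (ball 0 r) w
      \<le> (\<integral>\<^sup>+\<eta>\<in>{0..2 * pi}. k (z + cis \<eta> * w) \<partial>lborel)" for w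
  proof (cases "w \<in> ball 0 r")
    case True
    define S where "S = (\<lambda>\<xi>. z + \<xi> * w) -` ball z r"
    have "open S" unfolding S_def by (intro open_vimage continuous_intros open_ball)
    moreover have "cball 0 1 \<subseteq> S"
    proof
      fix \<xi> :: complex assume "\<xi> \<in> cball 0 1"
      then have "cmod (\<xi> * w) \<le> 1 * cmod w" by (simp add: norm_mult mult_left_le_one_le)
      then show "\<xi> \<in> S" using True by (simp add: S_def dist_norm)
    qed
    moreover have "(F \<circ> (\<lambda>\<xi>. z + \<xi> * w)) holomorphic_on S"
      by (rule holomorphic_on_compose_gen[OF _ F]) (auto simp: S_def intro!: holomorphic_intros)
    ultimately have "ennreal (2 * pi * cmod (F z))
        \<le> (\<integral>\<^sup>+t\<in>{0..2 * pi}. ennreal (cmod (F (z + cis t * w))) \<partial>lborel)"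
      using circle_mean_lower_bound[of S "F \<circ> (\<lambda>\<xi>. z + \<xi> * w)"] by simp
    also have "\<dots> = (\<integral>\<^sup>+\<eta>\<in>{0..2 * pi}. k (z + cis \<eta> * w) \<partial>lborel)"
      using True by (intro nn_integral_cong) (simp add: k_def dist_norm norm_mult)
    finally show ?thesis using True by simp
  qed simp
  have "ennreal (2 * pi) * (ennreal (cmod (F z)) * emeasure lborel (ball z r))
      = ennreal (2 * pi * cmod (F z)) * emeasure lborel (ball (0::complex) r)"
    using \<open>0 < r\<close> by (simp add: emeasure_ball ennreal_mult mult_ac)
  also have "\<dots> = (\<integral>\<^sup>+w. ennreal (2 * pi * cmod (F z)) * indicator (ball (0::complex) r) w \<partial>lborel)"
    by (simp add: nn_integral_cmult_indicator)
  also have "\<dots> \<le> (\<integral>\<^sup>+w. (\<integral>\<^sup>+\<eta>\<in>{0..2 * pi}. k (z + cis \<eta> * w) \<partial>lborel) \<partial>lborel)"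
    by (intro nn_integral_mono circle)
  also have "\<dots> = (\<integral>\<^sup>+\<eta>. (\<integral>\<^sup>+w. k (z + cis \<eta> * w) * indicator {0..2 * pi} \<eta> \<partial>lborel) \<partial>lborel)"
    by (rule lborel_pair.Fubini') measurable
  also have "\<dots> = (\<integral>\<^sup>+\<eta>. (\<integral>\<^sup>+w. k w \<partial>lborel) * indicator {0..2 * pi} \<eta> \<partial>lborel)"
    by (simp add: nn_integral_multc rot)
  also have "\<dots> = ennreal (2 * pi) * (\<integral>\<^sup>+w. k w \<partial>lborel)"
    by (simp add: nn_integral_cmult_indicator mult.commute)
  finally have "ennreal (2 * pi) * (ennreal (cmod (F z)) * emeasure lborel (ball z r))
      \<le> ennreal (2 * pi) * (\<integral>\<^sup>+w. k w \<partial>lborel)" .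
  then show ?thesis
    unfolding k_def by (subst (asm) ennreal_mult_le_mult_iff) auto
qed

text \<open>For exponents below 1 the sub-mean value inequality (with a constant) follows from the one for
exponent 1.  Maximise \<open>(r - \<bar>w - z\<bar>)\<^sup>2\<^sup>/\<^sup>q \<bar>F w\<bar>\<close> over the disk, at \<open>w\<^sub>0\<close> say.  On the disk about \<open>w\<^sub>0\<close> of
half the distance to the boundary, \<open>\<bar>F\<bar>\<close> is at most a constant times \<open>\<bar>F w\<^sub>0\<bar>\<close>, so that in the mean value
inequality at \<open>w\<^sub>0\<close> the factor \<open>\<bar>F\<bar>\<^sup>1\<^sup>-\<^sup>q\<close> can be estimated by \<open>\<bar>F w\<^sub>0\<bar>\<^sup>1\<^sup>-\<^sup>q\<close> and cancelled.  Maximality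
transports the resulting bound from \<open>w\<^sub>0\<close> to the centre.\<close>

lemma power_area_submean_small:
  fixes F :: "complex \<Rightarrow> complex"
  assumes F: "F holomorphic_on S" "open S" "cball z r \<subseteq> S" and "0 < r" and q: "0 < q" "q \<le> 1"
  shows "ennreal (cmod (F z) powr q) * emeasure lborel (ball z r)
    \<le> ennreal (2 powr (2 / q)) * (\<integral>\<^sup>+w\<in>ball z r. ennreal (cmod (F w) powr q) \<partial>lborel)"
proof -
  define J where "J = (\<integral>\<^sup>+w\<in>ball z r. ennreal (cmod (F w) powr q) \<partial>lborel)"
  define m where "m w = (r - cmod (w - z)) powr (2 / q) * cmod (F w)" for w
  have "continuous_on (cball z r) m"
    unfolding m_def using F q
    by (intro continuous_intros continuous_on_powr' holomorphic_on_imp_continuous_on)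
       (auto simp: dist_norm norm_minus_commute elim: holomorphic_on_subset)
  then obtain w0 where w0: "w0 \<in> cball z r" and max: "\<And>w. w \<in> cball z r \<Longrightarrow> m w \<le> m w0"
    using continuous_attains_sup[of "cball z r" m] \<open>0 < r\<close> by auto
  show ?thesis
  proof (cases "m w0 = 0")
    case True
    then have "m z \<le> 0" using max[of z] \<open>0 < r\<close> by simp
    then have "F z = 0" using \<open>0 < r\<close> by (simp add: m_def mult_le_0_iff)
    then show ?thesis by simp
  next
    case False
    define \<delta> where "\<delta> = (r - cmod (w0 - z)) / 2"
    define N where "N = cmod (F w0)"
    have "\<delta> \<noteq> 0" "N \<noteq> 0" using False by (auto simp: m_def \<delta>_def N_def)
    moreover have "\<delta> \<ge> 0" using w0 by (simp add: \<delta>_def dist_norm norm_minus_commute)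
    ultimately have pos: "\<delta> > 0" "N > 0" by (auto simp: N_def)
    have "2 * \<delta> = r - cmod (w0 - z)" by (simp add: \<delta>_def)
    then have m0: "m w0 = (2 * \<delta>) powr (2 / q) * N" by (simp add: m_def N_def)
    have inner: "\<delta> \<le> r - cmod (w - z)" if "w \<in> ball w0 \<delta>" for w
      using that norm_triangle_ineq[of "w - w0" "w0 - z"]
      by (simp add: \<delta>_def dist_norm norm_minus_commute field_simps)
    then have sub: "ball w0 \<delta> \<subseteq> ball z r"
      using pos by (auto simp: dist_norm norm_minus_commute) (smt (verit) dist_norm mem_ball norm_minus_commute)
    have subS: "ball w0 \<delta> \<subseteq> S" using sub F(3) ball_subset_cball by blast
    \<comment> \<open>The factor \<open>2 powr (2 / q)\<close> is the price of halving the distance to the boundary.\<close>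
    have bound: "cmod (F w) \<le> 2 powr (2 / q) * N" if "w \<in> ball w0 \<delta>" for w
    proof -
      have "\<delta> powr (2 / q) * cmod (F w) \<le> m w"
        unfolding m_def using inner[OF that] pos q by (intro mult_right_mono powr_mono2) auto
      also have "\<dots> \<le> m w0" using sub that by (intro max) auto
      also have "\<dots> = \<delta> powr (2 / q) * (2 powr (2 / q) * N)"
        using pos by (simp add: m0 powr_mult)
      finally show ?thesis using pos by simp
    qed
    have [measurable]: "(\<lambda>w. indicator (ball w0 \<delta>) w * cmod (F w)) \<in> borel_measurable borel"
      using subS by (intro measurable_cmod_indicator[OF F(1)]) auto
    have "ennreal N * emeasure lborel (ball w0 \<delta>) \<le> (\<integral>\<^sup>+w\<in>ball w0 \<delta>. ennreal (cmod (F w)) \<partial>lborel)"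
      unfolding N_def using pos
      by (intro area_mean_lower_bound holomorphic_on_subset[OF F(1) subS])
    also have "\<dots> \<le> (\<integral>\<^sup>+w. ennreal ((2 powr (2 / q) * N) powr (1 - q)) *
        ennreal ((indicator (ball w0 \<delta>) w * cmod (F w)) powr q) \<partial>lborel)"
    proof (rule nn_integral_mono)
      fix w
      show "ennreal (cmod (F w)) * indicator (ball w0 \<delta>) w \<le> ennreal ((2 powr (2 / q) * N) powr (1 - q)) *
        ennreal ((indicator (ball w0 \<delta>) w * cmod (F w)) powr q)"
      proof (cases "w \<in> ball w0 \<delta>")
        case True
        have "cmod (F w) = cmod (F w) powr (1 - q) * cmod (F w) powr q"
          by (simp flip: powr_add)
        also have "\<dots> \<le> (2 powr (2 / q) * N) powr (1 - q) * cmod (F w) powr q"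
          using bound[OF True] q by (intro mult_right_mono powr_mono2) auto
        finally show ?thesis using True by (simp add: ennreal_leI flip: ennreal_mult)
      qed simp
    qed
    also have "\<dots> = ennreal ((2 powr (2 / q) * N) powr (1 - q)) *
        (\<integral>\<^sup>+w. ennreal ((indicator (ball w0 \<delta>) w * cmod (F w)) powr q) \<partial>lborel)"
      by (rule nn_integral_cmult) measurable
    also have "\<dots> \<le> ennreal ((2 powr (2 / q) * N) powr (1 - q)) * J"
      unfolding J_def using sub by (intro mult_left_mono nn_integral_mono) (auto simp: indicator_def)
    finally have ineq: "ennreal N * emeasure lborel (ball w0 \<delta>) \<le> ennreal ((2 powr (2 / q) * N) powr (1 - q)) * J" .
    have e0: "emeasure lborel (ball w \<rho>) = ennreal (pi * \<rho>\<^sup>2)" if "\<rho> \<ge> 0" for w :: complex and \<rho>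
      using that by (simp add: emeasure_ball unit_ball_vol_2 ennreal_mult ennreal_power)
    have center: "cmod (F z) powr q * r\<^sup>2 \<le> 4 * \<delta>\<^sup>2 * N powr q"
    proof -
      have sq: "(x powr (2 / q)) powr q = x\<^sup>2" if "x \<ge> 0" for x
        using that q by (cases "x = 0") (auto simp: powr_powr)
      have "r powr (2 / q) * cmod (F z) \<le> (2 * \<delta>) powr (2 / q) * N"
        using max[of z] \<open>0 < r\<close> unfolding m0 by (simp add: m_def)
      then have "(r powr (2 / q) * cmod (F z)) powr q \<le> ((2 * \<delta>) powr (2 / q) * N) powr q"
        using q by (intro powr_mono2) auto
      then show ?thesis
        using \<open>0 < r\<close> pos sq[of r] sq[of "2 * \<delta>"] by (simp add: powr_mult mult_ac power_mult_distrib)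
    qed
    have "ennreal (cmod (F z) powr q) * emeasure lborel (ball z r) = ennreal (pi * (cmod (F z) powr q * r\<^sup>2))"
      using \<open>0 < r\<close> by (simp add: e0 mult_ac flip: ennreal_mult)
    also have "\<dots> \<le> ennreal (pi * (4 * \<delta>\<^sup>2 * N powr q))"
      using center by (intro ennreal_leI mult_left_mono) auto
    also have "\<dots> = ennreal (4 * N powr (q - 1)) * (ennreal N * emeasure lborel (ball w0 \<delta>))"
    proof -
      have "N powr q = N powr (q - 1) * N" using pos by (simp add: powr_diff)
      then show ?thesis using pos by (simp add: e0 mult_ac flip: ennreal_mult)
    qed
    also have "\<dots> \<le> ennreal (4 * N powr (q - 1)) * (ennreal ((2 powr (2 / q) * N) powr (1 - q)) * J)"
      by (intro mult_left_mono ineq) auto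
    also have "\<dots> = ennreal (2 powr (2 / q)) * J"
    proof -
      have "4 * N powr (q - 1) * (2 powr (2 / q) * N) powr (1 - q)
        = 2 powr 2 * (2 powr (2 / q)) powr (1 - q) * (N powr (q - 1) * N powr (1 - q))"
        using pos by (simp add: powr_mult)
      also have "\<dots> = 2 powr (2 + (2 / q) * (1 - q)) * N powr ((q - 1) + (1 - q))"
        using pos by (simp only: powr_add powr_powr)
      also have "2 + (2 / q) * (1 - q) = 2 / q" using q by (simp add: field_simps)
      finally show ?thesis using pos by (simp add: mult.assoc[symmetric] flip: ennreal_mult)
    qed
    finally show ?thesis by (simp add: J_def)
  qed
qed

text \<open>For exponents above 1 Jensen's inequality suffices.\<close>

lemma power_area_submean:
  assumes "0 < q"
  obtains C where "0 < C" "\<And>(F :: complex \<Rightarrow> complex) S z r. F holomorphic_on S \<Longrightarrow> open S \<Longrightarrow> cball z r \<subseteq> S \<Longrightarrow> 0 < r \<Longrightarrow>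
    ennreal (cmod (F z) powr q) * emeasure lborel (ball z r)
    \<le> ennreal C * (\<integral>\<^sup>+w\<in>ball z r. ennreal (cmod (F w) powr q) \<partial>lborel)"
proof (cases "q \<le> 1")
  case True
  then show ?thesis
    using that[of "2 powr (2 / q)"] power_area_submean_small assms by simp
next
  case False
  show ?thesis
  proof (rule that[of 1])
    fix F :: "complex \<Rightarrow> complex" and S z and r :: real
    assume F: "F holomorphic_on S" "open S" "cball z r \<subseteq> S" and "0 < r"
    define k where "k w = indicator (ball z r) w * cmod (F w)" for w
    define A where "A = pi * r\<^sup>2"
    have "A > 0" using \<open>0 < r\<close> by (simp add: A_def)
    have e0: "emeasure lborel (ball z r) = ennreal A"
      using \<open>0 < r\<close> by (simp add: A_def emeasure_ball unit_ball_vol_2 ennreal_mult ennreal_power)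
    have [measurable]: "k \<in> borel_measurable borel"
      unfolding k_def using F by (intro measurable_cmod_indicator[OF F(1)]) auto
    have "ennreal (cmod (F z) * A) = ennreal (cmod (F z)) * emeasure lborel (ball z r)"
      using \<open>A > 0\<close> by (simp add: e0 ennreal_mult)
    also have "\<dots> \<le> (\<integral>\<^sup>+w\<in>ball z r. ennreal (cmod (F w)) \<partial>lborel)"
      using F \<open>0 < r\<close> by (intro area_mean_lower_bound) (auto elim!: holomorphic_on_subset)
    also have "\<dots> = (\<integral>\<^sup>+w\<in>ball z r. ennreal (k w) \<partial>lborel)"
      by (intro nn_integral_cong) (auto simp: k_def indicator_def)
    finally have s: "ennreal (cmod (F z) * A) \<le> (\<integral>\<^sup>+w\<in>ball z r. ennreal (k w) \<partial>lborel)" .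
    have "ennreal ((cmod (F z) * A) powr q)
      \<le> ennreal (A powr (q - 1)) * (\<integral>\<^sup>+w\<in>ball z r. ennreal (k w powr q * 1 powr (1 - q)) \<partial>lborel)"
      using False \<open>A > 0\<close> s e0 \<open>k \<in> borel_measurable borel\<close>
      by (intro weighted_jensen) (simp_all, simp add: k_def)
    also have "(\<integral>\<^sup>+w\<in>ball z r. ennreal (k w powr q * 1 powr (1 - q)) \<partial>lborel)
        = (\<integral>\<^sup>+w\<in>ball z r. ennreal (cmod (F w) powr q) \<partial>lborel)"
      by (intro nn_integral_cong) (auto simp: k_def indicator_def)
    also have "ennreal ((cmod (F z) * A) powr q) = ennreal (A powr (q - 1)) * ennreal (cmod (F z) powr q * A)"
      using \<open>A > 0\<close> by (simp add: powr_mult powr_diff flip: ennreal_mult)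
    finally show "ennreal (cmod (F z) powr q) * emeasure lborel (ball z r)
        \<le> ennreal 1 * (\<integral>\<^sup>+w\<in>ball z r. ennreal (cmod (F w) powr q) \<partial>lborel)"
      using \<open>A > 0\<close> by (subst (asm) ennreal_mult_le_mult_iff) (simp_all add: e0 flip: ennreal_mult)
  qed simp
qed

section \<open>Growth conditions and Lipschitz classes\<close>

text \<open>The common form of the two kinds of conditions in the theorem: growth of a nonnegative function
(a size of a derivative) near the boundary, and smoothness of a function in terms of the majorant, both
measured in \<open>L\<^sup>p\<close> over rotations.\<close>

definition mean_growth :: "(real \<Rightarrow> real) \<Rightarrow> ereal \<Rightarrow> (complex \<Rightarrow> real) \<Rightarrow> bool"
  where "mean_growth \<omega> p X \<longleftrightarrow> (\<exists>M>0. \<forall>z\<in>\<bbbD>.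
    circ_bound p (\<lambda>\<eta>. X (cis \<eta> * z)) (M * (\<omega> (dist_bdry z) / dist_bdry z)))"

definition mean_modulus :: "(real \<Rightarrow> real) \<Rightarrow> ereal \<Rightarrow> (complex \<Rightarrow> complex) \<Rightarrow> bool"
  where "mean_modulus \<omega> p F \<longleftrightarrow> (\<exists>M>0. \<forall>z\<^sub>1\<in>closed_unit_disk. \<forall>z\<^sub>2\<in>closed_unit_disk.
    circ_bound p (\<lambda>\<eta>. cmod (F (cis \<eta> * z\<^sub>1) - F (cis \<eta> * z\<^sub>2))) (M * \<omega> (dist z\<^sub>1 z\<^sub>2)))"

lemma continuous_on_rotation:
  assumes "continuous_on (cball 0 \<rho>) F" "cmod z \<le> \<rho>"
  shows "continuous_on A (\<lambda>\<eta>. F (cis \<eta> * z))"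
  using assms by (intro continuous_on_compose2[OF assms(1)]) (auto simp: norm_mult intro!: continuous_intros)

lemma borel_measurable_rotation:
  assumes "continuous_on (cball 0 \<rho>) F" "cmod z \<le> \<rho>"
  shows "(\<lambda>\<eta>. F (cis \<eta> * z)) \<in> borel_measurable borel"
  by (rule borel_measurable_continuous_onI[OF continuous_on_rotation[OF assms]])

lemma majorant_facts:
  assumes "majorant \<omega>"
  shows majorant_nonneg: "0 \<le> t \<Longrightarrow> 0 \<le> \<omega> t"
    and majorant_mono: "0 \<le> s \<Longrightarrow> s \<le> t \<Longrightarrow> \<omega> s \<le> \<omega> t"
    and majorant_ratio: "0 < s \<Longrightarrow> s \<le> t \<Longrightarrow> \<omega> t / t \<le> \<omega> s / s"
    and majorant_0: "\<omega> 0 = 0"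
  using assms by (auto simp: majorant_def mono_on_def monotone_on_def)

lemma majorant_half_ratio:
  assumes "majorant \<omega>" "0 < d"
  shows "\<omega> (d / 2) / (d / 2) \<le> 2 * (\<omega> d / d)"
  using majorant_mono[OF assms(1), of "d / 2" d] assms(2) by (simp add: field_simps)

lemma Lip_class_iff_mean_modulus:
  assumes p: "1 \<le> p" and \<omega>: "majorant \<omega>" and F: "continuous_on closed_unit_disk F"
  shows "F \<in> Lip_class \<omega> p \<longleftrightarrow> mean_modulus \<omega> p F"
proof -
  \<comment> \<open>Measurability and integrability are automatic for continuous functions, so only the bound matters.\<close>
  have meas: "F \<in> borel_measurable (restrict_space borel closed_unit_disk)"
    by (rule borel_measurable_continuous_on_restrict[OF F])
  have key: "Lp_osc_finite p F z1 z2 \<and> Lp_osc p F z1 z2 \<le> M * \<omega> (dist z1 z2) \<longleftrightarrow>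
      circ_bound p (\<lambda>\<eta>. cmod (F (cis \<eta> * z1) - F (cis \<eta> * z2))) (M * \<omega> (dist z1 z2))"
    if "0 < M" "z1 \<in> closed_unit_disk" "z2 \<in> closed_unit_disk" for M z1 z2
  proof -
    have "continuous_on {0..2 * pi} (\<lambda>\<eta>. cmod (F (cis \<eta> * z1) - F (cis \<eta> * z2)))"
      using that by (intro continuous_on_norm continuous_on_diff continuous_on_rotation[OF F]) auto
    note int = set_integrable_powr_of_continuous[OF p _ this]
    have "0 \<le> M * \<omega> (dist z1 z2)"
      using that majorant_nonneg[OF \<omega>, of "dist z1 z2"] by simp
    note iff = circ_bound_iff[OF p this int]
    show ?thesis
      using iff int by (cases "p = \<infinity>") (auto simp: Lp_osc_finite_def Lp_osc_def)
  qed
  have "(\<exists>M>0. \<forall>z1\<in>closed_unit_disk. \<forall>z2\<in>closed_unit_disk.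
       Lp_osc_finite p F z1 z2 \<and> Lp_osc p F z1 z2 \<le> M * \<omega> (dist z1 z2)) \<longleftrightarrow> mean_modulus \<omega> p F"
    unfolding mean_modulus_def by (intro ex_cong1 conj_cong ball_cong refl key)
  then show ?thesis
    using meas by (simp add: Lip_class_def)
qed

lemma mean_modulus_mono:
  assumes p: "1 \<le> p" and \<omega>: "majorant \<omega>" and F: "mean_modulus \<omega> p F"
    and le: "\<And>z1 z2. z1 \<in> closed_unit_disk \<Longrightarrow> z2 \<in> closed_unit_disk \<Longrightarrow> cmod (G z1 - G z2) \<le> cmod (F z1 - F z2)"
  shows "mean_modulus \<omega> p G"
proof -
  obtain M where M: "0 < M" and bound: "\<And>z1 z2. z1 \<in> closed_unit_disk \<Longrightarrow> z2 \<in> closed_unit_disk \<Longrightarrow>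
      circ_bound p (\<lambda>\<eta>. cmod (F (cis \<eta> * z1) - F (cis \<eta> * z2))) (M * \<omega> (dist z1 z2))"
    using F by (auto simp: mean_modulus_def)
  have "circ_bound p (\<lambda>\<eta>. cmod (G (cis \<eta> * z1) - G (cis \<eta> * z2))) (M * \<omega> (dist z1 z2))"
    if "z1 \<in> closed_unit_disk" "z2 \<in> closed_unit_disk" for z1 z2
    using that M majorant_nonneg[OF \<omega>, of "dist z1 z2"]
    by (intro circ_bound_mono[OF p bound[OF that]] le) (auto simp: norm_mult)
  then show ?thesis using M by (auto simp: mean_modulus_def)
qed

lemma mean_modulus_add:
  assumes p: "1 \<le> p" and \<omega>: "majorant \<omega>" and FG: "mean_modulus \<omega> p F" "mean_modulus \<omega> p G"
    and cont: "continuous_on closed_unit_disk F" "continuous_on closed_unit_disk G"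
  shows "mean_modulus \<omega> p (\<lambda>z. F z + G z)"
proof -
  obtain M where M: "0 < M" and F: "\<And>z1 z2. z1 \<in> closed_unit_disk \<Longrightarrow> z2 \<in> closed_unit_disk \<Longrightarrow>
      circ_bound p (\<lambda>\<eta>. cmod (F (cis \<eta> * z1) - F (cis \<eta> * z2))) (M * \<omega> (dist z1 z2))"
    using FG(1) by (auto simp: mean_modulus_def)
  obtain N where N: "0 < N" and G: "\<And>z1 z2. z1 \<in> closed_unit_disk \<Longrightarrow> z2 \<in> closed_unit_disk \<Longrightarrow>
      circ_bound p (\<lambda>\<eta>. cmod (G (cis \<eta> * z1) - G (cis \<eta> * z2))) (N * \<omega> (dist z1 z2))"
    using FG(2) by (auto simp: mean_modulus_def)
  have "circ_bound p (\<lambda>\<eta>. cmod (F (cis \<eta> * z1) + G (cis \<eta> * z1) - (F (cis \<eta> * z2) + G (cis \<eta> * z2))))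
      (4 * (M + N) * \<omega> (dist z1 z2))"
    if z: "z1 \<in> closed_unit_disk" "z2 \<in> closed_unit_disk" for z1 z2
  proof (rule circ_bound_mono[OF p circ_bound_add[OF p F[OF z] G[OF z]]])
    have [measurable]: "(\<lambda>\<eta>. F (cis \<eta> * z1)) \<in> borel_measurable borel" "(\<lambda>\<eta>. F (cis \<eta> * z2)) \<in> borel_measurable borel"
      "(\<lambda>\<eta>. G (cis \<eta> * z1)) \<in> borel_measurable borel" "(\<lambda>\<eta>. G (cis \<eta> * z2)) \<in> borel_measurable borel"
      using z by (auto intro!: borel_measurable_rotation cont)
    show "(\<lambda>\<eta>. cmod (F (cis \<eta> * z1) - F (cis \<eta> * z2))) \<in> borel_measurable borel"
      "(\<lambda>\<eta>. cmod (G (cis \<eta> * z1) - G (cis \<eta> * z2))) \<in> borel_measurable borel"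
      by measurable
    show "cmod (F (cis \<eta> * z1) + G (cis \<eta> * z1) - (F (cis \<eta> * z2) + G (cis \<eta> * z2)))
       \<le> cmod (F (cis \<eta> * z1) - F (cis \<eta> * z2)) + cmod (G (cis \<eta> * z1) - G (cis \<eta> * z2))" for \<eta>
      by (metis add_diff_add norm_triangle_ineq)
  qed (use M N majorant_nonneg[OF \<omega>, of "dist z1 z2"] in \<open>auto simp: algebra_simps\<close>)
  then show ?thesis
    using M N unfolding mean_modulus_def by (intro exI[of _ "4 * (M + N)"]) auto
qed

lemma mean_growth_mono:
  assumes p: "1 \<le> p" and \<omega>: "majorant \<omega>" and Y: "mean_growth \<omega> p Y"
    and le: "\<And>z. z \<in> \<bbbD> \<Longrightarrow> 0 \<le> X z" "\<And>z. z \<in> \<bbbD> \<Longrightarrow> X z \<le> c * Y z" and "0 < c"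
    and cont: "continuous_on \<bbbD> Y" and nonneg: "\<And>z. z \<in> \<bbbD> \<Longrightarrow> 0 \<le> Y z"
  shows "mean_growth \<omega> p X"
proof -
  obtain M where M: "0 < M" and Y: "\<And>z. z \<in> \<bbbD> \<Longrightarrow>
      circ_bound p (\<lambda>\<eta>. Y (cis \<eta> * z)) (M * (\<omega> (dist_bdry z) / dist_bdry z))"
    using Y by (auto simp: mean_growth_def)
  have "circ_bound p (\<lambda>\<eta>. X (cis \<eta> * z)) (c * (M * (\<omega> (dist_bdry z) / dist_bdry z)))" if z: "z \<in> \<bbbD>" for z
  proof (rule circ_bound_mono[OF p circ_bound_cmult[OF p Y[OF z], where c = c]])
    show "(\<lambda>\<eta>. Y (cis \<eta> * z)) \<in> borel_measurable borel"
      using z by (intro borel_measurable_rotation[of "cmod z"] continuous_on_subset[OF cont]) auto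
  qed (use z M \<open>0 < c\<close> le nonneg majorant_nonneg[OF \<omega>, of "dist_bdry z"] in
        \<open>auto simp: norm_mult dist_bdry_def\<close>)
  then show ?thesis
    using M \<open>0 < c\<close> unfolding mean_growth_def by (intro exI[of _ "c * M"]) (auto simp: mult.assoc)
qed

lemma mean_growth_add:
  assumes p: "1 \<le> p" and \<omega>: "majorant \<omega>" and XY: "mean_growth \<omega> p X" "mean_growth \<omega> p Y"
    and cont: "continuous_on \<bbbD> X" "continuous_on \<bbbD> Y"
    and nonneg: "\<And>z. 0 \<le> X z" "\<And>z. 0 \<le> Y z"
  shows "mean_growth \<omega> p (\<lambda>z. X z + Y z)"
proof -
  obtain M where M: "0 < M" and X: "\<And>z. z \<in> \<bbbD> \<Longrightarrow>
      circ_bound p (\<lambda>\<eta>. X (cis \<eta> * z)) (M * (\<omega> (dist_bdry z) / dist_bdry z))"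
    using XY(1) by (auto simp: mean_growth_def)
  obtain N where N: "0 < N" and Y: "\<And>z. z \<in> \<bbbD> \<Longrightarrow>
      circ_bound p (\<lambda>\<eta>. Y (cis \<eta> * z)) (N * (\<omega> (dist_bdry z) / dist_bdry z))"
    using XY(2) by (auto simp: mean_growth_def)
  have "circ_bound p (\<lambda>\<eta>. X (cis \<eta> * z) + Y (cis \<eta> * z)) (4 * (M + N) * (\<omega> (dist_bdry z) / dist_bdry z))"
    if z: "z \<in> \<bbbD>" for z
  proof -
    have meas: "(\<lambda>\<eta>. X (cis \<eta> * z)) \<in> borel_measurable borel" "(\<lambda>\<eta>. Y (cis \<eta> * z)) \<in> borel_measurable borel"
      using z by (auto intro!: borel_measurable_rotation[of "cmod z"] continuous_on_subset[OF cont(1)]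
        continuous_on_subset[OF cont(2)])
    have "0 \<le> \<omega> (dist_bdry z) / dist_bdry z"
      using z majorant_nonneg[OF \<omega>, of "dist_bdry z"] by (simp add: dist_bdry_def)
    then have "0 \<le> M * (\<omega> (dist_bdry z) / dist_bdry z)" "0 \<le> N * (\<omega> (dist_bdry z) / dist_bdry z)"
      using M N by (auto intro: mult_nonneg_nonneg simp del: times_divide_eq_right)
    then have "circ_bound p (\<lambda>\<eta>. X (cis \<eta> * z) + Y (cis \<eta> * z))
      (4 * (M * (\<omega> (dist_bdry z) / dist_bdry z) + N * (\<omega> (dist_bdry z) / dist_bdry z)))"
      using nonneg by (intro circ_bound_add[OF p X[OF z] Y[OF z] meas])
    then show ?thesis by (simp only: distrib_left distrib_right mult.assoc)
  qed
  then show ?thesis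
    using M N unfolding mean_growth_def by (intro exI[of _ "4 * (M + N)"]) auto
qed

text \<open>The Dini-type condition for small \<open>\<delta>\<close> extends to \<open>\<delta> \<le> 1\<close>, because away from 0 the
integrand is at most a constant times \<open>\<omega> \<delta>\<close>.\<close>

lemma fast_majorant_integral:
  assumes "fast_majorant \<omega>"
  obtains M where "0 < M" "\<And>\<delta>. 0 < \<delta> \<Longrightarrow> \<delta> \<le> 1 \<Longrightarrow>
    (\<integral>\<^sup>+t\<in>{0<..\<delta>}. ennreal (\<omega> t / t) \<partial>lborel) \<le> ennreal (M * \<omega> \<delta>)"
proof -
  have \<omega>: "majorant \<omega>" using assms by (simp add: fast_majorant_def)
  obtain \<delta>0 M0 where pos: "0 < \<delta>0" "0 < M0" and int: "\<And>\<delta>. 0 < \<delta> \<Longrightarrow> \<delta> < \<delta>0 \<Longrightarrow>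
       set_integrable lborel {0<..\<delta>} (\<lambda>t. \<omega> t / t)"
    and le: "\<And>\<delta>. 0 < \<delta> \<Longrightarrow> \<delta> < \<delta>0 \<Longrightarrow> (LINT t:{0<..\<delta>}|lborel. \<omega> t / t) \<le> M0 * \<omega> \<delta>"
    using assms by (auto simp: fast_majorant_def)
  have small: "(\<integral>\<^sup>+t\<in>{0<..\<delta>}. ennreal (\<omega> t / t) \<partial>lborel) \<le> ennreal (M0 * \<omega> \<delta>)"
    if "0 < \<delta>" "\<delta> < \<delta>0" for \<delta>
  proof -
    have "(\<integral>\<^sup>+t\<in>{0<..\<delta>}. ennreal (\<omega> t / t) \<partial>lborel)
        = (\<integral>\<^sup>+t. ennreal (indicator {0<..\<delta>} t *\<^sub>R (\<omega> t / t)) \<partial>lborel)"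
      by (intro nn_integral_cong) (simp add: indicator_def)
    also have "\<dots> = ennreal (LINT t:{0<..\<delta>}|lborel. \<omega> t / t)"
      unfolding set_lebesgue_integral_def
      by (rule nn_integral_eq_integral[OF int[OF that, unfolded set_integrable_def]])
         (simp add: indicator_def majorant_nonneg[OF \<omega>])
    finally show ?thesis using le[OF that] by (simp add: ennreal_leI)
  qed
  define \<delta>1 where "\<delta>1 = \<delta>0 / 2"
  have \<delta>1: "0 < \<delta>1" "\<delta>1 < \<delta>0" using pos by (auto simp: \<delta>1_def)
  show ?thesis
  proof (rule that[of "M0 + 1 / \<delta>1"])
    fix \<delta> :: real assume \<delta>: "0 < \<delta>" "\<delta> \<le> 1"
    have \<omega>\<delta>: "0 \<le> \<omega> \<delta>" using majorant_nonneg[OF \<omega>] \<delta> by simp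
    show "(\<integral>\<^sup>+t\<in>{0<..\<delta>}. ennreal (\<omega> t / t) \<partial>lborel) \<le> ennreal ((M0 + 1 / \<delta>1) * \<omega> \<delta>)"
    proof (cases "\<delta> \<le> \<delta>1")
      case True
      then have "(\<integral>\<^sup>+t\<in>{0<..\<delta>}. ennreal (\<omega> t / t) \<partial>lborel) \<le> ennreal (M0 * \<omega> \<delta>)"
        using \<delta> \<delta>1 by (intro small) auto
      also have "\<dots> \<le> ennreal ((M0 + 1 / \<delta>1) * \<omega> \<delta>)"
        using \<delta>1 \<omega>\<delta> by (intro ennreal_leI mult_right_mono) auto
      finally show ?thesis .
    next
      case False
      have [measurable]: "(\<lambda>t. ennreal (\<omega> t / t) * indicator {0<..\<delta>1} t) \<in> borel_measurable borel"
      proof -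
        have "(\<lambda>t. ennreal (indicator {0<..\<delta>1} t *\<^sub>R (\<omega> t / t))) \<in> borel_measurable borel"
          using borel_measurable_integrable[OF int[OF \<delta>1, unfolded set_integrable_def]] by simp
        also have "(\<lambda>t. ennreal (indicator {0<..\<delta>1} t *\<^sub>R (\<omega> t / t)))
            = (\<lambda>t. ennreal (\<omega> t / t) * indicator {0<..\<delta>1} t)"
          by (auto simp: indicator_def)
        finally show ?thesis .
      qed
      have tail: "\<omega> t / t \<le> \<omega> \<delta> / \<delta>1" if "\<delta>1 < t" "t \<le> \<delta>" for t
        using that \<delta>1 majorant_mono[OF \<omega>, of t \<delta>] \<omega>\<delta> by (intro frac_le) auto
      have "(\<integral>\<^sup>+t\<in>{0<..\<delta>}. ennreal (\<omega> t / t) \<partial>lborel)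
        \<le> (\<integral>\<^sup>+t. ennreal (\<omega> t / t) * indicator {0<..\<delta>1} t + ennreal (\<omega> \<delta> / \<delta>1) * indicator {0..1} t \<partial>lborel)"
        using tail \<delta> \<delta>1 by (intro nn_integral_mono) (auto simp: indicator_def intro!: ennreal_leI)
      also have "\<dots> = (\<integral>\<^sup>+t\<in>{0<..\<delta>1}. ennreal (\<omega> t / t) \<partial>lborel) + ennreal (\<omega> \<delta> / \<delta>1)"
        by (subst nn_integral_add) (simp_all add: nn_integral_cmult_indicator)
      also have "\<dots> \<le> ennreal (M0 * \<omega> \<delta>1) + ennreal (\<omega> \<delta> / \<delta>1)"
        using \<delta>1 by (intro add_right_mono small)
      also have "\<dots> \<le> ennreal (M0 * \<omega> \<delta>) + ennreal (\<omega> \<delta> / \<delta>1)"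
        using False pos \<delta>1 by (intro add_right_mono ennreal_leI mult_left_mono majorant_mono[OF \<omega>]) auto
      also have "\<dots> = ennreal ((M0 + 1 / \<delta>1) * \<omega> \<delta>)"
        using pos \<delta>1 \<omega>\<delta> by (simp add: distrib_right flip: ennreal_plus)
      finally show ?thesis .
    qed
  qed (use pos \<delta>1 in \<open>simp add: add_pos_pos\<close>)
qed

section \<open>From Lipschitz conditions to growth of the derivative\<close>

text \<open>Smoothness of \<open>G\<close> controls a derivative size \<open>X\<close> as soon as every point admits a holomorphic function
whose real part lies below \<open>G\<close>, touches \<open>G\<close> at the point, and has derivative at least \<open>X\<close> there.
At a point of distance \<open>d\<close> to the boundary, the gradient estimate on a circle of radius \<open>d / 2\<close> is
integrated over all rotations by Minkowski's inequality.\<close>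

lemma mean_growth_of_touching:
  fixes G X :: "complex \<Rightarrow> real"
  assumes p: "1 \<le> p" and \<omega>: "majorant \<omega>" and G: "continuous_on closed_unit_disk G"
    and mod: "mean_modulus \<omega> p (\<lambda>z. of_real (G z))"
    and X: "\<And>w. w \<in> \<bbbD> \<Longrightarrow> 0 \<le> X w"
    and touch: "\<And>w. w \<in> \<bbbD> \<Longrightarrow> \<exists>\<psi>. \<psi> holomorphic_on \<bbbD> \<and> (\<forall>v\<in>\<bbbD>. Re (\<psi> v) \<le> G v) \<and>
      Re (\<psi> w) = G w \<and> X w \<le> cmod (deriv \<psi> w)"
  shows "mean_growth \<omega> p X"
proof -
  obtain M where M: "0 < M" and mod: "\<And>z1 z2. z1 \<in> closed_unit_disk \<Longrightarrow> z2 \<in> closed_unit_disk \<Longrightarrow>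
      circ_bound p (\<lambda>\<eta>. \<bar>G (cis \<eta> * z1) - G (cis \<eta> * z2)\<bar>) (M * \<omega> (dist z1 z2))"
    using mod by (auto simp: mean_modulus_def simp flip: of_real_diff)
  have GD: "continuous_on \<bbbD> G" by (rule continuous_on_subset[OF G]) auto
  \<comment> \<open>The cut-off makes the integrand jointly measurable on the whole plane; it does not change the values in question.\<close>
  define Gb where "Gb w = indicator closed_unit_disk w *\<^sub>R G w" for w
  have [measurable]: "Gb \<in> borel_measurable borel"
    unfolding Gb_def by (intro borel_measurable_continuous_on_indicator G) auto
  have Gb: "Gb (cis \<eta> * z) = G (cis \<eta> * z)" if "cmod z \<le> 1" for \<eta> z
    using that by (simp add: Gb_def norm_mult)
  have "circ_bound p (\<lambda>\<eta>. max 0 (X (cis \<eta> * z))) (8 * M * (\<omega> (dist_bdry z) / dist_bdry z))" if z: "z \<in> \<bbbD>" for z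
  proof -
    define \<rho> where "\<rho> = dist_bdry z / 2"
    have \<rho>: "0 < \<rho>" "cmod z + \<rho> < 1" using z by (auto simp: \<rho>_def dist_bdry_def field_simps)
    have in1: "cmod (z + of_real \<rho> * cis t) \<le> 1" for t
      using norm_triangle_ineq[of z "of_real \<rho> * cis t"] \<rho> by (simp add: norm_mult)
    define k where "k t \<eta> = 2 / (pi * \<rho>) * \<bar>Gb (cis \<eta> * (z + of_real \<rho> * cis t)) - Gb (cis \<eta> * z)\<bar>" for t \<eta>
    define b where "b = 2 / (pi * \<rho>) * (M * \<omega> \<rho>)"
    have "0 \<le> \<omega> \<rho>" using majorant_nonneg[OF \<omega>] \<rho> by simp
    then have "0 \<le> b" using M \<rho> by (simp add: b_def)
    have bound: "circ_bound p (\<lambda>\<eta>. max 0 (X (cis \<eta> * z))) (2 * pi * b)"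
    proof (rule circ_bound_integral[where A = "{0..2 * pi}" and b = "\<lambda>_. b" and X = k, OF p])
      show "(\<lambda>(t, \<eta>). k t \<eta>) \<in> borel_measurable (borel \<Otimes>\<^sub>M borel)"
        unfolding k_def by measurable
      show "(\<integral>\<^sup>+t\<in>{0..2 * pi}. ennreal b \<partial>lborel) \<le> ennreal (2 * pi * b)"
        using \<open>0 \<le> b\<close> by (simp add: nn_integral_cmult_indicator mult.commute flip: ennreal_mult)
      show "circ_bound p (k t) b" for t
      proof -
        have "circ_bound p (\<lambda>\<eta>. \<bar>G (cis \<eta> * (z + of_real \<rho> * cis t)) - G (cis \<eta> * z)\<bar>) (M * \<omega> \<rho>)"
        proof -
          have "z + of_real \<rho> * cis t \<in> closed_unit_disk" using in1[of t] by simp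
          moreover have "dist (z + of_real \<rho> * cis t) z = \<rho>" using \<rho> by (simp add: dist_norm norm_mult)
          ultimately show ?thesis using mod[of "z + of_real \<rho> * cis t" z] z by simp
        qed
        then have "circ_bound p (\<lambda>\<eta>. \<bar>Gb (cis \<eta> * (z + of_real \<rho> * cis t)) - Gb (cis \<eta> * z)\<bar>) (M * \<omega> \<rho>)"
          using in1[of t] z by (simp add: Gb)
        then show ?thesis
          unfolding k_def[abs_def] b_def using M \<rho> \<open>0 \<le> \<omega> \<rho>\<close>
          by (intro circ_bound_cmult[OF p]) auto
      qed
      show "ennreal (max 0 (X (cis \<eta> * z))) \<le> (\<integral>\<^sup>+t\<in>{0..2 * pi}. ennreal (k t \<eta>) \<partial>lborel)" for \<eta>
      proof -
        let ?g = "\<lambda>t. \<bar>G (cis \<eta> * (z + of_real \<rho> * cis t)) - G (cis \<eta> * z)\<bar>"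
        have inD: "cis \<eta> * z \<in> \<bbbD>" using z by (simp add: norm_mult)
        obtain \<psi> where \<psi>: "\<psi> holomorphic_on \<bbbD>" "\<And>v. v \<in> \<bbbD> \<Longrightarrow> Re (\<psi> v) \<le> G v"
          "Re (\<psi> (cis \<eta> * z)) = G (cis \<eta> * z)" "X (cis \<eta> * z) \<le> cmod (deriv \<psi> (cis \<eta> * z))"
          using touch[OF inD] by blast
        have cont: "continuous_on {0..2 * pi} ?g"
          using in1 by (intro continuous_intros continuous_on_compose2[OF G]) (auto simp: norm_mult)
        have "X (cis \<eta> * z) \<le> 2 / (pi * \<rho>) * integral {0..2 * pi} ?g"
          using touching_gradient_bound[OF \<psi>(1) GD \<psi>(2,3) _ \<rho>] \<psi>(4) \<rho>
          by (simp add: field_simps) (smt (verit) mult_left_mono pi_gt_zero mult_nonneg_nonneg)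
        also have "\<dots> = integral {0..2 * pi} (\<lambda>t. k t \<eta>)"
          using in1 z by (simp add: k_def Gb)
        finally have "max 0 (X (cis \<eta> * z)) \<le> integral {0..2 * pi} (\<lambda>t. k t \<eta>)"
          using X[OF inD] by simp
        moreover have "continuous_on {0..2 * pi} (\<lambda>t. k t \<eta>)"
          using continuous_on_mult_left[OF cont, of "2 / (pi * \<rho>)"] in1 z by (simp add: k_def Gb)
        then have "(\<integral>\<^sup>+t\<in>{0..2 * pi}. ennreal (k t \<eta>) \<partial>lborel) = ennreal (integral {0..2 * pi} (\<lambda>t. k t \<eta>))"
          using \<rho> by (intro nn_integral_Icc_eq_integral) (auto simp: k_def)
        ultimately show ?thesis by (simp add: ennreal_leI)
      qed
    qed (use \<open>0 \<le> b\<close> \<rho> in \<open>auto simp: k_def\<close>)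
    have "2 * pi * b \<le> 8 * M * (\<omega> (dist_bdry z) / dist_bdry z)"
    proof -
      have "2 * pi * b = 4 * M * (\<omega> \<rho> / \<rho>)" using \<rho> by (simp add: b_def)
      also have "\<dots> \<le> 4 * M * (2 * (\<omega> (dist_bdry z) / dist_bdry z))"
        unfolding \<rho>_def using \<rho> M by (intro mult_left_mono majorant_half_ratio[OF \<omega>]) (auto simp: \<rho>_def)
      finally show ?thesis by simp
    qed
    then show ?thesis
      using \<open>0 \<le> b\<close> by (intro circ_bound_mono[OF p bound]) auto
  qed
  moreover have "max 0 (X (cis \<eta> * z)) = X (cis \<eta> * z)" if "z \<in> \<bbbD>" for \<eta> z
    using X[of "cis \<eta> * z"] that by (simp add: norm_mult)
  ultimately show ?thesis
    using M unfolding mean_growth_def by (intro exI[of _ "8 * M"]) auto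
qed

section \<open>From growth of the derivative to Lipschitz conditions\<close>

lemma line_increment_bound:
  fixes F :: "complex \<Rightarrow> complex"
  assumes F: "F holomorphic_on S" "open S" and "0 \<le> L" and inS: "\<And>t. t \<in> {0..L} \<Longrightarrow> a + of_real t * b \<in> S"
  shows "ennreal (cmod (F (a + of_real L * b) - F a))
    \<le> (\<integral>\<^sup>+t\<in>{0<..L}. ennreal (cmod (deriv F (a + of_real t * b)) * cmod b) \<partial>lborel)"
proof -
  let ?g = "\<lambda>t. deriv F (a + of_real t * b) * b"
  have cont: "continuous_on {0..L} ?g"
    using inS
    by (intro continuous_intros continuous_on_compose2[OF holomorphic_on_imp_continuous_on[OF holomorphic_deriv[OF F]]]) auto
  have deriv: "((\<lambda>t. F (a + of_real t * b)) has_vector_derivative ?g t) (at t within {0..L})" if "t \<in> {0..L}" for t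
  proof -
    have "(F has_field_derivative deriv F (a + of_real t * b)) (at (a + of_real t * b))"
      using F inS[OF that] by (rule holomorphic_derivI)
    moreover have "((\<lambda>t. a + of_real t * b) has_vector_derivative b) (at t within {0..L})"
      by (auto intro!: derivative_eq_intros)
    ultimately show ?thesis
      using field_vector_diff_chain_within[OF _ has_field_derivative_at_within]
      by (fastforce simp: o_def mult.commute)
  qed
  have "(?g has_integral F (a + of_real L * b) - F (a + of_real 0 * b)) {0..L}"
    by (rule fundamental_theorem_of_calculus[OF \<open>0 \<le> L\<close> deriv])
  then have "integral {0..L} ?g = F (a + of_real L * b) - F a"
    by (simp only: integral_unique of_real_0 mult_zero_left add_0_right)
  then have "cmod (F (a + of_real L * b) - F a) = cmod (integral {0..L} ?g)"
    by (simp only:)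
  also have "\<dots> \<le> integral {0..L} (\<lambda>t. cmod (?g t))"
    using cont by (intro integral_norm_bound_integral integrable_continuous_real continuous_on_norm) auto
  finally have "ennreal (cmod (F (a + of_real L * b) - F a)) \<le> ennreal (integral {0..L} (\<lambda>t. cmod (?g t)))"
    by (rule ennreal_leI)
  also have "\<dots> = (\<integral>\<^sup>+t\<in>{0..L}. ennreal (cmod (?g t)) \<partial>lborel)"
    using cont by (intro nn_integral_Icc_eq_integral[symmetric] continuous_on_norm) auto
  also have "\<dots> = (\<integral>\<^sup>+t\<in>{0<..L}. ennreal (cmod (deriv F (a + of_real t * b)) * cmod b) \<partial>lborel)"
    using AE_lborel_singleton[of 0]
    by (intro nn_integral_cong_AE) (auto elim!: eventually_mono simp: indicator_def norm_mult)
  finally show ?thesis .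
qed

text \<open>The Hardy--Littlewood argument.  Two points at distance \<open>2 r\<close> are moved radially inwards by the factor
\<open>1 - r\<close> and then joined by a segment.  On the radial parts the derivative at depth \<open>s\<close> is of size
\<open>\<omega> s / s\<close>, whose integral up to \<open>r\<close> is controlled since the majorant is fast.  The
segment has length at most \<open>2 r\<close> and lies at depth at least \<open>r\<close>, so that it contributes a multiple of
\<open>\<omega> r\<close>.  Boundary points are reached as limits.\<close>

lemma mean_modulus_of_growth:
  assumes p: "1 \<le> p" and fast: "fast_majorant \<omega>" and h: "h \<in> disk_algebra"
    and growth: "mean_growth \<omega> p (\<lambda>z. cmod (deriv h z))"
  shows "mean_modulus \<omega> p h"
proof -
  have \<omega>: "majorant \<omega>" using fast by (simp add: fast_majorant_def)
  have hol: "h holomorphic_on \<bbbD>" and cont: "continuous_on closed_unit_disk h"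
    using h by (auto simp: disk_algebra_def)
  obtain C where C: "0 < C" and growth: "\<And>z. z \<in> \<bbbD> \<Longrightarrow>
      circ_bound p (\<lambda>\<eta>. cmod (deriv h (cis \<eta> * z))) (C * (\<omega> (dist_bdry z) / dist_bdry z))"
    using growth by (auto simp: mean_growth_def)
  obtain N where N: "0 < N" and dini: "\<And>\<delta>. 0 < \<delta> \<Longrightarrow> \<delta> \<le> 1 \<Longrightarrow>
    (\<integral>\<^sup>+t\<in>{0<..\<delta>}. ennreal (\<omega> t / t) \<partial>lborel) \<le> ennreal (N * \<omega> \<delta>)"
    using fast_majorant_integral[OF fast] by blast
  \<comment> \<open>Extending the derivative by 0 makes it measurable on the whole plane.\<close>
  define D where "D w = indicator \<bbbD> w * cmod (deriv h w)" for w
  have [measurable]: "D \<in> borel_measurable borel"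
    unfolding D_def by (rule measurable_cmod_indicator[OF holomorphic_deriv[OF hol]]) auto
  have D: "D (cis \<eta> * z) = cmod (deriv h (cis \<eta> * z))" if "z \<in> \<bbbD>" for \<eta> z
    using that by (simp add: D_def norm_mult)
  have D0: "0 \<le> D w" for w by (simp add: D_def)
  have D_near: "circ_bound p (\<lambda>\<eta>. D (cis \<eta> * z)) (C * (\<omega> s / s))" if "0 < s" "s \<le> 1 - cmod z" for s z
  proof -
    have "z \<in> \<bbbD>" using that by simp
    then have near: "circ_bound p (\<lambda>\<eta>. D (cis \<eta> * z)) (C * (\<omega> (dist_bdry z) / dist_bdry z))"
      using growth[of z] by (simp add: D)
    show ?thesis
      using that C majorant_ratio[OF \<omega>, of s "dist_bdry z"] majorant_nonneg[OF \<omega>, of "dist_bdry z"]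
      by (intro circ_bound_mono[OF p near] D0 order_refl mult_left_mono mult_nonneg_nonneg divide_nonneg_nonneg)
         (auto simp: dist_bdry_def)
  qed
  have rot: "(\<lambda>\<xi>. h (cis \<eta> * \<xi>)) holomorphic_on \<bbbD>" for \<eta>
    by (rule holomorphic_on_compose_gen[OF _ hol, unfolded o_def])
       (auto simp: norm_mult intro!: holomorphic_intros)
  have rot_deriv: "deriv (\<lambda>\<xi>. h (cis \<eta> * \<xi>)) w = deriv h (cis \<eta> * w) * cis \<eta>" if "w \<in> \<bbbD>" for \<eta> w
  proof -
    have "(h has_field_derivative deriv h (cis \<eta> * w)) (at (cis \<eta> * w))"
      using that by (intro holomorphic_derivI[OF hol]) (auto simp: norm_mult)
    moreover have "((\<lambda>\<xi>. cis \<eta> * \<xi>) has_field_derivative cis \<eta>) (at w)"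
      by (auto intro!: derivative_eq_intros)
    ultimately show ?thesis
      by (rule DERIV_imp_deriv[OF DERIV_chain2])
  qed
  have line: "ennreal (cmod (h (cis \<eta> * (a + of_real L * b)) - h (cis \<eta> * a)))
      \<le> (\<integral>\<^sup>+t\<in>{0<..L}. ennreal (cmod b * D (cis \<eta> * (a + of_real t * b))) \<partial>lborel)"
    if L: "0 \<le> L" and inD: "\<And>t. t \<in> {0..L} \<Longrightarrow> a + of_real t * b \<in> \<bbbD>" for a b L \<eta>
  proof -
    have "ennreal (cmod (h (cis \<eta> * (a + of_real L * b)) - h (cis \<eta> * a)))
      \<le> (\<integral>\<^sup>+t\<in>{0<..L}. ennreal (cmod (deriv (\<lambda>\<xi>. h (cis \<eta> * \<xi>)) (a + of_real t * b)) * cmod b) \<partial>lborel)"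
      using line_increment_bound[OF rot[of \<eta>] open_ball that] by blast
    also have "\<dots> = (\<integral>\<^sup>+t\<in>{0<..L}. ennreal (cmod b * D (cis \<eta> * (a + of_real t * b))) \<partial>lborel)"
    proof (rule nn_integral_cong)
      fix t
      have eq: "cmod (deriv (\<lambda>\<xi>. h (cis \<eta> * \<xi>)) (a + of_real t * b)) * cmod b
          = cmod b * D (cis \<eta> * (a + of_real t * b))" if t: "t \<in> {0<..L}"
        using inD[of t] t by (subst rot_deriv) (simp_all add: D norm_mult)
      show "ennreal (cmod (deriv (\<lambda>\<xi>. h (cis \<eta> * \<xi>)) (a + of_real t * b)) * cmod b) * indicator {0<..L} t
          = ennreal (cmod b * D (cis \<eta> * (a + of_real t * b))) * indicator {0<..L} t"
        by (cases "t \<in> {0<..L}") (simp only: eq, simp)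
    qed
    finally show ?thesis .
  qed
  have "continuous_on {0..} \<omega>"
    using \<omega> by (simp add: majorant_def)
  then have "continuous_on {0<..} \<omega>"
    by (rule continuous_on_subset) auto
  then have [measurable]: "(\<lambda>t. indicator {0<..} t *\<^sub>R \<omega> t) \<in> borel_measurable borel"
    by (intro borel_measurable_continuous_on_indicator) auto
  have shrink: "cmod (of_real (1 - t) * z) = (1 - t) * cmod z" if "t \<le> 1" for t and z :: complex
    unfolding norm_mult norm_of_real using that by simp
  have radial: "circ_bound p (\<lambda>\<eta>. cmod (h (cis \<eta> * (of_real (1 - r) * z)) - h (cis \<eta> * z))) (C * (N * \<omega> r))"
    if r: "0 < r" "r \<le> 1" and z: "z \<in> \<bbbD>" for r z
  proof (rule circ_bound_integral[where A = "{0<..r}" and b = "\<lambda>t. C * (indicator {0<..} t *\<^sub>R \<omega> t / t)"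
        and X = "\<lambda>t \<eta>. D (cis \<eta> * (z + of_real t * (- z)))", OF p])
    show "(\<lambda>t. C * (indicator {0<..} t *\<^sub>R \<omega> t / t)) \<in> borel_measurable borel"
      by measurable
    show "(\<lambda>(t, \<eta>). D (cis \<eta> * (z + of_real t * (- z)))) \<in> borel_measurable (borel \<Otimes>\<^sub>M borel)"
      by measurable
    have "(\<integral>\<^sup>+t\<in>{0<..r}. ennreal (C * (indicator {0<..} t *\<^sub>R \<omega> t / t)) \<partial>lborel)
        = (\<integral>\<^sup>+t. ennreal C * (ennreal (indicator {0<..} t *\<^sub>R \<omega> t / t) * indicator {0<..r} t) \<partial>lborel)"
      by (simp only: ennreal_mult'[OF less_imp_le[OF C]] mult.assoc)
    also have "\<dots> = ennreal C * (\<integral>\<^sup>+t\<in>{0<..r}. ennreal (indicator {0<..} t *\<^sub>R \<omega> t / t) \<partial>lborel)"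
      by (rule nn_integral_cmult) measurable
    also have "(\<integral>\<^sup>+t\<in>{0<..r}. ennreal (indicator {0<..} t *\<^sub>R \<omega> t / t) \<partial>lborel)
        = (\<integral>\<^sup>+t\<in>{0<..r}. ennreal (\<omega> t / t) \<partial>lborel)"
      by (intro nn_integral_cong) (auto simp: indicator_def)
    also have "ennreal C * \<dots> \<le> ennreal C * ennreal (N * \<omega> r)"
      using dini[OF r] by (rule mult_left_mono) simp
    finally show "(\<integral>\<^sup>+t\<in>{0<..r}. ennreal (C * (indicator {0<..} t *\<^sub>R \<omega> t / t)) \<partial>lborel) \<le> ennreal (C * (N * \<omega> r))"
      using C N majorant_nonneg[OF \<omega>, of r] r by (simp add: ennreal_mult)
    show "0 \<le> C * (N * \<omega> r)" using C N majorant_nonneg[OF \<omega>, of r] r by simp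
    show "circ_bound p (\<lambda>\<eta>. D (cis \<eta> * (z + of_real t * (- z)))) (C * (indicator {0<..} t *\<^sub>R \<omega> t / t))"
      if t: "t \<in> {0<..r}" for t
    proof -
      have "z + of_real t * (- z) = of_real (1 - t) * z" by (simp add: algebra_simps)
      moreover have "cmod (of_real (1 - t) * z) \<le> (1 - t) * 1"
        using t r z mult_left_mono[of "cmod z" 1 "1 - t"] by (subst shrink) auto
      ultimately show ?thesis
        using D_near[of t "z + of_real t * (- z)"] t by simp
    qed
    show "ennreal (cmod (h (cis \<eta> * (of_real (1 - r) * z)) - h (cis \<eta> * z)))
        \<le> (\<integral>\<^sup>+t\<in>{0<..r}. ennreal (D (cis \<eta> * (z + of_real t * (- z)))) \<partial>lborel)" for \<eta>
    proof -
      have inD: "z + of_real t * (- z) \<in> \<bbbD>" if "t \<in> {0..r}" for t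
      proof -
        have "z + of_real t * (- z) = of_real (1 - t) * z" by (simp add: algebra_simps)
        moreover have "cmod (of_real (1 - t) * z) \<le> 1 * cmod z"
          using that r mult_right_mono[of "1 - t" 1 "cmod z"] by (subst shrink) auto
        ultimately show ?thesis using z by simp
      qed
      have "of_real (1 - r) * z = z + of_real r * (- z)" by (simp add: algebra_simps)
      then have "ennreal (cmod (h (cis \<eta> * (of_real (1 - r) * z)) - h (cis \<eta> * z)))
        \<le> (\<integral>\<^sup>+t\<in>{0<..r}. ennreal (cmod (- z) * D (cis \<eta> * (z + of_real t * (- z)))) \<partial>lborel)"
        using line[of r z "- z" \<eta>] r inD by simp
      also have "\<dots> \<le> (\<integral>\<^sup>+t\<in>{0<..r}. ennreal (D (cis \<eta> * (z + of_real t * (- z)))) \<partial>lborel)"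
        using z D0 by (intro nn_integral_mono mult_right_mono ennreal_leI) (auto simp: mult_left_le_one_le)
      finally show ?thesis .
    qed
  qed (use C D0 majorant_nonneg[OF \<omega>] r in \<open>auto simp: indicator_def\<close>)
  have chord: "circ_bound p (\<lambda>\<eta>. cmod (h (cis \<eta> * z2) - h (cis \<eta> * z1))) (2 * C * \<omega> r)"
    if r: "0 < r" and z: "cmod z1 \<le> 1 - r" "cmod z2 \<le> 1 - r" and dist: "cmod (z2 - z1) \<le> 2 * r" for r z1 z2
  proof (rule circ_bound_integral[where A = "{0<..1}" and b = "\<lambda>t. 2 * r * (C * (\<omega> r / r))"
        and X = "\<lambda>t \<eta>. 2 * r * D (cis \<eta> * (z1 + of_real t * (z2 - z1)))", OF p])
    have near: "cmod (z1 + of_real t * (z2 - z1)) \<le> 1 - r" if "t \<in> {0..1}" for t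
    proof -
      have "z1 + of_real t * (z2 - z1) = (1 - t) *\<^sub>R z1 + t *\<^sub>R z2"
        by (simp add: scaleR_conv_of_real algebra_simps)
      moreover have "\<dots> \<in> cball 0 (1 - r)"
        using z that by (intro convexD_alt[OF convex_cball, THEN subsetD[OF order_refl]]) auto
      ultimately show ?thesis by simp
    qed
    show "(\<lambda>(t, \<eta>). 2 * r * D (cis \<eta> * (z1 + of_real t * (z2 - z1)))) \<in> borel_measurable (borel \<Otimes>\<^sub>M borel)"
      by measurable
    show "circ_bound p (\<lambda>\<eta>. 2 * r * D (cis \<eta> * (z1 + of_real t * (z2 - z1)))) (2 * r * (C * (\<omega> r / r)))"
      if "t \<in> {0<..1}" for t
      using that r near[of t] C majorant_nonneg[OF \<omega>, of r] D0
      by (intro circ_bound_cmult[OF p D_near]) auto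
    show "ennreal (cmod (h (cis \<eta> * z2) - h (cis \<eta> * z1)))
        \<le> (\<integral>\<^sup>+t\<in>{0<..1}. ennreal (2 * r * D (cis \<eta> * (z1 + of_real t * (z2 - z1)))) \<partial>lborel)" for \<eta>
    proof -
      have "z1 + of_real t * (z2 - z1) \<in> \<bbbD>" if "t \<in> {0..1}" for t
        using near[OF that] r by simp
      then have "ennreal (cmod (h (cis \<eta> * z2) - h (cis \<eta> * z1)))
        \<le> (\<integral>\<^sup>+t\<in>{0<..1}. ennreal (cmod (z2 - z1) * D (cis \<eta> * (z1 + of_real t * (z2 - z1)))) \<partial>lborel)"
        using line[of 1 z1 "z2 - z1" \<eta>] by simp
      also have "\<dots> \<le> (\<integral>\<^sup>+t\<in>{0<..1}. ennreal (2 * r * D (cis \<eta> * (z1 + of_real t * (z2 - z1)))) \<partial>lborel)"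
        using dist D0 by (intro nn_integral_mono mult_right_mono ennreal_leI) auto
      finally show ?thesis .
    qed
    show "(\<integral>\<^sup>+t\<in>{0<..1::real}. ennreal (2 * r * (C * (\<omega> r / r))) \<partial>lborel) \<le> ennreal (2 * C * \<omega> r)"
      using r by (subst nn_integral_cmult_indicator) (simp_all add: mult_ac)
  qed (use C D0 majorant_nonneg[OF \<omega>, of r] r in auto)
  define K where "K = 4 * (4 * (C * N + 2 * C) + C * N)"
  have "K > 0" using C N by (simp add: K_def add_pos_pos)
  have interior: "circ_bound p (\<lambda>\<eta>. cmod (h (cis \<eta> * z1) - h (cis \<eta> * z2))) (K * \<omega> (dist z1 z2))"
    if z: "z1 \<in> \<bbbD>" "z2 \<in> \<bbbD>" for z1 z2
  proof (cases "z1 = z2")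
    case True
    then show ?thesis
      by (simp add: circ_bound_def majorant_0[OF \<omega>])
  next
    case False
    define r where "r = dist z1 z2 / 2"
    have "dist z1 z2 \<le> 2" using z norm_triangle_ineq4[of z1 z2] by (simp add: dist_norm)
    then have r: "0 < r" "r \<le> 1" using False by (auto simp: r_def)
    define w1 w2 where "w1 = of_real (1 - r) * z1" and "w2 = of_real (1 - r) * z2"
    have w: "cmod (of_real (1 - r) * z) \<le> 1 - r" if "z \<in> \<bbbD>" for z
      using r that mult_left_mono[of "cmod z" 1 "1 - r"] by (simp add: shrink del: of_real_diff)
    have "w2 - w1 = of_real (1 - r) * (z2 - z1)" by (simp add: w1_def w2_def algebra_simps)
    then have "cmod (w2 - w1) \<le> 1 * cmod (z2 - z1)"
      using r mult_right_mono[of "1 - r" 1 "cmod (z2 - z1)"] by (simp add: shrink del: of_real_diff)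
    then have w12: "cmod (w2 - w1) \<le> 2 * r" by (simp add: r_def dist_norm norm_minus_commute)
    have \<omega>r: "0 \<le> \<omega> r" "\<omega> r \<le> \<omega> (dist z1 z2)"
      using r majorant_nonneg[OF \<omega>] majorant_mono[OF \<omega>, of r "dist z1 z2"] by (auto simp: r_def)
    have [measurable]: "(\<lambda>\<eta>. h (cis \<eta> * z1)) \<in> borel_measurable borel" "(\<lambda>\<eta>. h (cis \<eta> * z2)) \<in> borel_measurable borel"
      "(\<lambda>\<eta>. h (cis \<eta> * w1)) \<in> borel_measurable borel" "(\<lambda>\<eta>. h (cis \<eta> * w2)) \<in> borel_measurable borel"
      using z w[OF z(1)] w[OF z(2)] r
      by (auto intro!: borel_measurable_rotation[OF cont] simp: w1_def w2_def simp del: of_real_diff)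
    have ww: "cmod w1 \<le> 1 - r" "cmod w2 \<le> 1 - r"
      unfolding w1_def w2_def using w z by blast+
    have "circ_bound p (\<lambda>\<eta>. cmod (h (cis \<eta> * w1) - h (cis \<eta> * z1)) + cmod (h (cis \<eta> * w2) - h (cis \<eta> * w1)))
        (4 * (C * (N * \<omega> r) + 2 * C * \<omega> r))"
      using C N \<omega>r r z w12 ww
      by (intro circ_bound_add[OF p radial[of r z1, folded w1_def] chord]) auto
    then have "circ_bound p (\<lambda>\<eta>. (cmod (h (cis \<eta> * w1) - h (cis \<eta> * z1)) + cmod (h (cis \<eta> * w2) - h (cis \<eta> * w1)))
        + cmod (h (cis \<eta> * w2) - h (cis \<eta> * z2))) (4 * (4 * (C * (N * \<omega> r) + 2 * C * \<omega> r) + C * (N * \<omega> r)))"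
      using C N \<omega>r r z
      by (intro circ_bound_add[OF p _ radial[of r z2, folded w2_def]]) auto
    then show ?thesis
    proof (rule circ_bound_mono[OF p])
      fix \<eta>
      show "cmod (h (cis \<eta> * z1) - h (cis \<eta> * z2)) \<le>
        (cmod (h (cis \<eta> * w1) - h (cis \<eta> * z1)) + cmod (h (cis \<eta> * w2) - h (cis \<eta> * w1)))
        + cmod (h (cis \<eta> * w2) - h (cis \<eta> * z2))"
        by norm
      have "4 * (4 * (C * (N * \<omega> r) + 2 * C * \<omega> r) + C * (N * \<omega> r)) = K * \<omega> r"
        by (simp add: K_def algebra_simps)
      also have "\<dots> \<le> K * \<omega> (dist z1 z2)"
        using \<open>K > 0\<close> \<omega>r by (intro mult_left_mono) auto
      finally show "4 * (4 * (C * (N * \<omega> r) + 2 * C * \<omega> r) + C * (N * \<omega> r)) \<le> K * \<omega> (dist z1 z2)" .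
    qed (use C N \<omega>r in auto)
  qed
  have "circ_bound p (\<lambda>\<eta>. cmod (h (cis \<eta> * z1) - h (cis \<eta> * z2))) (K * \<omega> (dist z1 z2))"
    if z: "z1 \<in> closed_unit_disk" "z2 \<in> closed_unit_disk" for z1 z2
  proof -
    define s where "s n = 1 - inverse (real (Suc n))" for n
    have s: "0 \<le> s n" "s n < 1" for n by (auto simp: s_def inverse_eq_divide)
    have "s \<longlonglongrightarrow> 1 - 0"
      unfolding s_def by (intro tendsto_diff tendsto_const LIMSEQ_inverse_real_of_nat)
    then have lim: "(\<lambda>n. of_real (s n) * z) \<longlonglongrightarrow> z" for z :: complex
      by (intro tendsto_eq_intros) auto
    have sz: "of_real (s n) * z \<in> \<bbbD>" if "z \<in> closed_unit_disk" for n z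
      using that s[of n] mult_left_le_one_le[of "s n" "cmod z"] mult_left_le[of "cmod z" "s n"]
      by (simp add: norm_mult)
    have hlim: "(\<lambda>n. h (cis \<eta> * (of_real (s n) * z))) \<longlonglongrightarrow> h (cis \<eta> * z)" if "z \<in> closed_unit_disk" for \<eta> z
      using that sz[OF that] by (intro continuous_on_tendsto_compose[OF cont] tendsto_mult_left lim)
        (auto simp: norm_mult eventually_sequentially less_imp_le)
    show ?thesis
    proof (rule circ_bound_pointwise_limit[OF p])
      fix n
      have "dist (of_real (s n) * z1) (of_real (s n) * z2) = s n * dist z1 z2"
        using s[of n] by (simp add: dist_norm norm_mult flip: right_diff_distrib)
      then have "\<omega> (dist (of_real (s n) * z1) (of_real (s n) * z2)) \<le> \<omega> (dist z1 z2)"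
        using s[of n] by (intro majorant_mono[OF \<omega>]) (auto simp: mult_left_le_one_le)
      then show "circ_bound p (\<lambda>\<eta>. cmod (h (cis \<eta> * (of_real (s n) * z1)) - h (cis \<eta> * (of_real (s n) * z2))))
          (K * \<omega> (dist z1 z2))"
        using \<open>K > 0\<close> majorant_nonneg[OF \<omega>]
        by (intro circ_bound_mono[OF p interior[OF sz[OF z(1), of n] sz[OF z(2), of n]]]) auto
      have "(\<lambda>\<eta>. h (cis \<eta> * (of_real (s n) * z))) \<in> borel_measurable borel" if "z \<in> closed_unit_disk" for z
        using sz[OF that, of n] by (intro borel_measurable_rotation[OF cont]) auto
      from this[OF z(1)] this[OF z(2)]
      show "(\<lambda>\<eta>. cmod (h (cis \<eta> * (of_real (s n) * z1)) - h (cis \<eta> * (of_real (s n) * z2)))) \<in> borel_measurable borel"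
        by measurable
    next
      show "(\<lambda>n. cmod (h (cis \<eta> * (of_real (s n) * z1)) - h (cis \<eta> * (of_real (s n) * z2))))
          \<longlonglongrightarrow> cmod (h (cis \<eta> * z1) - h (cis \<eta> * z2))" for \<eta>
        by (intro tendsto_norm tendsto_diff hlim z)
    qed simp
  qed
  then show ?thesis using \<open>K > 0\<close> by (auto simp: mean_modulus_def)
qed

section \<open>Averages over half balls\<close>

text \<open>The inner average in the definition of \<open>Y_mean\<close>, for a holomorphic function in place of the gradient of a
harmonic function.\<close>

definition half_ball_mean :: "real \<Rightarrow> (complex \<Rightarrow> complex) \<Rightarrow> complex \<Rightarrow> real \<Rightarrow> real"
  where "half_ball_mean q \<phi> z \<eta> = 1 / measure lborel (half_ball z) *
    (LINT \<xi>:half_ball z|lborel. cmod (\<phi> (\<xi> * cis \<eta>)) powr q)"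

lemma half_ball_facts:
  assumes "z \<in> \<bbbD>"
  shows half_ball_dist: "\<xi> \<in> half_ball z \<Longrightarrow> dist_bdry z / 2 \<le> dist_bdry \<xi>"
    and half_ball_subset: "half_ball z \<subseteq> cball 0 ((1 + cmod z) / 2)"
    and half_ball_measure: "0 < measure lborel (half_ball z)"
    and half_ball_emeasure: "emeasure lborel (half_ball z) = ennreal (measure lborel (half_ball z))"
    and half_ball_sets: "half_ball z \<in> sets borel"
proof -
  have tri: "cmod \<xi> \<le> cmod z + dist_bdry z / 2" if "\<xi> \<in> half_ball z" for \<xi>
    using that norm_triangle_ineq[of z "\<xi> - z"] by (simp add: half_ball_def dist_norm norm_minus_commute)
  then show "\<xi> \<in> half_ball z \<Longrightarrow> dist_bdry z / 2 \<le> dist_bdry \<xi>"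
    by (force simp: dist_bdry_def field_simps)
  show "half_ball z \<subseteq> cball 0 ((1 + cmod z) / 2)"
    using tri by (force simp: dist_bdry_def field_simps)
  show "0 < measure lborel (half_ball z)"
    using assms unfolding half_ball_def by (subst content_ball_gt_0_iff) (simp add: dist_bdry_def)
  show "emeasure lborel (half_ball z) = ennreal (measure lborel (half_ball z))"
    unfolding half_ball_def using emeasure_lborel_ball_finite[of z "dist_bdry z / 2"]
    by (intro emeasure_eq_ennreal_measure) auto
  show "half_ball z \<in> sets borel" by (simp add: half_ball_def)
qed

lemma half_ball_mean_nn:
  assumes \<phi>: "\<phi> holomorphic_on \<bbbD>" and q: "0 < q" and z: "z \<in> \<bbbD>"
  shows half_ball_mean_nonneg: "0 \<le> half_ball_mean q \<phi> z \<eta>"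
    and half_ball_mean_eq: "ennreal (half_ball_mean q \<phi> z \<eta>) = ennreal (1 / measure lborel (half_ball z)) *
      (\<integral>\<^sup>+\<xi>\<in>half_ball z. ennreal (cmod (\<phi> (\<xi> * cis \<eta>)) powr q) \<partial>lborel)"
    and half_ball_mean_measurable: "half_ball_mean q \<phi> z \<in> borel_measurable borel"
    and half_ball_mean_bounded: "\<exists>B. \<forall>\<eta>. half_ball_mean q \<phi> z \<eta> \<le> B"
proof -
  define m where "m = measure lborel (half_ball z)"
  define R where "R = (1 + cmod z) / 2"
  note hb = half_ball_facts[OF z]
  have m: "0 < m" unfolding m_def by (rule hb)
  have cont: "continuous_on (cball 0 R) (\<lambda>w. cmod (\<phi> w) powr q)"
    using z q by (intro continuous_on_powr' continuous_on_norm continuous_on_const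
        continuous_on_subset[OF holomorphic_on_imp_continuous_on[OF \<phi>]]) (auto simp: R_def)
  then have "bounded ((\<lambda>w. cmod (\<phi> w) powr q) ` cball 0 R)"
    by (intro compact_imp_bounded compact_continuous_image) auto
  then obtain B where "\<forall>x\<in>(\<lambda>w. cmod (\<phi> w) powr q) ` cball 0 R. norm x \<le> B"
    by (auto simp only: bounded_iff)
  then have B: "cmod (\<phi> w) powr q \<le> B" if "w \<in> cball 0 R" for w
    using that by force
  define k where "k w = indicator (cball 0 R) w *\<^sub>R (cmod (\<phi> w) powr q)" for w
  have [measurable]: "k \<in> borel_measurable borel"
    unfolding k_def by (intro borel_measurable_continuous_on_indicator cont) auto
  have k: "cmod (\<phi> (\<xi> * cis \<eta>)) powr q = k (\<xi> * cis \<eta>)" if "\<xi> \<in> half_ball z" for \<xi> \<eta>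
    using that hb(2) by (auto simp: k_def norm_mult R_def)
  have k0: "0 \<le> k w" for w by (simp add: k_def)
  have "0 \<le> B" using B[of 0] z by (auto simp: R_def intro: order_trans[OF powr_ge_zero])
  then have kB: "k w \<le> B" for w using B by (auto simp: k_def indicator_def)
  have [measurable]: "half_ball z \<in> sets borel" by (rule hb)
  have eq: "half_ball_mean q \<phi> z \<eta> = 1 / m * (\<integral>\<xi>. indicator (half_ball z) \<xi> *\<^sub>R k (\<xi> * cis \<eta>) \<partial>lborel)" for \<eta>
    unfolding half_ball_mean_def m_def set_lebesgue_integral_def
    by (intro arg_cong2[where f = "(*)"] Bochner_Integration.integral_cong refl) (auto simp: indicator_def k)
  have int: "integrable lborel (\<lambda>\<xi>. indicator (half_ball z) \<xi> *\<^sub>R k (\<xi> * cis \<eta>))" for \<eta>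
  proof (rule integrableI_bounded_set[where A = "half_ball z" and B = B])
    show "emeasure lborel (half_ball z) < \<infinity>" by (simp add: hb(4))
    show "AE x in lborel. x \<in> half_ball z \<longrightarrow> norm (indicator (half_ball z) x *\<^sub>R k (x * cis \<eta>)) \<le> B"
      using kB k0 by auto
  qed auto
  have int_le: "(\<integral>\<xi>. indicator (half_ball z) \<xi> *\<^sub>R k (\<xi> * cis \<eta>) \<partial>lborel) \<le> B * m" for \<eta>
  proof -
    have "(\<integral>\<xi>. indicator (half_ball z) \<xi> *\<^sub>R k (\<xi> * cis \<eta>) \<partial>lborel)
        \<le> (\<integral>\<xi>. indicator (half_ball z) \<xi> *\<^sub>R B \<partial>lborel)"
    proof (rule integral_mono[OF int])
      show "integrable lborel (\<lambda>\<xi>. indicator (half_ball z) \<xi> *\<^sub>R B)"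
        by (intro integrable_scaleR_left integrable_real_indicator) (simp_all add: hb(4))
    qed (auto simp: indicator_def kB)
    then show ?thesis by (simp add: m_def mult.commute)
  qed
  show "0 \<le> half_ball_mean q \<phi> z \<eta>"
    unfolding eq using m k0 by (intro mult_nonneg_nonneg integral_nonneg_AE) auto
  show "half_ball_mean q \<phi> z \<in> borel_measurable borel"
  proof -
    have "(\<lambda>\<eta>. \<integral>\<xi>. indicator (half_ball z) \<xi> *\<^sub>R k (\<xi> * cis \<eta>) \<partial>lborel) \<in> borel_measurable borel"
      by (rule lborel.borel_measurable_lebesgue_integral) measurable
    then show ?thesis unfolding eq[abs_def] by measurable
  qed
  show "\<exists>B. \<forall>\<eta>. half_ball_mean q \<phi> z \<eta> \<le> B"
  proof (intro exI allI)
    fix \<eta>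
    show "half_ball_mean q \<phi> z \<eta> \<le> 1 / m * (B * m)"
      unfolding eq using int_le m by (intro mult_left_mono) auto
  qed
  have "ennreal (half_ball_mean q \<phi> z \<eta>)
      = ennreal (1 / m) * ennreal (\<integral>\<xi>. indicator (half_ball z) \<xi> *\<^sub>R k (\<xi> * cis \<eta>) \<partial>lborel)"
    unfolding eq using m by (intro ennreal_mult') auto
  also have "ennreal (\<integral>\<xi>. indicator (half_ball z) \<xi> *\<^sub>R k (\<xi> * cis \<eta>) \<partial>lborel)
      = (\<integral>\<^sup>+\<xi>. ennreal (indicator (half_ball z) \<xi> *\<^sub>R k (\<xi> * cis \<eta>)) \<partial>lborel)"
    using k0 by (intro nn_integral_eq_integral[symmetric] int) auto
  also have "\<dots> = (\<integral>\<^sup>+\<xi>\<in>half_ball z. ennreal (cmod (\<phi> (\<xi> * cis \<eta>)) powr q) \<partial>lborel)"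
    by (intro nn_integral_cong) (auto simp: indicator_def k)
  finally show "ennreal (half_ball_mean q \<phi> z \<eta>) = ennreal (1 / measure lborel (half_ball z)) *
      (\<integral>\<^sup>+\<xi>\<in>half_ball z. ennreal (cmod (\<phi> (\<xi> * cis \<eta>)) powr q) \<partial>lborel)"
    by (simp add: m_def)
qed

text \<open>From left to right, every point of the half ball has at least half the distance of its centre to
the boundary, and Minkowski's inequality with exponent \<open>p / q\<close> bounds the average.  From right to left,
the value at the centre is controlled by the average, by the sub-mean value property of
the \<open>q\<close>-th power.\<close>

lemma mean_growth_iff_half_ball_mean:
  assumes p: "1 \<le> p" and \<omega>: "majorant \<omega>" and \<phi>: "\<phi> holomorphic_on \<bbbD>" and q: "0 < q" "ereal q \<le> p"
  shows "mean_growth \<omega> p (\<lambda>w. cmod (\<phi> w)) \<longleftrightarrow> (\<exists>M>0. \<forall>z\<in>\<bbbD>.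
    circ_bound p (\<lambda>\<eta>. half_ball_mean q \<phi> z \<eta> powr (1 / q)) (M * (\<omega> (dist_bdry z) / dist_bdry z)))"
proof
  assume "mean_growth \<omega> p (\<lambda>w. cmod (\<phi> w))"
  then obtain M where M: "0 < M" and bound: "\<And>z. z \<in> \<bbbD> \<Longrightarrow>
      circ_bound p (\<lambda>\<eta>. cmod (\<phi> (cis \<eta> * z))) (M * (\<omega> (dist_bdry z) / dist_bdry z))"
    by (auto simp: mean_growth_def)
  obtain p' where p': "1 \<le> p'" and powr: "\<And>X B. (\<And>\<eta>. 0 \<le> X \<eta>) \<Longrightarrow> 0 \<le> B \<Longrightarrow>
      circ_bound p X B \<longleftrightarrow> circ_bound p' (\<lambda>\<eta>. X \<eta> powr q) (B powr q)"
    using circ_bound_powr[OF p q] by blast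
  have "circ_bound p (\<lambda>\<eta>. half_ball_mean q \<phi> z \<eta> powr (1 / q)) (2 * M * (\<omega> (dist_bdry z) / dist_bdry z))"
    if z: "z \<in> \<bbbD>" for z
  proof -
    note hb = half_ball_facts[OF z]
    note mean = half_ball_mean_nn[OF \<phi> q(1) z]
    define m where "m = measure lborel (half_ball z)"
    define d where "d = dist_bdry z"
    define C where "C = 2 * M * (\<omega> d / d)"
    have d: "0 < d" using z by (simp add: d_def dist_bdry_def)
    have m: "0 < m" unfolding m_def by (rule hb)
    have C: "0 \<le> C" using M d majorant_nonneg[OF \<omega>, of d] by (simp add: C_def)
    have [measurable]: "half_ball z \<in> sets borel" by (rule hb)
    define \<Phi> where "\<Phi> w = indicator \<bbbD> w * cmod (\<phi> w)" for w
    have [measurable]: "\<Phi> \<in> borel_measurable borel"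
      unfolding \<Phi>_def by (rule measurable_cmod_indicator[OF \<phi>]) auto
    have sub: "half_ball z \<subseteq> \<bbbD>" using hb(2) z by (force simp: dist_bdry_def)
    have \<Phi>: "\<Phi> (cis \<eta> * \<xi>) = cmod (\<phi> (cis \<eta> * \<xi>))" if "\<xi> \<in> half_ball z" for \<eta> \<xi>
      using sub that by (auto simp: \<Phi>_def norm_mult)
    have "circ_bound p' (half_ball_mean q \<phi> z) (C powr q)"
    proof (rule circ_bound_integral[where A = "half_ball z" and b = "\<lambda>_. 1 / m * C powr q"
          and X = "\<lambda>\<xi> \<eta>. 1 / m * \<Phi> (cis \<eta> * \<xi>) powr q", OF p'])
      show "(\<lambda>(\<xi>, \<eta>). 1 / m * \<Phi> (cis \<eta> * \<xi>) powr q) \<in> borel_measurable (borel \<Otimes>\<^sub>M borel)"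
        by measurable
      show "(\<integral>\<^sup>+\<xi>\<in>half_ball z. ennreal (1 / m * C powr q) \<partial>lborel) \<le> ennreal (C powr q)"
        using m by (subst nn_integral_cmult_indicator) (simp_all add: hb(4) m_def[symmetric] flip: ennreal_mult)
      show "circ_bound p' (\<lambda>\<eta>. 1 / m * \<Phi> (cis \<eta> * \<xi>) powr q) (1 / m * C powr q)" if \<xi>: "\<xi> \<in> half_ball z" for \<xi>
      proof (rule circ_bound_cmult[OF p'])
        have "circ_bound p (\<lambda>\<eta>. cmod (\<phi> (cis \<eta> * \<xi>))) C"
        proof (rule circ_bound_mono[OF p bound])
          show "\<xi> \<in> \<bbbD>" using sub \<xi> by auto
          have d2: "d / 2 \<le> dist_bdry \<xi>" unfolding d_def by (rule hb(1)[OF \<xi>])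
          then show "0 \<le> M * (\<omega> (dist_bdry \<xi>) / dist_bdry \<xi>)"
            using d M majorant_nonneg[OF \<omega>, of "dist_bdry \<xi>"] by simp
          have "\<omega> (dist_bdry \<xi>) / dist_bdry \<xi> \<le> \<omega> (d / 2) / (d / 2)"
            using d d2 by (intro majorant_ratio[OF \<omega>]) auto
          also have "\<dots> \<le> 2 * (\<omega> d / d)" by (rule majorant_half_ratio[OF \<omega> d])
          finally have "M * (\<omega> (dist_bdry \<xi>) / dist_bdry \<xi>) \<le> M * (2 * (\<omega> d / d))"
            using M by (intro mult_left_mono) auto
          also have "\<dots> = C" by (simp add: C_def)
          finally show "M * (\<omega> (dist_bdry \<xi>) / dist_bdry \<xi>) \<le> C" .
        qed auto
        then have "circ_bound p (\<lambda>\<eta>. \<Phi> (cis \<eta> * \<xi>)) C" using \<xi> by (simp add: \<Phi>)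
        moreover have "0 \<le> \<Phi> w" for w by (simp add: \<Phi>_def)
        ultimately show "circ_bound p' (\<lambda>\<eta>. \<Phi> (cis \<eta> * \<xi>) powr q) (C powr q)"
          using powr[of "\<lambda>\<eta>. \<Phi> (cis \<eta> * \<xi>)" C] C by simp
      qed (use m in auto)
      show "ennreal (half_ball_mean q \<phi> z \<eta>)
          \<le> (\<integral>\<^sup>+\<xi>\<in>half_ball z. ennreal (1 / m * \<Phi> (cis \<eta> * \<xi>) powr q) \<partial>lborel)" for \<eta>
      proof -
        have "(\<integral>\<^sup>+\<xi>\<in>half_ball z. ennreal (cmod (\<phi> (\<xi> * cis \<eta>)) powr q) \<partial>lborel)
            = (\<integral>\<^sup>+\<xi>\<in>half_ball z. ennreal (\<Phi> (cis \<eta> * \<xi>) powr q) \<partial>lborel)"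
          by (intro nn_integral_cong) (auto simp: indicator_def \<Phi> mult.commute[of _ "cis \<eta>"])
        then have "ennreal (half_ball_mean q \<phi> z \<eta>)
            = ennreal (1 / m) * (\<integral>\<^sup>+\<xi>\<in>half_ball z. ennreal (\<Phi> (cis \<eta> * \<xi>) powr q) \<partial>lborel)"
          unfolding mean(2) m_def[symmetric] by (simp only:)
        also have "\<dots> = (\<integral>\<^sup>+\<xi>. ennreal (1 / m) * (ennreal (\<Phi> (cis \<eta> * \<xi>) powr q) * indicator (half_ball z) \<xi>) \<partial>lborel)"
          by (rule nn_integral_cmult[symmetric]) measurable
        also have "\<dots> = (\<integral>\<^sup>+\<xi>\<in>half_ball z. ennreal (1 / m * \<Phi> (cis \<eta> * \<xi>) powr q) \<partial>lborel)"
          using m by (simp only: ennreal_mult'[of "1 / m"] zero_le_divide_1_iff less_imp_le mult.assoc)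
        finally show ?thesis by simp
      qed
    qed (use m C mean(1) hb(4) in auto)
    then have "circ_bound p' (\<lambda>\<eta>. (half_ball_mean q \<phi> z \<eta> powr (1 / q)) powr q) (C powr q)"
      using q mean(1) by (simp add: powr_powr)
    then show ?thesis
      using powr[of "\<lambda>\<eta>. half_ball_mean q \<phi> z \<eta> powr (1 / q)" C] C by (simp add: C_def d_def)
  qed
  then show "\<exists>M>0. \<forall>z\<in>\<bbbD>.
    circ_bound p (\<lambda>\<eta>. half_ball_mean q \<phi> z \<eta> powr (1 / q)) (M * (\<omega> (dist_bdry z) / dist_bdry z))"
    using M by (intro exI[of _ "2 * M"]) auto
next
  assume "\<exists>M>0. \<forall>z\<in>\<bbbD>.
    circ_bound p (\<lambda>\<eta>. half_ball_mean q \<phi> z \<eta> powr (1 / q)) (M * (\<omega> (dist_bdry z) / dist_bdry z))"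
  then obtain M where M: "0 < M" and bound: "\<And>z. z \<in> \<bbbD> \<Longrightarrow>
    circ_bound p (\<lambda>\<eta>. half_ball_mean q \<phi> z \<eta> powr (1 / q)) (M * (\<omega> (dist_bdry z) / dist_bdry z))"
    by blast
  obtain C where C: "0 < C" and submean: "\<And>(F :: complex \<Rightarrow> complex) S z r. F holomorphic_on S \<Longrightarrow> open S \<Longrightarrow>
    cball z r \<subseteq> S \<Longrightarrow> 0 < r \<Longrightarrow> ennreal (cmod (F z) powr q) * emeasure lborel (ball z r)
    \<le> ennreal C * (\<integral>\<^sup>+w\<in>ball z r. ennreal (cmod (F w) powr q) \<partial>lborel)"
    by (rule power_area_submean[OF q(1)]) (rule that)
  have "circ_bound p (\<lambda>\<eta>. cmod (\<phi> (cis \<eta> * z))) (C powr (1 / q) * (M * (\<omega> (dist_bdry z) / dist_bdry z)))"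
    if z: "z \<in> \<bbbD>" for z
  proof -
    note hb = half_ball_facts[OF z]
    note mean = half_ball_mean_nn[OF \<phi> q(1) z]
    define m where "m = measure lborel (half_ball z)"
    have m: "0 < m" unfolding m_def by (rule hb)
    have pointwise: "cmod (\<phi> (cis \<eta> * z)) \<le> C powr (1 / q) * half_ball_mean q \<phi> z \<eta> powr (1 / q)" for \<eta>
    proof -
      have rot: "(\<lambda>\<xi>. \<phi> (\<xi> * cis \<eta>)) holomorphic_on \<bbbD>"
        by (rule holomorphic_on_compose_gen[OF _ \<phi>, unfolded o_def])
           (auto simp: norm_mult intro!: holomorphic_intros)
      have "cball z (dist_bdry z / 2) \<subseteq> \<bbbD>"
      proof
        fix \<xi> assume "\<xi> \<in> cball z (dist_bdry z / 2)"
        then show "\<xi> \<in> \<bbbD>"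
          using z norm_triangle_ineq[of z "\<xi> - z"]
          by (simp add: dist_norm norm_minus_commute dist_bdry_def field_simps)
      qed
      moreover have "0 < dist_bdry z / 2" using z by (simp add: dist_bdry_def)
      ultimately have "ennreal (cmod (\<phi> (z * cis \<eta>)) powr q) * emeasure lborel (half_ball z)
          \<le> ennreal C * (\<integral>\<^sup>+\<xi>\<in>half_ball z. ennreal (cmod (\<phi> (\<xi> * cis \<eta>)) powr q) \<partial>lborel)"
        unfolding half_ball_def by (rule submean[OF rot open_ball])
      then have "ennreal (cmod (\<phi> (z * cis \<eta>)) powr q) * ennreal m
          \<le> ennreal C * (\<integral>\<^sup>+\<xi>\<in>half_ball z. ennreal (cmod (\<phi> (\<xi> * cis \<eta>)) powr q) \<partial>lborel)"
        by (simp only: hb(4) m_def)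
      then have "ennreal (1 / m) * (ennreal (cmod (\<phi> (z * cis \<eta>)) powr q) * ennreal m)
          \<le> ennreal (1 / m) * (ennreal C * (\<integral>\<^sup>+\<xi>\<in>half_ball z. ennreal (cmod (\<phi> (\<xi> * cis \<eta>)) powr q) \<partial>lborel))"
        by (rule mult_left_mono) simp
      also have "\<dots> = ennreal C * ennreal (half_ball_mean q \<phi> z \<eta>)"
        by (simp add: mean(2) m_def mult_ac)
      also have "\<dots> = ennreal (C * half_ball_mean q \<phi> z \<eta>)"
        using C mean(1) by (simp add: ennreal_mult)
      also have "ennreal (1 / m) * (ennreal (cmod (\<phi> (z * cis \<eta>)) powr q) * ennreal m)
          = ennreal (cmod (\<phi> (z * cis \<eta>)) powr q)"
        using m by (simp flip: ennreal_mult)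
      finally have "cmod (\<phi> (z * cis \<eta>)) powr q \<le> C * half_ball_mean q \<phi> z \<eta>"
        using C mean(1)[of \<eta>] by (simp add: ennreal_le_iff)
      then have "(cmod (\<phi> (z * cis \<eta>)) powr q) powr (1 / q) \<le> (C * half_ball_mean q \<phi> z \<eta>) powr (1 / q)"
        using q by (intro powr_mono2) auto
      then show ?thesis
        using q C mean(1) by (simp add: powr_powr powr_mult mult.commute)
    qed
    have "0 \<le> M * (\<omega> (dist_bdry z) / dist_bdry z)"
      using M z majorant_nonneg[OF \<omega>, of "dist_bdry z"] by (simp add: dist_bdry_def)
    moreover have "(\<lambda>\<eta>. half_ball_mean q \<phi> z \<eta> powr (1 / q)) \<in> borel_measurable borel"
      using mean(3) by measurable
    ultimately have "circ_bound p (\<lambda>\<eta>. C powr (1 / q) * half_ball_mean q \<phi> z \<eta> powr (1 / q))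
        (C powr (1 / q) * (M * (\<omega> (dist_bdry z) / dist_bdry z)))"
      by (intro circ_bound_cmult[OF p bound[OF z]]) auto
    then show ?thesis
      by (rule circ_bound_mono[OF p])
         (use pointwise \<open>0 \<le> M * (\<omega> (dist_bdry z) / dist_bdry z)\<close> in \<open>auto intro!: mult_nonneg_nonneg simp del: times_divide_eq_right\<close>)
  qed
  then show "mean_growth \<omega> p (\<lambda>w. cmod (\<phi> w))"
    using M C unfolding mean_growth_def
    by (intro exI[of _ "C powr (1 / q) * M"]) (auto simp: mult.assoc simp del: times_divide_eq_right)
qed

section \<open>Wirtinger derivatives of harmonic functions\<close>

lemma wirtinger_harmonic:
  assumes "h holomorphic_on \<bbbD>" "g holomorphic_on \<bbbD>"
    and F: "\<And>w. w \<in> \<bbbD> \<Longrightarrow> F w = h w + cnj (g w)" and z: "z \<in> \<bbbD>"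
  shows "wirtinger F z = deriv h z" and "wirtinger_bar F z = cnj (deriv g z)"
proof -
  have dir: "((\<lambda>t. F (z + a * of_real t)) has_vector_derivative deriv h z * a + cnj (deriv g z * a)) (at 0)" for a
  proof -
    have line: "((\<lambda>t. z + a * of_real t) has_vector_derivative a) (at 0)"
      by (auto intro!: derivative_eq_intros)
    have comp: "((\<lambda>t. k (z + a * of_real t)) has_vector_derivative deriv k z * a) (at 0)"
      if "k holomorphic_on \<bbbD>" for k
    proof -
      have "(k has_field_derivative deriv k z) (at (z + a * of_real 0))"
        using holomorphic_derivI[OF that open_ball z] by simp
      from field_vector_diff_chain_at[OF line this] show ?thesis
        by (simp add: o_def mult.commute)
    qed
    have "((\<lambda>t. h (z + a * of_real t) + cnj (g (z + a * of_real t)))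
        has_vector_derivative deriv h z * a + cnj (deriv g z * a)) (at 0)"
      by (intro has_vector_derivative_add comp assms has_vector_derivative_cnj)
    moreover have "open ((\<lambda>t::real. z + a * of_real t) -` \<bbbD>)"
      by (intro open_vimage continuous_intros open_ball)
    ultimately show ?thesis
      using z by (elim has_vector_derivative_transform_within_open) (auto simp: F)
  qed
  have px: "partial_x F z = deriv h z + cnj (deriv g z)"
    using dir[of 1] unfolding partial_x_def by (intro vector_derivative_at) simp
  have py: "partial_y F z = deriv h z * \<i> + cnj (deriv g z * \<i>)"
    using dir[of \<i>] unfolding partial_y_def by (intro vector_derivative_at)
  show "wirtinger F z = deriv h z" "wirtinger_bar F z = cnj (deriv g z)"
    by (simp_all add: wirtinger_def wirtinger_bar_def px py algebra_simps)
qed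

lemma max_deriv_Re:
  assumes \<phi>: "\<phi> holomorphic_on \<bbbD>" and F: "\<And>w. w \<in> \<bbbD> \<Longrightarrow> F w = of_real (Re (\<phi> w))" and z: "z \<in> \<bbbD>"
  shows "max_deriv F z = cmod (deriv \<phi> z)"
proof -
  have hol: "(\<lambda>w. \<phi> w / 2) holomorphic_on \<bbbD>" by (intro holomorphic_intros \<phi>) auto
  have half: "F w = \<phi> w / 2 + cnj (\<phi> w / 2)" if "w \<in> \<bbbD>" for w
    using F[OF that] by (simp add: complex_eq_iff)
  have half_deriv: "deriv (\<lambda>w. \<phi> w / 2) z = deriv \<phi> z / 2"
    using holomorphic_on_imp_differentiable_at[OF \<phi> open_ball z] by (intro deriv_cdivide_right) 
  have W: "wirtinger F z = deriv (\<lambda>w. \<phi> w / 2) z" "wirtinger_bar F z = cnj (deriv (\<lambda>w. \<phi> w / 2) z)"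
    using wirtinger_harmonic[OF hol hol _ z, of F] half by blast+
  show ?thesis
    unfolding max_deriv_def W half_deriv by (simp add: norm_divide)
qed

lemma deriv_mean_bounds_iff_mean_growth:
  assumes p: "1 \<le> p" and \<omega>: "majorant \<omega>" and cont: "continuous_on \<bbbD> (max_deriv f)"
  shows "(\<exists>M>0. \<forall>z\<in>\<bbbD>. deriv_mean p f z \<le> M * (\<omega> (dist_bdry z) / dist_bdry z)) \<longleftrightarrow> mean_growth \<omega> p (max_deriv f)"
  unfolding mean_growth_def
proof (intro ex_cong1 conj_cong ball_cong refl)
  fix M :: real and z assume "0 < M" and z: "z \<in> \<bbbD>"
  have "continuous_on {0..2 * pi} (\<lambda>\<eta>. max_deriv f (cis \<eta> * z))"
    using z by (intro continuous_on_rotation[of "cmod z"] continuous_on_subset[OF cont]) auto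
  moreover have "0 \<le> max_deriv f (cis \<eta> * z)" for \<eta> by (simp add: max_deriv_def)
  ultimately have int: "p < \<infinity> \<Longrightarrow>
      set_integrable lborel {0..2 * pi} (\<lambda>\<eta>. max_deriv f (cis \<eta> * z) powr real_of_ereal p)"
    by (intro set_integrable_powr_of_continuous[OF p])
  have "0 \<le> M * (\<omega> (dist_bdry z) / dist_bdry z)"
    using \<open>0 < M\<close> z majorant_nonneg[OF \<omega>, of "dist_bdry z"] by (simp add: dist_bdry_def)
  from circ_bound_iff[OF p this int]
  show "deriv_mean p f z \<le> M * (\<omega> (dist_bdry z) / dist_bdry z)
      \<longleftrightarrow> circ_bound p (\<lambda>\<eta>. max_deriv f (cis \<eta> * z)) (M * (\<omega> (dist_bdry z) / dist_bdry z))"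
    by (cases "p = \<infinity>") (simp_all add: deriv_mean_def mult.commute[of z])
qed

lemma Y_mean_bounds_iff_mean_growth:
  assumes p: "1 \<le> p" and \<omega>: "majorant \<omega>" and \<phi>: "\<phi> holomorphic_on \<bbbD>" and q: "0 < q" "ereal q \<le> p"
    and w: "\<And>\<xi>. \<xi> \<in> \<bbbD> \<Longrightarrow> w \<xi> = Re (\<phi> \<xi>)"
  shows "(\<exists>M>0. \<forall>z\<in>\<bbbD>. Y_mean w q p z \<le> M * (\<omega> (dist_bdry z) / dist_bdry z))
    \<longleftrightarrow> mean_growth \<omega> p (\<lambda>z. cmod (deriv \<phi> z))"
proof -
  have d\<phi>: "deriv \<phi> holomorphic_on \<bbbD>" by (rule holomorphic_deriv[OF \<phi> open_ball])
  have md: "max_deriv (\<lambda>x. of_real (w x)) \<xi> = cmod (deriv \<phi> \<xi>)" if "\<xi> \<in> \<bbbD>" for \<xi>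
    by (rule max_deriv_Re[OF \<phi> _ that]) (simp add: w)
  have "Y_mean w q p z \<le> B \<longleftrightarrow> circ_bound p (\<lambda>\<eta>. half_ball_mean q (deriv \<phi>) z \<eta> powr (1 / q)) B"
    if z: "z \<in> \<bbbD>" and "0 \<le> B" for z B
  proof -
    note hb = half_ball_facts[OF z]
    note mean = half_ball_mean_nn[OF d\<phi> q(1) z]
    have inD: "\<xi> * cis \<eta> \<in> \<bbbD>" if "\<xi> \<in> half_ball z" for \<xi> \<eta>
      using hb(2) that z by (force simp: norm_mult)
    have avg: "1 / measure lborel (half_ball z) *
        (LINT \<xi>:half_ball z|lborel. max_deriv (\<lambda>x. of_real (w x)) (\<xi> * cis \<eta>) powr q)
        = half_ball_mean q (deriv \<phi>) z \<eta>" for \<eta>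
      unfolding half_ball_mean_def
      using hb(5)
      by (intro arg_cong2[where f = "(*)"] set_lebesgue_integral_cong refl allI impI)
         (simp_all only: md[OF inD] sets_lborel)
    have int: "set_integrable lborel {0..2 * pi} (\<lambda>\<eta>. (half_ball_mean q (deriv \<phi>) z \<eta> powr (1 / q)) powr real_of_ereal p)"
      if "p < \<infinity>"
    proof -
      obtain B where B: "\<And>\<eta>. half_ball_mean q (deriv \<phi>) z \<eta> \<le> B" using mean(4) by blast
      have [measurable]: "half_ball_mean q (deriv \<phi>) z \<in> borel_measurable borel" by (rule mean(3))
      show ?thesis
        unfolding set_integrable_def
      proof (rule integrableI_bounded_set[where A = "{0..2 * pi}" and B = "(B powr (1 / q)) powr real_of_ereal p"])
        have "0 \<le> real_of_ereal p" using p by (cases p) auto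
        then show "AE x in lborel. x \<in> {0..2 * pi} \<longrightarrow> norm (indicator {0..2 * pi} x *\<^sub>R
            ((half_ball_mean q (deriv \<phi>) z x powr (1 / q)) powr real_of_ereal p)) \<le> (B powr (1 / q)) powr real_of_ereal p"
          using B mean(1) q by (intro AE_I2) (auto intro!: powr_mono2)
      qed auto
    qed
    have "Y_mean w q p z = (if p = \<infinity> then half_ball_mean q (deriv \<phi>) z 0 powr (1 / q)
      else (LINT \<eta>:{0..2 * pi}|lborel. (half_ball_mean q (deriv \<phi>) z \<eta> powr (1 / q)) powr real_of_ereal p)
        powr (1 / real_of_ereal p))"
      unfolding Y_mean_def avg using avg[of 0] by (simp add: powr_powr)
    then show ?thesis
      using circ_bound_iff[OF p \<open>0 \<le> B\<close> int] by simp
  qed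
  then have "(\<exists>M>0. \<forall>z\<in>\<bbbD>. Y_mean w q p z \<le> M * (\<omega> (dist_bdry z) / dist_bdry z)) \<longleftrightarrow>
    (\<exists>M>0. \<forall>z\<in>\<bbbD>. circ_bound p (\<lambda>\<eta>. half_ball_mean q (deriv \<phi>) z \<eta> powr (1 / q))
      (M * (\<omega> (dist_bdry z) / dist_bdry z)))"
    using majorant_nonneg[OF \<omega>]
    by (intro ex_cong1 conj_cong ball_cong refl) (simp add: dist_bdry_def)
  then show ?thesis
    using mean_growth_iff_half_ball_mean[OF p \<omega> d\<phi> q] by simp
qed

section \<open>Moduli of harmonic functions and quasiregularity\<close>

lemma unimodular_rotation_to_modulus:
  obtains c :: complex where "cmod c = 1" "c * w = of_real (cmod w)"
proof (cases "w = 0")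
  case True
  then show ?thesis using that[of 1] by simp
next
  case False
  then have "cnj (sgn w) * w = of_real (cmod w)"
    using complex_norm_square[of w] by (simp add: sgn_eq power2_eq_square field_simps)
  moreover have "cmod (cnj (sgn w)) = 1" using False by (simp add: norm_sgn)
  ultimately show ?thesis by (rule that[rotated])
qed

text \<open>If the unimodular constant \<open>c\<close> makes \<open>c f\<close> nonnegative at a point, then the real part of \<open>c f\<close> lies
below \<open>\<bar>f\<bar>\<close> and touches it there.  It is also the real part of the holomorphic function
\<open>c h + cnj c * g\<close>, whose derivative has modulus at least \<open>\<bar>h'\<bar> - \<bar>g'\<bar>\<close>.  The case \<open>g = 0\<close> is
the statement about the modulus of a holomorphic function.\<close>

lemma mean_growth_of_modulus_harmonic:
  assumes p: "1 \<le> p" and \<omega>: "majorant \<omega>" and hg: "h holomorphic_on \<bbbD>" "g holomorphic_on \<bbbD>"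
    and f: "\<And>w. w \<in> \<bbbD> \<Longrightarrow> f w = h w + cnj (g w)" and cont: "continuous_on closed_unit_disk f"
    and mod: "mean_modulus \<omega> p (\<lambda>z. of_real (cmod (f z)))"
    and X: "\<And>w. w \<in> \<bbbD> \<Longrightarrow> 0 \<le> X w" "\<And>w. w \<in> \<bbbD> \<Longrightarrow> X w \<le> cmod (deriv h w) - cmod (deriv g w)"
  shows "mean_growth \<omega> p X"
proof (rule mean_growth_of_touching[OF p \<omega> _ mod X(1)])
  show "continuous_on closed_unit_disk (\<lambda>z. cmod (f z))" by (intro continuous_on_norm cont)
  fix w assume w: "w \<in> \<bbbD>"
  obtain c where c: "cmod c = 1" "c * f w = of_real (cmod (f w))"
    by (rule unimodular_rotation_to_modulus)
  define \<psi> where "\<psi> v = c * h v + cnj c * g v" for v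
  have Re_\<psi>: "Re (\<psi> v) = Re (c * f v)" if "v \<in> \<bbbD>" for v
    by (simp add: \<psi>_def f[OF that] algebra_simps)
  have "deriv \<psi> w = c * deriv h w + cnj c * deriv g w"
    unfolding \<psi>_def using hg w
    by (auto intro!: DERIV_imp_deriv derivative_eq_intros holomorphic_derivI)
  then have "cmod (deriv h w) - cmod (deriv g w) \<le> cmod (deriv \<psi> w)"
    using norm_diff_ineq[of "c * deriv h w" "cnj c * deriv g w"] c by (simp add: norm_mult)
  moreover have "\<psi> holomorphic_on \<bbbD>" unfolding \<psi>_def by (intro holomorphic_intros hg)
  moreover have "Re (\<psi> v) \<le> cmod (f v)" if "v \<in> \<bbbD>" for v
    using complex_Re_le_cmod[of "c * f v"] c Re_\<psi>[OF that] by (simp add: norm_mult)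
  moreover have "Re (\<psi> w) = cmod (f w)" using Re_\<psi>[OF w] c by simp
  ultimately show "\<exists>\<psi>. \<psi> holomorphic_on \<bbbD> \<and> (\<forall>v\<in>\<bbbD>. Re (\<psi> v) \<le> cmod (f v)) \<and>
      Re (\<psi> w) = cmod (f w) \<and> X w \<le> cmod (deriv \<psi> w)"
    using X(2)[OF w] by (intro exI[of _ \<psi>]) auto
qed

text \<open>Here the touching function is \<open>\<phi>\<close> or \<open>- \<phi>\<close>, according to the sign of \<open>w\<close> at the point.\<close>

lemma mean_growth_of_abs_real_part:
  fixes w :: "complex \<Rightarrow> real"
  assumes p: "1 \<le> p" and \<omega>: "majorant \<omega>" and \<phi>: "\<phi> holomorphic_on \<bbbD>"
    and w: "\<And>z. z \<in> \<bbbD> \<Longrightarrow> w z = Re (\<phi> z)" and cont: "continuous_on closed_unit_disk w"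
    and mod: "mean_modulus \<omega> p (\<lambda>z. of_real \<bar>w z\<bar>)"
  shows "mean_growth \<omega> p (\<lambda>z. cmod (deriv \<phi> z))"
proof (rule mean_growth_of_touching[OF p \<omega> _ mod])
  show "continuous_on closed_unit_disk (\<lambda>z. \<bar>w z\<bar>)" by (intro continuous_intros cont)
  fix z assume z: "z \<in> \<bbbD>"
  define \<psi> where "\<psi> v = of_real (if w z \<ge> 0 then 1 else - 1) * \<phi> v" for v
  have "deriv \<psi> z = of_real (if w z \<ge> 0 then 1 else - 1) * deriv \<phi> z"
    unfolding \<psi>_def using \<phi> z
    by (auto intro!: DERIV_imp_deriv derivative_eq_intros holomorphic_derivI)
  then have "cmod (deriv \<psi> z) = cmod (deriv \<phi> z)" by (simp add: norm_mult)
  moreover have "\<psi> holomorphic_on \<bbbD>" unfolding \<psi>_def by (intro holomorphic_intros \<phi>)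
  moreover have "Re (\<psi> v) \<le> \<bar>w v\<bar>" if "v \<in> \<bbbD>" for v
    using w[OF that] by (auto simp: \<psi>_def abs_ge_self abs_ge_minus_self)
  moreover have "Re (\<psi> z) = \<bar>w z\<bar>" using w[OF z] by (simp add: \<psi>_def)
  ultimately show "\<exists>\<psi>. \<psi> holomorphic_on \<bbbD> \<and> (\<forall>v\<in>\<bbbD>. Re (\<psi> v) \<le> \<bar>w v\<bar>) \<and>
      Re (\<psi> z) = \<bar>w z\<bar> \<and> cmod (deriv \<phi> z) \<le> cmod (deriv \<psi> z)"
    by (intro exI[of _ \<psi>]) auto
qed simp

text \<open>The distortion inequality holds almost everywhere by definition.  Both sides are continuous for a
harmonic mapping, so the set where it fails is open; being a null set, it is empty.\<close>

lemma quasiregular_dilatation_bound: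
  assumes qr: "quasiregular_on K f \<bbbD>" and hg: "h holomorphic_on \<bbbD>" "g holomorphic_on \<bbbD>"
    and f: "\<And>w. w \<in> \<bbbD> \<Longrightarrow> f w = h w + cnj (g w)" and z: "z \<in> \<bbbD>"
  shows "cmod (deriv h z) + cmod (deriv g z) \<le> K * (cmod (deriv h z) - cmod (deriv g z))"
proof -
  define a b where "a w = cmod (deriv h w)" and "b w = cmod (deriv g w)" for w
  define E where "E = {w \<in> \<bbbD>. K * ((a w)\<^sup>2 - (b w)\<^sup>2) < (a w + b w)\<^sup>2}"
  have cont: "continuous_on \<bbbD> a" "continuous_on \<bbbD> b"
    unfolding a_def b_def
    by (intro continuous_on_norm holomorphic_on_imp_continuous_on holomorphic_deriv hg open_ball)+
  have "open E"
  proof -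
    have "E = \<bbbD> \<inter> (\<lambda>w. (a w + b w)\<^sup>2 - K * ((a w)\<^sup>2 - (b w)\<^sup>2)) -` {0<..}"
      by (auto simp: E_def)
    moreover have "open \<dots>"
      by (intro continuous_open_preimage continuous_intros cont) auto
    ultimately show ?thesis by simp
  qed
  have "AE w in lborel. w \<in> \<bbbD> \<longrightarrow> (max_deriv f w)\<^sup>2 \<le> K * jacobian f w"
    using qr by (simp add: quasiregular_on_def)
  then have "AE w in lborel. w \<notin> E"
  proof (rule AE_mp, intro AE_I2 impI)
    fix w assume "w \<in> \<bbbD> \<longrightarrow> (max_deriv f w)\<^sup>2 \<le> K * jacobian f w"
    moreover have "wirtinger f w = deriv h w" "wirtinger_bar f w = cnj (deriv g w)" if "w \<in> \<bbbD>"
      using wirtinger_harmonic[OF hg _ that, of f] f by blast+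
    ultimately show "w \<notin> E"
      by (auto simp: E_def a_def b_def max_deriv_def jacobian_def)
  qed
  then have "E \<in> null_sets lborel"
    using \<open>open E\<close> by (simp add: AE_iff_null_sets)
  then have "E \<in> null_sets lebesgue" by (rule null_sets_completionI)
  then have "E = {}"
    using open_not_negligible[OF \<open>open E\<close>] by (auto simp: negligible_iff_null_sets)
  then have "(a z + b z)\<^sup>2 \<le> K * ((a z)\<^sup>2 - (b z)\<^sup>2)"
    using z by (auto simp: E_def)
  then have le: "(a z + b z) * (a z + b z) \<le> K * (a z - b z) * (a z + b z)"
    by (simp add: power2_eq_square algebra_simps)
  have "0 \<le> a z" "0 \<le> b z" by (simp_all add: a_def b_def)
  have "a z + b z \<le> K * (a z - b z)"
  proof (cases "a z + b z = 0")
    case True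
    then have "a z = 0" "b z = 0" using \<open>0 \<le> a z\<close> \<open>0 \<le> b z\<close> by auto
    then show ?thesis by simp
  next
    case False
    then have "0 < a z + b z" using \<open>0 \<le> a z\<close> \<open>0 \<le> b z\<close> by auto
    then show ?thesis using le by (simp only: mult_le_cancel_right_pos)
  qed
  then show ?thesis by (simp add: a_def b_def)
qed

section \<open>The equivalences\<close>

theorem theorem2p3:
  fixes p :: ereal and \<omega> :: "real \<Rightarrow> real"
    and f h g :: "complex \<Rightarrow> complex" and u v :: "complex \<Rightarrow> real"
  assumes "1 \<le> p"
    and "fast_majorant \<omega>"
    and "harmonic_on f \<bbbD>"
    and "continuous_on closed_unit_disk f"
    and "h \<in> disk_algebra" and "g \<in> disk_algebra"
    and "\<And>z. z \<in> closed_unit_disk \<Longrightarrow> f z = h z + cnj (g z)"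
    and "\<And>z. z \<in> closed_unit_disk \<Longrightarrow> f z = of_real (u z) + \<i> * of_real (v z)"
  defines "A1 \<equiv> \<exists>M>0. \<forall>z\<in>\<bbbD>. deriv_mean p f z \<le> M * (\<omega> (dist_bdry z) / dist_bdry z)"
    and "A2 \<equiv> f \<in> Lip_class \<omega> p"
    and "A3 \<equiv> h \<in> Lip_class \<omega> p \<and> g \<in> Lip_class \<omega> p"
    and "A4 \<equiv> (\<lambda>z. of_real (cmod (h z))) \<in> Lip_class \<omega> p \<and>
               (\<lambda>z. of_real (cmod (g z))) \<in> Lip_class \<omega> p"
    and "A5 \<equiv> (\<lambda>z. of_real (cmod (f z))) \<in> Lip_class \<omega> p"
    and "A6 \<equiv> (\<lambda>z. of_real (u z)) \<in> Lip_class \<omega> p"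
    and "A7 \<equiv> (\<lambda>z. of_real \<bar>u z\<bar>) \<in> Lip_class \<omega> p"
    and "A8 \<equiv> (\<lambda>z. of_real (v z)) \<in> Lip_class \<omega> p"
    and "A9 \<equiv> (\<lambda>z. of_real \<bar>v z\<bar>) \<in> Lip_class \<omega> p"
    and "A10 \<equiv> \<lambda>q. \<exists>M>0. \<forall>z\<in>\<bbbD>. Y_mean u q p z \<le> M * (\<omega> (dist_bdry z) / dist_bdry z)"
    and "A11 \<equiv> \<lambda>q. \<exists>M>0. \<forall>z\<in>\<bbbD>. Y_mean v q p z \<le> M * (\<omega> (dist_bdry z) / dist_bdry z)"
  shows "(A1 \<longleftrightarrow> A2) \<and> (A1 \<longleftrightarrow> A3) \<and> (A1 \<longleftrightarrow> A4) \<and>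
    (\<forall>K q :: real. 1 \<le> K \<and> quasiregular_on K f \<bbbD> \<and> 0 < q \<and> ereal q \<le> p \<longrightarrow>
       (A1 \<longleftrightarrow> A5) \<and> (A1 \<longleftrightarrow> A6) \<and> (A1 \<longleftrightarrow> A7) \<and> (A1 \<longleftrightarrow> A8) \<and> (A1 \<longleftrightarrow> A9) \<and>
       (A1 \<longleftrightarrow> A10 q) \<and> (A1 \<longleftrightarrow> A11 q))"
proof -
  note p = assms(1) and fast = assms(2) and f_cont = assms(4) and h = assms(5) and g = assms(6)
    and f = assms(7) and uv = assms(8)
  have \<omega>: "majorant \<omega>" using fast by (simp add: fast_majorant_def)
  have hol: "h holomorphic_on \<bbbD>" "g holomorphic_on \<bbbD>"
    and cont: "continuous_on closed_unit_disk h" "continuous_on closed_unit_disk g"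
    using h g by (auto simp: disk_algebra_def)
  have fD: "f z = h z + cnj (g z)" if "z \<in> \<bbbD>" for z using f[of z] that by simp
  have u: "u z = Re (f z)" and v: "v z = Im (f z)" if "z \<in> closed_unit_disk" for z
    using uv[OF that] by simp_all
  have u_cont: "continuous_on closed_unit_disk u"
    using continuous_on_Re[OF f_cont] by (rule continuous_on_eq) (simp add: u)
  have v_cont: "continuous_on closed_unit_disk v"
    using continuous_on_Im[OF f_cont] by (rule continuous_on_eq) (simp add: v)
  \<comment> \<open>As \<open>Im (cnj g) = - Im g\<close>, \<open>v\<close> is the imaginary part of the holomorphic function \<open>h - g\<close>.\<close>
  define \<phi> \<psi> where "\<phi> z = h z + g z" and "\<psi> z = - \<i> * (h z - g z)" for z
  have \<phi>\<psi>_hol: "\<phi> holomorphic_on \<bbbD>" "\<psi> holomorphic_on \<bbbD>"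
    unfolding \<phi>_def \<psi>_def by (intro holomorphic_intros hol)+
  have u_Re: "u z = Re (\<phi> z)" and v_Re: "v z = Re (\<psi> z)" if "z \<in> \<bbbD>" for z
    using that u[of z] v[of z] by (simp_all add: fD \<phi>_def \<psi>_def)
  have d\<phi>: "deriv \<phi> z = deriv h z + deriv g z" and d\<psi>: "deriv \<psi> z = - \<i> * (deriv h z - deriv g z)"
    if "z \<in> \<bbbD>" for z
    unfolding \<phi>_def \<psi>_def
    by (intro DERIV_imp_deriv DERIV_cmult DERIV_add DERIV_diff holomorphic_derivI[OF _ open_ball that] hol)+
  define H G P Q where "H z = cmod (deriv h z)" and "G z = cmod (deriv g z)"
    and "P z = cmod (deriv \<phi> z)" and "Q z = cmod (deriv \<psi> z)" for z
  have HGPQ_cont: "continuous_on \<bbbD> H" "continuous_on \<bbbD> G" "continuous_on \<bbbD> P" "continuous_on \<bbbD> Q"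
    unfolding H_def G_def P_def Q_def
    by (intro continuous_on_norm holomorphic_on_imp_continuous_on holomorphic_deriv hol \<phi>\<psi>_hol open_ball)+
  have HGPQ_nonneg: "0 \<le> H z" "0 \<le> G z" "0 \<le> P z" "0 \<le> Q z" for z
    by (simp_all add: H_def G_def P_def Q_def)
  have max_deriv_f: "max_deriv f z = H z + G z" if "z \<in> \<bbbD>" for z
    using wirtinger_harmonic[OF hol _ that, of f] fD by (simp add: max_deriv_def H_def G_def)
  have max_deriv_cont: "continuous_on \<bbbD> (max_deriv f)"
    by (rule continuous_on_eq[OF continuous_on_add[OF HGPQ_cont(1,2)]]) (simp add: max_deriv_f)
  have P_le: "P z \<le> H z + G z" and Q_le: "Q z \<le> H z + G z" if "z \<in> \<bbbD>" for z
    unfolding P_def Q_def H_def G_def d\<phi>[OF that] d\<psi>[OF that]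
    by (simp_all add: norm_mult norm_triangle_ineq norm_triangle_ineq4)
  have H_le: "H z \<le> P z + Q z" and G_le: "G z \<le> P z + Q z" if "z \<in> \<bbbD>" for z
  proof -
    have PQ: "P z = cmod (deriv h z + deriv g z)" "Q z = cmod (deriv h z - deriv g z)"
      by (simp_all add: P_def Q_def d\<phi>[OF that] d\<psi>[OF that] norm_mult)
    have "2 * H z = cmod ((deriv h z + deriv g z) + (deriv h z - deriv g z))"
      by (simp add: H_def norm_mult flip: mult_2)
    then have "2 * H z \<le> P z + Q z"
      unfolding PQ using norm_triangle_ineq by metis
    moreover have "2 * G z = cmod ((deriv h z + deriv g z) - (deriv h z - deriv g z))"
      by (simp add: G_def norm_mult flip: mult_2)
    then have "2 * G z \<le> P z + Q z"
      unfolding PQ using norm_triangle_ineq4 by metis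
    ultimately show "H z \<le> P z + Q z" "G z \<le> P z + Q z"
      using HGPQ_nonneg[of z] by linarith+
  qed

  have A1: "A1 \<longleftrightarrow> mean_growth \<omega> p (max_deriv f)"
    unfolding A1_def by (rule deriv_mean_bounds_iff_mean_growth[OF p \<omega> max_deriv_cont])
  note modulus = Lip_class_iff_mean_modulus[OF p \<omega>]
  have A2: "A2 \<longleftrightarrow> mean_modulus \<omega> p f"
    unfolding A2_def by (rule modulus[OF f_cont])
  have A3: "A3 \<longleftrightarrow> mean_modulus \<omega> p h \<and> mean_modulus \<omega> p g"
    unfolding A3_def by (simp add: modulus cont)
  have A4: "A4 \<longleftrightarrow> mean_modulus \<omega> p (\<lambda>z. of_real (cmod (h z))) \<and> mean_modulus \<omega> p (\<lambda>z. of_real (cmod (g z)))"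
    unfolding A4_def by (simp add: modulus continuous_intros cont)
  have A5: "A5 \<longleftrightarrow> mean_modulus \<omega> p (\<lambda>z. of_real (cmod (f z)))"
    unfolding A5_def by (intro modulus continuous_intros f_cont)
  have A6: "A6 \<longleftrightarrow> mean_modulus \<omega> p (\<lambda>z. of_real (u z))"
    unfolding A6_def by (intro modulus continuous_intros u_cont)
  have A7: "A7 \<longleftrightarrow> mean_modulus \<omega> p (\<lambda>z. of_real \<bar>u z\<bar>)"
    unfolding A7_def by (intro modulus continuous_intros u_cont)
  have A8: "A8 \<longleftrightarrow> mean_modulus \<omega> p (\<lambda>z. of_real (v z))"
    unfolding A8_def by (intro modulus continuous_intros v_cont)
  have A9: "A9 \<longleftrightarrow> mean_modulus \<omega> p (\<lambda>z. of_real \<bar>v z\<bar>)"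
    unfolding A9_def by (intro modulus continuous_intros v_cont)

  have A1_iff: "A1 \<longleftrightarrow> mean_growth \<omega> p H \<and> mean_growth \<omega> p G"
  proof (intro iffI conjI)
    assume A1
    then have growth: "mean_growth \<omega> p (max_deriv f)" by (simp add: A1)
    show "mean_growth \<omega> p H" "mean_growth \<omega> p G"
      using HGPQ_nonneg
      by (auto intro!: mean_growth_mono[OF p \<omega> growth, of _ 1] max_deriv_cont simp: max_deriv_f)
  next
    assume "mean_growth \<omega> p H \<and> mean_growth \<omega> p G"
    then have growth: "mean_growth \<omega> p (\<lambda>z. H z + G z)"
      using HGPQ_cont HGPQ_nonneg by (intro mean_growth_add[OF p \<omega>]) auto
    have "mean_growth \<omega> p (max_deriv f)"
      using HGPQ_nonneg
      by (intro mean_growth_mono[OF p \<omega> growth, of _ 1] continuous_intros HGPQ_cont)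
         (auto simp: max_deriv_f)
    then show A1 by (simp add: A1)
  qed
  have A1_of_PQ: A1 if PQ: "mean_growth \<omega> p P" "mean_growth \<omega> p Q"
  proof -
    have growth: "mean_growth \<omega> p (\<lambda>z. P z + Q z)"
      using HGPQ_cont HGPQ_nonneg by (intro mean_growth_add[OF p \<omega> PQ]) auto
    have "mean_growth \<omega> p H" "mean_growth \<omega> p G"
      using HGPQ_nonneg H_le G_le
      by (auto intro!: mean_growth_mono[OF p \<omega> growth, of _ 1] continuous_intros HGPQ_cont)
    then show A1 by (simp add: A1_iff)
  qed

  \<comment> \<open>The growth condition gives smoothness of both parts, hence of everything built from them.\<close>
  have A1_A3: A3 if A1
    using that mean_modulus_of_growth[OF p fast h] mean_modulus_of_growth[OF p fast g]
    by (simp add: A1_iff A3 H_def[abs_def] G_def[abs_def])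
  have A3_A2: A2 if A3
  proof -
    have "mean_modulus \<omega> p h" "mean_modulus \<omega> p g" using that by (auto simp: A3)
    moreover from this(2) have "mean_modulus \<omega> p (\<lambda>z. cnj (g z))"
      by (rule mean_modulus_mono[OF p \<omega>]) (simp flip: complex_cnj_diff)
    ultimately have sum: "mean_modulus \<omega> p (\<lambda>z. h z + cnj (g z))"
      by (intro mean_modulus_add[OF p \<omega>] cont continuous_intros)
    have "mean_modulus \<omega> p f"
      by (rule mean_modulus_mono[OF p \<omega> sum]) (simp add: f)
    then show A2 by (simp add: A2)
  qed
  have modulus_cmod: "mean_modulus \<omega> p (\<lambda>z. of_real (cmod (F z)))" if "mean_modulus \<omega> p F" for F
    using that by (rule mean_modulus_mono[OF p \<omega>]) (simp add: norm_triangle_ineq3 flip: of_real_diff)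
  have A3_A4: A4 if A3
    using that unfolding A3 A4 by (simp add: modulus_cmod)
  have A4_A1: A1 if A4
  proof -
    have *: "mean_growth \<omega> p (\<lambda>z. cmod (deriv k z))"
      if "k holomorphic_on \<bbbD>" "continuous_on closed_unit_disk k"
        "mean_modulus \<omega> p (\<lambda>z. of_real (cmod (k z)))" for k
      by (rule mean_growth_of_modulus_harmonic[OF p \<omega> that(1) holomorphic_on_const[of 0] _ that(2,3)]) simp_all
    have "mean_growth \<omega> p H" "mean_growth \<omega> p G"
      unfolding H_def[abs_def] G_def[abs_def] using that hol cont by (auto simp: A4 intro: *)
    then show A1 by (simp add: A1_iff)
  qed
  have A2_A6: A6 if A2
    using that unfolding A2 A6
    by (rule mean_modulus_mono[OF p \<omega>])
       (simp add: u abs_Re_le_cmod flip: of_real_diff minus_complex.sel)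
  have A2_A8: A8 if A2
    using that unfolding A2 A8
    by (rule mean_modulus_mono[OF p \<omega>])
       (simp add: v abs_Im_le_cmod flip: of_real_diff minus_complex.sel)
  have A2_A5: A5 if A2
    using that unfolding A2 A5 by (rule modulus_cmod)
  have A6_A7: A7 if A6
    using that unfolding A6 A7
    by (rule mean_modulus_mono[OF p \<omega>]) (simp add: abs_triangle_ineq3 flip: of_real_diff)
  have A8_A9: A9 if A8
    using that unfolding A8 A9
    by (rule mean_modulus_mono[OF p \<omega>]) (simp add: abs_triangle_ineq3 flip: of_real_diff)
  \<comment> \<open>Conversely, smoothness of \<open>\<bar>u\<bar>\<close> or \<open>\<bar>v\<bar>\<close> bounds the derivative of the corresponding holomorphic function; together they recover \<open>h'\<close> and \<open>g'\<close>.\<close>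
  have A7_P: "mean_growth \<omega> p P" if A7
    using that mean_growth_of_abs_real_part[OF p \<omega> \<phi>\<psi>_hol(1) u_Re u_cont]
    by (simp add: A7 P_def[abs_def])
  have A9_Q: "mean_growth \<omega> p Q" if A9
    using that mean_growth_of_abs_real_part[OF p \<omega> \<phi>\<psi>_hol(2) v_Re v_cont]
    by (simp add: A9 Q_def[abs_def])
  have A2_A1: A1 if A2
    using that A2_A6 A2_A8 A6_A7 A8_A9 A7_P A9_Q A1_of_PQ by blast
  have first: "(A1 \<longleftrightarrow> A2) \<and> (A1 \<longleftrightarrow> A3) \<and> (A1 \<longleftrightarrow> A4)"
    using A1_A3 A3_A2 A3_A4 A4_A1 A2_A1 by blast

  have A1_P: "mean_growth \<omega> p P" and A1_Q: "mean_growth \<omega> p Q" if A1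
  proof -
    have growth: "mean_growth \<omega> p (max_deriv f)" using that by (simp add: A1)
    show "mean_growth \<omega> p P" "mean_growth \<omega> p Q"
      using HGPQ_nonneg P_le Q_le
      by (auto intro!: mean_growth_mono[OF p \<omega> growth, of _ 1] max_deriv_cont simp: max_deriv_f)
  qed
  have second: "(A1 \<longleftrightarrow> A5) \<and> (A1 \<longleftrightarrow> A6) \<and> (A1 \<longleftrightarrow> A7) \<and> (A1 \<longleftrightarrow> A8) \<and> (A1 \<longleftrightarrow> A9) \<and>
       (A1 \<longleftrightarrow> A10 q) \<and> (A1 \<longleftrightarrow> A11 q)"
    if K: "1 \<le> K" and qr: "quasiregular_on K f \<bbbD>" and q: "0 < q" "ereal q \<le> p" for K q
  proof -
    \<comment> \<open>In the quasiregular case any bound for \<open>\<bar>h'\<bar> - \<bar>g'\<bar>\<close> is a bound for \<open>\<bar>h'\<bar> + \<bar>g'\<bar>\<close>, so one of \<open>u\<close>, \<open>v\<close>, \<open>\<bar>f\<bar>\<close> is enough.\<close>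
    have dil: "H z + G z \<le> K * (H z - G z)" if "z \<in> \<bbbD>" for z
      unfolding H_def G_def by (rule quasiregular_dilatation_bound[OF qr hol fD that])
    have diff_nonneg: "0 \<le> H z - G z" if "z \<in> \<bbbD>" for z
    proof -
      have "0 \<le> K * (H z - G z)" using dil[OF that] HGPQ_nonneg[of z] by linarith
      then show ?thesis using K by (simp add: zero_le_mult_iff)
    qed
    have A1_of_dominating: A1
      if growth: "mean_growth \<omega> p X" and "continuous_on \<bbbD> X" and X: "\<And>z. z \<in> \<bbbD> \<Longrightarrow> H z - G z \<le> X z" for X
    proof -
      have "mean_growth \<omega> p (max_deriv f)"
      proof (rule mean_growth_mono[OF p \<omega> growth, of _ K])
        fix z assume z: "z \<in> \<bbbD>"
        show "0 \<le> max_deriv f z" using HGPQ_nonneg by (simp add: max_deriv_f[OF z])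
        show "0 \<le> X z" using diff_nonneg[OF z] X[OF z] by linarith
        have "K * (H z - G z) \<le> K * X z" using K X[OF z] by (intro mult_left_mono) auto
        then show "max_deriv f z \<le> K * X z" using dil[OF z] by (simp add: max_deriv_f[OF z])
      qed (use that K in auto)
      then show A1 by (simp add: A1)
    qed
    have PQ_lower: "H z - G z \<le> P z" "H z - G z \<le> Q z" if "z \<in> \<bbbD>" for z
      using norm_diff_ineq[of "deriv h z" "deriv g z"] norm_triangle_ineq2[of "deriv h z" "deriv g z"]
      by (simp_all add: H_def G_def P_def Q_def d\<phi>[OF that] d\<psi>[OF that] norm_mult)
    have P_A1: A1 if "mean_growth \<omega> p P"
      using that HGPQ_cont(3) PQ_lower(1) by (rule A1_of_dominating)
    have Q_A1: A1 if "mean_growth \<omega> p Q"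
      using that HGPQ_cont(4) PQ_lower(2) by (rule A1_of_dominating)
    have A5_A1: A1 if A5
    proof (rule A1_of_dominating[of "\<lambda>z. H z - G z"])
      show "mean_growth \<omega> p (\<lambda>z. H z - G z)"
        using that diff_nonneg
        by (intro mean_growth_of_modulus_harmonic[OF p \<omega> hol fD f_cont]) (auto simp: A5 H_def G_def)
    qed (auto intro!: continuous_intros HGPQ_cont)
    have A10: "A10 q \<longleftrightarrow> mean_growth \<omega> p P"
      unfolding A10_def P_def[abs_def]
      by (rule Y_mean_bounds_iff_mean_growth[OF p \<omega> \<phi>\<psi>_hol(1) q u_Re])
    have A11: "A11 q \<longleftrightarrow> mean_growth \<omega> p Q"
      unfolding A11_def Q_def[abs_def]
      by (rule Y_mean_bounds_iff_mean_growth[OF p \<omega> \<phi>\<psi>_hol(2) q v_Re])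
    show ?thesis
      unfolding A10 A11
      using first A2_A5 A5_A1 A2_A6 A6_A7 A7_P P_A1 A2_A8 A8_A9 A9_Q Q_A1 A1_P A1_Q by blast
  qed
  from first second show ?thesis by blast
qed

end
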